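(* Let $n\ge3$ and let $p\ge1$ be an integer. A map $\mu:\mathcal{P}_o^n\to\operatorname{Sym}^p(\mathbb{R}^n)$ is an $\operatorname{SL}(n)$ contravariant valuation if and only if there exists a Cauchy function $\xi:(0,\infty)\to\mathbb{R}$ such that $$\mu(P)=M_\xi^{0,p}(P)$$ for every $P\in\mathcal{P}_o^n$.
   Context: $\mathcal{P}_o^n$ is the set of (convex) polytopes in $\mathbb{R}^n$ (of any dimension) that contain the origin $o$. $\operatorname{Sym}^p(\mathbb{R}^n)$ is the space of symmetric tensors of order $p$ on $\mathbb{R}^n$; a tensor of order $p$ is identified with a multilinear function on $(\mathbb{R}^n)^p$, and a symmetric tensor $\mathbf{t}$ is identified by its action $\langle\mathbf{t},x^p\rangle$ on $x^p$, $x\in\mathbb{R}^n$, where $x^p$ is the $p$-fold tensor product of $x$ (in particular $\langle u^p,x^p\rangle=(x\cdot u)^p$). For an invertible matrix $\phi$ of determinant $1$, $\phi\mathbf{t}$ is defined by $\langle\phi\mathbf{t},x^p\rangle=\langle\mathbf{t},(\phi^tx)^p\rangle$ for all $x\in\mathbb{R}^n$, where $\phi^t$ is the transpose. $\mu$ is $\operatorname{SL}(n)$ contravariant if $\mu(\phi P)=\phi^{-t}\mu(P)$ for all $\phi\in\operatorname{SL}(n)$ and $P\in\mathcal{P}_o^n$; it is a valuation if $\mu(P)+\mu(Q)=\mu(P\cup Q)+\mu(P\cap Q)$ whenever $P,Q,P\cup Q,P\cap Q\in\mathcal{P}_o^n$. A function $\xi:(0,\infty)\to\mathbb{R}$ is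 a Cauchy function if $\xi(r+s)=\xi(r)+\xi(s)$ for all $r,s>0$ (no regularity assumed). For a polytope $P$, $h_P(u)=\max\{u\cdot y:y\in P\}$ is the support function. $\mathcal{N}(P)$ is the set of outer unit normals of facets of $P$, i.e. of unit vectors $u$ for which the face $\{y\in P:y\cdot u=h_P(u)\}$ has dimension $n-1$; $S_P(u)$ is the $(n-1)$-dimensional volume of that face; $V_P(u)=\frac1nh_P(u)S_P(u)$ (cone-volume measure); and $\mathcal{N}_o(P)=\{u\in\mathcal{N}(P):h_P(u)\ne0\}$ is the set of normals of facets whose affine hulls do not contain the origin. Then $$M_\xi^{0,p}(P)=\sum_{u\in\mathcal{N}_o(P)}\left(\frac{u}{h_P(u)}\right)^p\xi(V_P(u)),$$ where $(\cdot)^p$ denotes the $p$-fold tensor power and the empty sum is $0$. *)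

theory Defs
  imports "HOL-Analysis.Analysis"
begin

section \<open>Symmetric tensors\<close>

text \<open>
  A tensor of order \<open>p\<close> on \<open>real ^ 'n\<close> is a multilinear function of \<open>p\<close> vectors.  The argument
  tuple is a sequence \<open>x :: nat \<Rightarrow> real ^ 'n\<close> of which only \<open>x 0, \<dots>, x (p - 1)\<close> matter; the
  second conjunct of \<open>Sym_tensors\<close> enforces this, so that equality of elements of \<open>Sym_tensors p\<close>
  is equality of tensors.
\<close>

type_synonym 'n tensor = "(nat \<Rightarrow> real ^ 'n) \<Rightarrow> real"

definition multilinear :: "nat \<Rightarrow> 'n::finite tensor \<Rightarrow> bool" where
  "multilinear p t \<longleftrightarrow> (\<forall>x. \<forall>i<p. linear (\<lambda>v. t (x(i := v))))"

definition Sym_tensors :: "nat \<Rightarrow> 'n::finite tensor set" where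
  "Sym_tensors p = {t. multilinear p t \<and>
     (\<forall>x y. (\<forall>i<p. x i = y i) \<longrightarrow> t x = t y) \<and>
     (\<forall>\<pi> x. \<pi> permutes {..<p} \<longrightarrow> t (x \<circ> \<pi>) = t x)}"

definition tensor_power :: "real ^ 'n::finite \<Rightarrow> nat \<Rightarrow> 'n tensor" where
  "tensor_power u p = (\<lambda>x. \<Prod>i<p. x i \<bullet> u)"

text \<open>The action \<open>\<langle>\<phi> t, x\<^sup>p\<rangle> = \<langle>t, (\<phi>\<^sup>t x)\<^sup>p\<rangle>\<close>, written for the full multilinear function.\<close>

definition tensor_act :: "real ^ 'n ^ 'n \<Rightarrow> 'n::finite tensor \<Rightarrow> 'n tensor" where
  "tensor_act \<phi> t = (\<lambda>x. t (\<lambda>i. transpose \<phi> *v x i))"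

lemma tensor_act_diag: "tensor_act \<phi> t (\<lambda>_. x) = t (\<lambda>_. transpose \<phi> *v x)"
  by (simp add: tensor_act_def)

lemma tensor_power_diag: "tensor_power u p (\<lambda>_. x) = (x \<bullet> u) ^ p"
  by (simp add: tensor_power_def)

lemma tensor_act_in_Sym_tensors:
  assumes "t \<in> Sym_tensors p"
  shows "tensor_act \<phi> t \<in> Sym_tensors p"
proof -
  have lin: "linear (\<lambda>v. t (\<lambda>j. transpose \<phi> *v (x(i := v)) j))" if "i < p" for x i
  proof -
    have "linear ((\<lambda>v. t ((\<lambda>j. transpose \<phi> *v x j)(i := v))) \<circ> (\<lambda>v. transpose \<phi> *v v))"
      using assms that
      by (intro linear_compose matrix_vector_mul_linear) (auto simp: Sym_tensors_def multilinear_def)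
    moreover have "(\<lambda>j. transpose \<phi> *v x j)(i := transpose \<phi> *v v)
        = (\<lambda>j. transpose \<phi> *v (x(i := v)) j)" for v
      by (rule ext) simp
    ultimately show ?thesis by (simp only: o_def)
  qed
  have perm: "t (\<lambda>i. transpose \<phi> *v x (\<pi> i)) = t (\<lambda>i. transpose \<phi> *v x i)"
    if "\<pi> permutes {..<p}" for \<pi> x
  proof -
    have "t ((\<lambda>i. transpose \<phi> *v x i) \<circ> \<pi>) = t (\<lambda>i. transpose \<phi> *v x i)"
      using assms that by (auto simp: Sym_tensors_def)
    then show ?thesis by (simp add: o_def)
  qed
  have ext': "t (\<lambda>i. transpose \<phi> *v x i) = t (\<lambda>i. transpose \<phi> *v y i)"
    if "\<forall>i<p. x i = y i" for x y
  proof -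
    have "\<forall>x y. (\<forall>i<p. x i = y i) \<longrightarrow> t x = t y"
      using assms by (simp add: Sym_tensors_def)
    then show ?thesis using that by simp
  qed
  show ?thesis
    unfolding Sym_tensors_def multilinear_def tensor_act_def mem_Collect_eq o_def
    using lin perm ext' by blast
qed


section \<open>Contravariant valuations on polytopes containing the origin\<close>

definition polytopes_o :: "(real ^ 'n::finite) set set" where
  "polytopes_o = {P. polytope P \<and> 0 \<in> P}"

definition valuation_on :: "'a set set \<Rightarrow> ('a set \<Rightarrow> 'n::finite tensor) \<Rightarrow> bool" where
  "valuation_on \<S> \<mu> \<longleftrightarrow> (\<forall>P Q. P \<in> \<S> \<and> Q \<in> \<S> \<and> P \<union> Q \<in> \<S> \<and> P \<inter> Q \<in> \<S> \<longrightarrow>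
     (\<forall>x. \<mu> P x + \<mu> Q x = \<mu> (P \<union> Q) x + \<mu> (P \<inter> Q) x))"

definition SL_contravariant :: "((real ^ 'n::finite) set \<Rightarrow> 'n tensor) \<Rightarrow> bool" where
  "SL_contravariant \<mu> \<longleftrightarrow> (\<forall>\<phi> :: real ^ 'n ^ 'n. \<forall>P \<in> polytopes_o. det \<phi> = 1 \<longrightarrow>
     \<mu> ((\<lambda>x. \<phi> *v x) ` P) = tensor_act (transpose (matrix_inv \<phi>)) (\<mu> P))"

text \<open>Only the values of \<open>\<xi>\<close> on the positive reals are meaningful.\<close>

definition Cauchy_function :: "(real \<Rightarrow> real) \<Rightarrow> bool" where
  "Cauchy_function \<xi> \<longleftrightarrow> (\<forall>r>0. \<forall>s>0. \<xi> (r + s) = \<xi> r + \<xi> s)"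


section \<open>Facets and the cone-volume measure\<close>

definition support_fun :: "(real ^ 'n::finite) set \<Rightarrow> real ^ 'n \<Rightarrow> real" where
  "support_fun P u = (SUP y\<in>P. u \<bullet> y)"

definition support_face :: "(real ^ 'n::finite) set \<Rightarrow> real ^ 'n \<Rightarrow> (real ^ 'n) set" where
  "support_face P u = {y \<in> P. y \<bullet> u = support_fun P u}"

definition facet_normals :: "(real ^ 'n::finite) set \<Rightarrow> (real ^ 'n) set" where
  "facet_normals P = {u. norm u = 1 \<and> aff_dim (support_face P u) = int CARD('n) - 1}"

definition facet_normals_o :: "(real ^ 'n::finite) set \<Rightarrow> (real ^ 'n) set" where
  "facet_normals_o P = {u \<in> facet_normals P. support_fun P u \<noteq> 0}"

text \<open>
  The \<open>(n - 1)\<close>-dimensional volume of a set \<open>F\<close> lying in a hyperplane with normal \<open>u\<close>: the hyperplane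
  is identified isometrically with \<open>(n - 1)\<close>-dimensional Euclidean space by taking coordinates with
  respect to an orthonormal basis of the orthogonal complement of \<open>u\<close>, and \<open>F\<close> is measured there by
  Lebesgue measure.  The result does not depend on the basis, as Lebesgue measure is invariant under
  orthogonal maps.
\<close>

definition orthonormal_basis_perp :: "real ^ 'n::finite \<Rightarrow> (real ^ 'n) set \<Rightarrow> bool" where
  "orthonormal_basis_perp u B \<longleftrightarrow>
     pairwise orthogonal B \<and> (\<forall>b\<in>B. norm b = 1) \<and> span B = {x. u \<bullet> x = 0}"

definition hyperplane_volume :: "real ^ 'n::finite \<Rightarrow> (real ^ 'n) set \<Rightarrow> real" where
  "hyperplane_volume u F =
     (let B = (SOME B. orthonormal_basis_perp u B)
      in measure (\<Pi>\<^sub>M b\<in>B. lborel) ((\<lambda>y. \<lambda>b\<in>B. y \<bullet> b) ` F))"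

definition surface_area :: "(real ^ 'n::finite) set \<Rightarrow> real ^ 'n \<Rightarrow> real" where
  "surface_area P u = hyperplane_volume u (support_face P u)"

definition cone_volume :: "(real ^ 'n::finite) set \<Rightarrow> real ^ 'n \<Rightarrow> real" where
  "cone_volume P u = 1 / real CARD('n) * support_fun P u * surface_area P u"

definition M0 :: "(real \<Rightarrow> real) \<Rightarrow> nat \<Rightarrow> (real ^ 'n::finite) set \<Rightarrow> 'n tensor" where
  "M0 \<xi> p P = (\<lambda>x. \<Sum>u\<in>facet_normals_o P.
     tensor_power (u /\<^sub>R support_fun P u) p x * \<xi> (cone_volume P u))"


subsection \<open>Well-definedness\<close>

lemma orthonormal_basis_perp_exists: "\<exists>B. orthonormal_basis_perp u B"
proof -
  obtain B where "pairwise orthogonal B" "\<And>x. x \<in> B \<Longrightarrow> norm x = 1" "span B = {x. u \<bullet> x = 0}"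
    by (rule orthonormal_basis_subspace[OF subspace_hyperplane[of u]]) blast
  then show ?thesis unfolding orthonormal_basis_perp_def by blast
qed

lemma orthonormal_basis_perp_card:
  fixes u :: "real ^ 'n::finite"
  assumes "orthonormal_basis_perp u B" "u \<noteq> 0"
  shows "finite B" "card B = CARD('n) - 1"
proof -
  have "0 \<notin> B" using assms(1) by (auto simp: orthonormal_basis_perp_def)
  then have ind: "independent B"
    using assms(1) pairwise_orthogonal_independent by (auto simp: orthonormal_basis_perp_def)
  then show "finite B" using independent_imp_finite by blast
  have "card B = dim (span B)" using ind by (simp add: dim_eq_card_independent)
  also have "\<dots> = CARD('n) - 1"
    using assms dim_hyperplane[of u] by (simp add: orthonormal_basis_perp_def)
  finally show "card B = CARD('n) - 1" .
qed

lemma support_fun_upper: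
  assumes "compact P" "y \<in> P"
  shows "u \<bullet> y \<le> support_fun P u"
proof -
  have "compact ((\<lambda>y. u \<bullet> y) ` P)"
    by (intro compact_continuous_image continuous_intros assms)
  then have "bdd_above ((\<lambda>y. u \<bullet> y) ` P)"
    by (intro bounded_imp_bdd_above compact_imp_bounded)
  then show ?thesis unfolding support_fun_def using assms(2) by (rule cSUP_upper[rotated])
qed

lemma support_fun_attained:
  assumes "compact P" "P \<noteq> {}"
  obtains y where "y \<in> P" "u \<bullet> y = support_fun P u"
proof -
  obtain y where y: "y \<in> P" "\<And>z. z \<in> P \<Longrightarrow> u \<bullet> z \<le> u \<bullet> y"
    using continuous_attains_sup[OF assms, of "\<lambda>y. u \<bullet> y"]
      continuous_on_inner[OF continuous_on_const continuous_on_id] by blast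
  then have "support_fun P u \<le> u \<bullet> y"
    unfolding support_fun_def using assms(2) by (intro cSUP_least) auto
  with support_fun_upper[OF assms(1) y(1), of u] y(1) that show ?thesis by auto
qed

lemma finite_facet_normals_o:
  fixes P :: "(real ^ 'n::finite) set"
  assumes "P \<in> polytopes_o"
  shows "finite (facet_normals_o P)"
proof (rule finite_imageD)
  have P: "polytope P" "0 \<in> P" using assms by (auto simp: polytopes_o_def)
  have cp: "compact P" and cv: "convex P"
    using P polytope_imp_compact polytope_imp_convex by auto
  have "support_face P u face_of P" for u
    using face_of_Int_supporting_hyperplane_le[OF cv, of u "support_fun P u"] support_fun_upper[OF cp]
    by (simp add: support_face_def Int_def inner_commute)
  then have "support_face P ` facet_normals_o P \<subseteq> {F. F face_of P}" by auto
  then show "finite (support_face P ` facet_normals_o P)"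
    using finite_polytope_faces[OF P(1)] finite_subset by blast
  show "inj_on (support_face P) (facet_normals_o P)"
  proof (rule inj_onI)
    fix u v assume uv: "u \<in> facet_normals_o P" "v \<in> facet_normals_o P"
      and eq: "support_face P u = support_face P v"
    have aff: "affine hull (support_face P w) = {x. w \<bullet> x = support_fun P w}"
      if "w \<in> facet_normals_o P" for w
    proof (rule affine_dim_equal)
      have w: "w \<noteq> 0" and d: "aff_dim (support_face P w) = int CARD('n) - 1"
        using that by (auto simp: facet_normals_o_def facet_normals_def)
      show "affine hull (support_face P w) \<subseteq> {x. w \<bullet> x = support_fun P w}"
        using affine_hyperplane[of w "support_fun P w"]
        by (intro hull_minimal) (auto simp: support_face_def inner_commute)
      show "aff_dim (affine hull (support_face P w)) = aff_dim {x. w \<bullet> x = support_fun P w}"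
        using w d by (simp add: aff_dim_hyperplane)
      have "aff_dim (support_face P w) \<noteq> - 1" using d by simp
      then show "affine hull (support_face P w) \<noteq> {}" by (auto simp: aff_dim_empty)
    qed (auto simp: affine_hyperplane)
    define a b where "a = support_fun P u" and "b = support_fun P v"
    have hyp: "u \<bullet> x = a \<longleftrightarrow> v \<bullet> x = b" for x
      using aff[OF uv(1)] aff[OF uv(2)] eq by (auto simp: a_def b_def)
    have pos: "support_fun P w > 0" if "w \<in> facet_normals_o P" for w
      using that support_fun_upper[OF cp P(2), of w] by (auto simp: facet_normals_o_def)
    have ab: "a > 0" "b > 0" using pos uv by (auto simp: a_def b_def)
    have n: "u \<bullet> u = 1" "v \<bullet> v = 1"
      using uv by (auto simp: facet_normals_o_def facet_normals_def dot_square_norm)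
    have 1: "a * (u \<bullet> v) = b" using hyp[of "a *\<^sub>R u"] n by (simp add: inner_commute)
    have 2: "b * (u \<bullet> v) = a" using hyp[of "b *\<^sub>R v"] n by simp
    from 1 ab have cpos: "u \<bullet> v > 0" by (metis zero_less_mult_pos)
    have "a * (u \<bullet> v) * (u \<bullet> v) = a" using 1 2 by simp
    then have "(u \<bullet> v)\<^sup>2 = 1" using ab by (simp add: power2_eq_square)
    with cpos have "u \<bullet> v = 1" by (simp add: power2_eq_1_iff)
    then have "(u - v) \<bullet> (u - v) = 0" using n by (simp add: inner_diff inner_commute)
    then show "u = v" by simp
  qed
qed

lemma tensor_power_upd:
  assumes "i < p"
  shows "tensor_power u p (x(i := v)) = (v \<bullet> u) * (\<Prod>j\<in>{..<p} - {i}. x j \<bullet> u)"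
  unfolding tensor_power_def using assms
  by (subst prod.remove[of _ i]) (auto intro!: prod.cong)

lemma M0_in_Sym_tensors: "M0 \<xi> p P \<in> Sym_tensors p"
proof -
  have "linear (\<lambda>v. M0 \<xi> p P (x(i := v)))" if "i < p" for x i
    unfolding M0_def tensor_power_upd[OF that]
    by (rule linearI)
      (simp_all add: inner_add_left distrib_left distrib_right sum.distrib sum_distrib_left mult.assoc
        del: inner_scaleR_right)
  moreover have "tensor_power u p (x \<circ> \<pi>) = tensor_power u p x"
    if "\<pi> permutes {..<p}" for u :: "real ^ 'a" and \<pi> x
    using prod.permute[OF that, of "\<lambda>i. x i \<bullet> u"] by (simp add: tensor_power_def o_def)
  moreover have "M0 \<xi> p P x = M0 \<xi> p P y" if "\<forall>i<p. x i = y i" for x y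
    using that by (simp add: M0_def tensor_power_def)
  ultimately show ?thesis
    unfolding Sym_tensors_def multilinear_def mem_Collect_eq
    by (simp add: M0_def)
qed

end

theory Submission
  imports Defs "HOL-Computational_Algebra.Polynomial"
begin

text \<open>
  Facets not containing the origin are encoded by the vectors \<open>w = u / h\<^sub>P(u)\<close>.  The cone volume,
  as a function of the polytope for fixed \<open>w\<close>, is itself a valuation, whence so is
  \<open>M\<^sub>\<xi>\<^sup>0\<^sup>,\<^sup>p\<close>.

  Conversely, a contravariant valuation vanishes on polytopes in a hyperplane, because shears and
  stretchings fixing the hyperplane leave no room for a nonzero value.  It is thus simple and, as a
  polytope is dissected into simplices with a vertex at the origin by hyperplanes through the origin,
  it is determined by its values on simplices \<open>[0, v\<^sub>1, \<dots>, v\<^sub>n]\<close>.  On these, the value depends only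
  on the residues of the arguments modulo the differences \<open>v\<^sub>i - v\<^sub>j\<close>: by downward induction on the
  number of slots filled with directions of the plane of a triangle \<open>v\<^sub>i v\<^sub>j v\<^sub>k\<close>, the leading term is
  equivariant under area-preserving affine maps of that plane, and cutting the triangle parallel to a
  side forces it to vanish.  What remains is a function of the volume, and cutting a simplex shows that
  it satisfies Cauchy's equation.
\<close>

section \<open>Symmetric tensors\<close>

text \<open>No regularity is assumed, so the values of the valuation cannot be obtained as limits.
  Each vanishing comes from a self-similarity instead: a map of determinant 1 relates a polytope to
  itself, or the pieces of a cut to each other or to the whole, and this yields t = c t with c
  different from 1. The powers of 2 with exponent \<open>p\<close> or \<open>d\<close> below are
  such scale factors. The obstacle is that these maps also move the other arguments of the tensor.
  Arguments are therefore written in coordinates of a frame, and frames are compared only if they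
  differ by directions on which the value is already known not to depend. The dimension n >= 3
  enters through a third vertex, which completes an edge to a triangle, and through two indices
  other than a given one. On the side of the formula, volumes are those of prisms rather than cones:
  the height splits off as a factor, and prisms in a fixed direction over faces in a fixed
  hyperplane respect unions and intersections.\<close>

lemma Sym_tensors_linear_slot:
  assumes "t \<in> Sym_tensors p" "i < p"
  shows "linear (\<lambda>v. t (x(i := v)))"
  using assms by (auto simp: Sym_tensors_def multilinear_def)

lemma Sym_tensors_cong:
  assumes "t \<in> Sym_tensors p" "\<And>i. i < p \<Longrightarrow> x i = y i"
  shows "t x = t y"
  using assms by (auto simp: Sym_tensors_def)

lemma Sym_tensors_swap:
  assumes "t \<in> Sym_tensors p" "i < p" "j < p"
  shows "t (x(i := x j, j := x i)) = t x"
proof -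
  have "Transposition.transpose i j permutes {..<p}"
    using assms by (intro permutes_swap_id) auto
  then have "t (x \<circ> Transposition.transpose i j) = t x"
    using assms by (auto simp: Sym_tensors_def)
  moreover have "x \<circ> Transposition.transpose i j = x(i := x j, j := x i)"
    by (auto simp: fun_eq_iff Transposition.transpose_def)
  ultimately show ?thesis by simp
qed

lemma Sym_tensors_diff_slot:
  assumes "t \<in> Sym_tensors p" "i < p"
  shows "t (x(i := a)) - t (x(i := b)) = t (x(i := a - b))"
  using linear_diff[OF Sym_tensors_linear_slot[OF assms, of x], of a b] by simp

lemma Sym_tensors_zero_slot:
  assumes "t \<in> Sym_tensors p" "i < p" "x i = 0"
  shows "t x = 0"
  using linear_0[OF Sym_tensors_linear_slot[OF assms(1,2), of x]] assms(3)
  by (metis fun_upd_triv)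

lemma Sym_tensors_scale_first:
  assumes "t \<in> Sym_tensors p" "d \<le> p"
  shows "t (\<lambda>l. if l < d then c *\<^sub>R y else z l) = c ^ d * t (\<lambda>l. if l < d then y else z l)"
  using assms(2)
proof (induction d arbitrary: z)
  case (Suc d)
  have upd: "(\<lambda>l. if l < Suc d then a else z l) = (\<lambda>l. if l < d then a else (z(d := a)) l)" for a
    by (auto simp: fun_eq_iff less_Suc_eq)
  have upd': "(\<lambda>l. if l < d then y else (z(d := a)) l) = (\<lambda>l. if l < d then y else z l)(d := a)" for a
    by (auto simp: fun_eq_iff)
  have "t (\<lambda>l. if l < Suc d then c *\<^sub>R y else z l) = c ^ d * t ((\<lambda>l. if l < d then y else z l)(d := c *\<^sub>R y))"
    unfolding upd using Suc by (simp add: upd')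
  also have "\<dots> = c ^ Suc d * t ((\<lambda>l. if l < d then y else z l)(d := y))"
    using linear_scale[OF Sym_tensors_linear_slot[OF assms(1), of d "\<lambda>l. if l < d then y else z l"], of c y] Suc.prems
    by simp
  finally show ?case unfolding upd upd' .
qed simp

lemma Sym_tensors_scale:
  assumes "t \<in> Sym_tensors p"
  shows "t (\<lambda>_. c *\<^sub>R y) = c ^ p * t (\<lambda>_. y)"
proof -
  have "t (\<lambda>_. c *\<^sub>R y) = t (\<lambda>l. if l < p then c *\<^sub>R y else 0)"
    by (rule Sym_tensors_cong[OF assms]) simp
  also have "\<dots> = c ^ p * t (\<lambda>l. if l < p then y else 0)"
    by (rule Sym_tensors_scale_first[OF assms]) simp
  also have "t (\<lambda>l. if l < p then y else 0) = t (\<lambda>_. y)"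
    by (rule Sym_tensors_cong[OF assms]) simp
  finally show ?thesis .
qed

lemma Sym_tensors_scale_slots:
  assumes t: "t \<in> Sym_tensors p"
  shows "t (\<lambda>l. \<alpha> l *\<^sub>R x l) = (\<Prod>l<p. \<alpha> l) * t x"
proof -
  have "t (\<lambda>l. if l < k then \<alpha> l *\<^sub>R x l else x l) = (\<Prod>l<k. \<alpha> l) * t x" if "k \<le> p" for k
    using that
  proof (induction k)
    case (Suc k)
    let ?f = "\<lambda>l. if l < k then \<alpha> l *\<^sub>R x l else x l"
    have upd: "(\<lambda>l. if l < Suc k then \<alpha> l *\<^sub>R x l else x l) = ?f(k := \<alpha> k *\<^sub>R x k)" "?f(k := x k) = ?f"
      by (auto simp: fun_eq_iff less_Suc_eq)
    have "t (?f(k := \<alpha> k *\<^sub>R x k)) = \<alpha> k * t (?f(k := x k))"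
      using linear_scale[OF Sym_tensors_linear_slot[OF t Suc_le_lessD[OF Suc.prems]]] by simp
    then show ?case using Suc by (simp only: upd) simp
  qed simp
  from this[of p] have "t (\<lambda>l. if l < p then \<alpha> l *\<^sub>R x l else x l) = (\<Prod>l<p. \<alpha> l) * t x" by simp
  moreover have "t (\<lambda>l. if l < p then \<alpha> l *\<^sub>R x l else x l) = t (\<lambda>l. \<alpha> l *\<^sub>R x l)"
    by (rule Sym_tensors_cong[OF t]) simp
  ultimately show ?thesis by simp
qed

text \<open>A polynomial with infinitely many roots is zero, so knowledge about almost all points of
  a line passes to every coefficient. The linear coefficient is the derivative in direction
  \<open>y'\<close>, kept as a sum over slots because polarization reads it off.\<close>

lemma Sym_tensors_line_poly:
  assumes "t \<in> Sym_tensors p" "r \<le> p"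
  shows "\<exists>q. (\<forall>s. t (\<lambda>l. if l < r then y + s *\<^sub>R y' else x l) = poly q s) \<and>
    coeff q 0 = t (\<lambda>l. if l < r then y else x l) \<and>
    coeff q 1 = (\<Sum>j<r. t ((\<lambda>l. if l < r then y else x l)(j := y')))"
  using assms(2)
proof (induction r arbitrary: x)
  case 0
  then show ?case by (intro exI[of _ "[:t x:]"]) simp
next
  case (Suc r)
  have upd: "(\<lambda>l. if l < Suc r then a else x l) = (\<lambda>l. if l < r then a else (x(r := a)) l)" for a
    by (auto simp: fun_eq_iff less_Suc_eq)
  have upd': "(\<lambda>l. if l < r then y0 else (x(r := a)) l) = (\<lambda>l. if l < r then y0 else x l)(r := a)" for a y0
    by (auto simp: fun_eq_iff)
  obtain q1 where
    q1: "\<forall>s. t (\<lambda>l. if l < r then y + s *\<^sub>R y' else (x(r := y)) l) = poly q1 s"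
      "coeff q1 0 = t (\<lambda>l. if l < r then y else (x(r := y)) l)"
      "coeff q1 1 = (\<Sum>j<r. t ((\<lambda>l. if l < r then y else (x(r := y)) l)(j := y')))"
    using Suc.IH[OF Suc_leD[OF Suc.prems], of "x(r := y)"]
    by (elim exE conjE) (rule that)
  obtain q2 where
    q2: "\<forall>s. t (\<lambda>l. if l < r then y + s *\<^sub>R y' else (x(r := y')) l) = poly q2 s"
      "coeff q2 0 = t (\<lambda>l. if l < r then y else (x(r := y')) l)"
    using Suc.IH[OF Suc_leD[OF Suc.prems], of "x(r := y')"]
    by (elim exE conjE) (rule that)
  show ?case
  \<comment> \<open>The \<open>y\<close> part of slot \<open>r\<close> gives \<open>q1\<close>; its
    \<open>y'\<close> part carries a factor \<open>s\<close>, hence the shift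
    \<open>pCons 0 q2\<close>.\<close>
  proof (intro exI[of _ "q1 + pCons 0 q2"] conjI allI)
    fix s
    note lin = Sym_tensors_linear_slot[OF assms(1) Suc_le_lessD[OF Suc.prems],
        of "\<lambda>l. if l < r then y + s *\<^sub>R y' else x l"]
    have "t (\<lambda>l. if l < Suc r then y + s *\<^sub>R y' else x l)
        = t (\<lambda>l. if l < r then y + s *\<^sub>R y' else (x(r := y)) l)
          + s * t (\<lambda>l. if l < r then y + s *\<^sub>R y' else (x(r := y')) l)"
      unfolding upd unfolding upd' using linear_add[OF lin, of y "s *\<^sub>R y'"] linear_scale[OF lin, of s y']
      by simp
    then show "t (\<lambda>l. if l < Suc r then y + s *\<^sub>R y' else x l) = poly (q1 + pCons 0 q2) s"
      by (simp only: q1(1)[rule_format] q2(1)[rule_format] poly_add poly_pCons)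
  next
    show "coeff (q1 + pCons 0 q2) 0 = t (\<lambda>l. if l < Suc r then y else x l)"
      unfolding upd by (simp add: q1(2))
  next
    have "(\<lambda>l. if l < Suc r then y else x l)(r := y') = (\<lambda>l. if l < r then y else (x(r := y')) l)"
      by (auto simp: fun_eq_iff)
    then show "coeff (q1 + pCons 0 q2) 1 = (\<Sum>j<Suc r. t ((\<lambda>l. if l < Suc r then y else x l)(j := y')))"
      using q1(3) q2(2) by (simp add: upd[of y])
  qed
qed

text \<open>Slots are released one at a time. Since \<open>y + s *\<^sub>R x r\<close> stays in
  \<open>W\<close>, the polynomial in \<open>s\<close> is zero; its linear coefficient is a sum of
  terms that symmetry makes equal, each with \<open>x r\<close> in a single slot. The slots from
  \<open>d\<close> on stay at \<open>z\<close>, so that only the slots filled from a tangent plane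
  are polarized.\<close>

lemma Sym_tensors_polarization:
  assumes t: "t \<in> Sym_tensors p" and d: "d \<le> p" and W: "subspace W"
    and diag: "\<And>y. y \<in> W \<Longrightarrow> t (\<lambda>l. if l < d then y else z l) = 0"
    and x: "\<And>l. l < d \<Longrightarrow> x l \<in> W" "\<And>l. d \<le> l \<Longrightarrow> x l = z l"
  shows "t x = 0"
proof -
  have "\<forall>y\<in>W. \<forall>x. (\<forall>l<d. x l \<in> W) \<and> (\<forall>l\<ge>d. x l = z l) \<longrightarrow> t (\<lambda>l. if l < d - k then y else x l) = 0"
    if "k \<le> d" for k
    using that
  proof (induction k)
    case 0
    show ?case
    proof (intro ballI allI impI)
      fix y x assume "y \<in> W" and x: "(\<forall>l<d. x l \<in> W) \<and> (\<forall>l\<ge>d. x l = z l)"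
      then have "(\<lambda>l. if l < d - 0 then y else x l) = (\<lambda>l. if l < d then y else z l)"
        by auto
      then show "t (\<lambda>l. if l < d - 0 then y else x l) = 0" using diag \<open>y \<in> W\<close> by simp
    qed
  next
    case (Suc k)
    define r where "r = d - Suc k"
    have dk: "d - k = Suc r" and r: "r < p" using Suc.prems d by (auto simp: r_def)
    show ?case
    proof (intro ballI allI impI, fold r_def)
      fix y x assume y: "y \<in> W" and x: "(\<forall>l<d. x l \<in> W) \<and> (\<forall>l\<ge>d. x l = z l)"
      have xr: "x r \<in> W" using x Suc.prems by (auto simp: r_def)
      obtain q where q: "\<And>s. t (\<lambda>l. if l < Suc r then y + s *\<^sub>R x r else x l) = poly q s"
        "coeff q 1 = (\<Sum>j<Suc r. t ((\<lambda>l. if l < Suc r then y else x l)(j := x r)))"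
        using Sym_tensors_line_poly[OF t Suc_leI[OF r], of y "x r" x] by (elim exE conjE) simp
      have "y + s *\<^sub>R x r \<in> W" for s
        using W y xr by (simp add: subspace_add subspace_scale)
      then have "poly q s = 0" for s
        using Suc.IH Suc.prems x unfolding q(1)[symmetric] dk by simp
      then have "q = 0" using poly_all_0_iff_0 by blast
      moreover have "t ((\<lambda>l. if l < Suc r then y else x l)(j := x r)) = t (\<lambda>l. if l < r then y else x l)"
        if "j < Suc r" for j
      proof -
        \<comment> \<open>For \<open>j < r\<close> this exchanges \<open>y\<close> and
          \<open>x r\<close>; for \<open>j = r\<close> both updates hit the same slot and leave
          \<open>x r\<close> there.\<close>
        have "t ((\<lambda>l. if l < r then y else x l)(j := x r, r := (if j < r then y else x j)))
            = t (\<lambda>l. if l < r then y else x l)"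
          using Sym_tensors_swap[OF t, of j r "\<lambda>l. if l < r then y else x l"] that r by simp
        moreover have "(\<lambda>l. if l < r then y else x l)(j := x r, r := (if j < r then y else x j))
            = (\<lambda>l. if l < Suc r then y else x l)(j := x r)"
          using that by (auto simp: fun_eq_iff less_Suc_eq)
        ultimately show ?thesis by simp
      qed
      ultimately have "0 = real (Suc r) * t (\<lambda>l. if l < r then y else x l)"
        using q(2) by simp
      then show "t (\<lambda>l. if l < r then y else x l) = 0" by simp
    qed
  qed
  from this[OF order_refl, rule_format, OF subspace_0[OF W], of x]
  have "t (\<lambda>l. if l < d - d then 0 else x l) = 0" using x by simp
  then show ?thesis by simp
qed

lemma Sym_tensors_eq_0_if_diag:
  assumes "t \<in> Sym_tensors p" "\<And>y. t (\<lambda>_. y) = 0"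
  shows "t x = 0"
proof (rule Sym_tensors_polarization[OF assms(1) order_refl subspace_UNIV, where z = x])
  show "t (\<lambda>l. if l < p then y else x l) = 0" for y
    using Sym_tensors_cong[OF assms(1), of "\<lambda>l. if l < p then y else x l" "\<lambda>_. y"] assms(2) by simp
qed auto

text \<open>A point of the hyperplane is left along the normal \<open>a\<close>: on
  \<open>y + s *\<^sub>R a\<close> the tensor is a polynomial in \<open>s\<close> with every nonzero
  \<open>s\<close> as a root, so it also vanishes at 0.\<close>

lemma Sym_tensors_eq_0_if_diag_off_hyperplane:
  assumes t: "t \<in> Sym_tensors p" and a: "a \<noteq> 0" and off: "\<And>y. a \<bullet> y \<noteq> 0 \<Longrightarrow> t (\<lambda>_. y) = 0"
  shows "t x = 0"
proof (rule Sym_tensors_eq_0_if_diag[OF t])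
  fix y
  show "t (\<lambda>_. y) = 0"
  proof (cases "a \<bullet> y = 0")
    case True
    obtain q where q: "\<And>s. t (\<lambda>l. if l < p then y + s *\<^sub>R a else 0) = poly q s"
      using Sym_tensors_line_poly[OF t order_refl, of y a "\<lambda>_. 0"] by (elim exE conjE) simp
    have eq: "t (\<lambda>l. if l < p then y' else 0) = t (\<lambda>_. y')" for y'
      by (rule Sym_tensors_cong[OF t]) simp
    have "poly q s = 0" if "s \<noteq> 0" for s
      using off[of "y + s *\<^sub>R a"] that True a by (simp add: q[symmetric] eq inner_add_right)
    then have "\<not> finite {s. poly q s = 0}"
      using infinite_super[of "- {0}" "{s. poly q s = 0}"] by (auto simp: infinite_UNIV_char_0)
    then have "q = 0" using poly_roots_finite by blast
    then show ?thesis using q[of 0] by (simp add: eq)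
  qed (rule off)
qed

text \<open>Changing a further slot by an element of \<open>W\<close> adds a term with
  \<open>d + 1\<close> slots in \<open>W\<close>, which \<open>van\<close> kills. The guard
  \<open>d < p\<close> admits \<open>d = p\<close>, where no further slot is left; for
  \<open>d = 0\<close> the tensor descends to the quotient by \<open>W\<close>.\<close>

lemma Sym_tensors_slots_mod:
  assumes t: "t \<in> Sym_tensors p" and W: "subspace W"
    and van: "\<And>x. \<lbrakk>d < p; \<And>l. l \<le> d \<Longrightarrow> x l \<in> W\<rbrakk> \<Longrightarrow> t x = 0"
    and x: "\<And>l. l < d \<Longrightarrow> x l \<in> W" "\<And>l. l < d \<Longrightarrow> x' l = x l"
      "\<And>l. \<lbrakk>d \<le> l; l < p\<rbrakk> \<Longrightarrow> x l - x' l \<in> W"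
  shows "t x = t x'"
proof -
  have "t (\<lambda>l. if l < k then x' l else x l) = t x" if "k \<le> p" for k
    using that
  proof (induction k)
    case (Suc k)
    define f where "f = (\<lambda>l. if l < k then x' l else x l)"
    have Sk: "(\<lambda>l. if l < Suc k then x' l else x l) = f(k := x' k)"
      by (auto simp: f_def fun_eq_iff less_Suc_eq)
    have fk: "f(k := x k) = f" by (auto simp: f_def fun_eq_iff)
    have "t (f(k := x k)) = t (f(k := x' k))"
    proof (cases "k < d")
      case False
      \<comment> \<open>The difference sits in slot \<open>k\<close>; exchanging slots
        \<open>k\<close> and \<open>d\<close> gives the form that \<open>van\<close> asks
        for.\<close>
      define g where "g = f(k := x k - x' k)"
      have "t (g(k := g d, d := g k)) = 0"
        by (rule van) (use False x Suc.prems in \<open>auto simp: g_def f_def le_less\<close>)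
      then have "t g = 0"
        using Sym_tensors_swap[OF t, of k d g] False Suc.prems by simp
      then show ?thesis
        using Sym_tensors_diff_slot[OF t, of k f "x k" "x' k"] Suc.prems by (simp add: g_def)
    qed (use x in simp)
    then show ?case using Suc by (simp add: Sk fk) (simp add: f_def)
  qed simp
  from this[of p] have "t x = t (\<lambda>l. if l < p then x' l else x l)" by simp
  also have "\<dots> = t x'" by (rule Sym_tensors_cong[OF t]) simp
  finally show ?thesis .
qed

section \<open>Frames\<close>

text \<open>Frames are indexed by the coordinate type itself: the vectors form a square matrix, and
  replacing a vertex is a function update.\<close>

definition frame_det :: "('n \<Rightarrow> real^'n::finite) \<Rightarrow> real" where
  "frame_det v = det (\<chi> i. v i)"

lemma linear_frame_det_slot: "linear (\<lambda>x. frame_det (v(k := x)))"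
proof (rule linearI)
  have upd: "(\<chi> i. (v(k := x)) i) = (\<chi> i. if i = k then x else v i)" for x
    by (simp add: vec_eq_iff)
  show "frame_det (v(k := x + y)) = frame_det (v(k := x)) + frame_det (v(k := y))" for x y
    unfolding frame_det_def upd by (rule det_row_add)
  show "frame_det (v(k := c *\<^sub>R x)) = c *\<^sub>R frame_det (v(k := x))" for c x
    unfolding frame_det_def upd using det_row_mul[of k c "\<lambda>_. x" v]
    by (simp only: scalar_mult_eq_scaleR real_scaleR_def)
qed

lemma frame_det_scale: "frame_det (v(k := c *\<^sub>R x)) = c * frame_det (v(k := x))"
  using linear_scale[OF linear_frame_det_slot] by simp

lemma frame_det_span:
  assumes "x \<in> span (v ` (- {k}))"
  shows "frame_det (v(k := x)) = 0"
  using linear_frame_det_slot _ assms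
proof (rule linear_eq_0_on_span)
  fix y assume "y \<in> v ` (- {k})"
  then obtain j where j: "j \<noteq> k" "y = v j" by auto
  then show "frame_det (v(k := y)) = 0"
    unfolding frame_det_def by (intro det_identical_rows[of k j]) (auto simp: row_def vec_eq_iff)
qed

lemma frame_det_add_span:
  assumes "x \<in> span (v ` (- {k}))"
  shows "frame_det (v(k := y + x)) = frame_det (v(k := y))"
  using linear_add[OF linear_frame_det_slot, of v k y x] frame_det_span[OF assms] by simp

lemma frame_det_combine:
  assumes "i \<noteq> j"
  shows "frame_det (v(j := a *\<^sub>R v i + b *\<^sub>R v j)) = b * frame_det v"
proof -
  have "a *\<^sub>R v i \<in> span (v ` (- {j}))"
    using assms by (intro span_scale span_base) auto
  from frame_det_add_span[OF this, of "b *\<^sub>R v j"] show ?thesis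
    by (simp add: frame_det_scale add.commute)
qed

lemma frame_det_linear:
  assumes "linear f"
  shows "frame_det (\<lambda>i. f (v i)) = det (matrix f) * frame_det v"
proof -
  have "(\<chi> i. f (v i)) = (\<chi> i. v i) ** transpose (matrix f)"
  proof (simp add: vec_eq_iff matrix_matrix_mult_def Finite_Cartesian_Product.transpose_def, intro allI)
    fix i j
    have "f (v i) $ j = (matrix f *v v i) $ j" using assms by simp
    then show "f (v i) $ j = (\<Sum>k\<in>UNIV. v i $ k * matrix f $ j $ k)"
      by (simp add: matrix_vector_mult_def mult.commute)
  qed
  then show ?thesis by (simp add: frame_det_def det_mul mult.commute)
qed

lemma frame_det_permute:
  assumes "\<pi> permutes UNIV"
  shows "frame_det (v \<circ> \<pi>) = of_int (sign \<pi>) * frame_det v"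
  using det_permute_rows[OF assms, of "\<chi> i. v i"] by (simp add: frame_det_def)

lemma frame_det_nonzero_imp:
  assumes "frame_det v \<noteq> 0"
  shows "inj v" "independent (range v)" "span (range v) = UNIV"
proof -
  show inj: "inj v"
  proof (rule injI, rule ccontr)
    fix i j assume "v i = v j" "i \<noteq> j"
    then have "frame_det v = 0"
      unfolding frame_det_def by (intro det_identical_rows[of i j]) (auto simp: row_def vec_eq_iff)
    with assms show False by simp
  qed
  show ind: "independent (range v)"
  proof
    assume "dependent (range v)"
    then obtain k where "v k \<in> span (range v - {v k})" by (auto simp: dependent_def)
    moreover have "range v - {v k} = v ` (- {k})" using inj by (auto simp: inj_def)
    ultimately have "frame_det (v(k := v k)) = 0" by (intro frame_det_span) simp
    with assms show False by simp
  qed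
  have "card (range v) = CARD('a)" using inj by (simp add: card_image)
  then have "dim (UNIV :: (real^'a) set) \<le> card (range v)" by simp
  from card_ge_dim_independent[OF subset_UNIV ind this]
  show "span (range v) = UNIV" by (rule subset_antisym[OF subset_UNIV])
qed

lemma linear_on_independent_range:
  assumes "inj v" "independent (range v)"
  shows "\<exists>g. linear g \<and> (\<forall>i. g (v i) = h i)"
proof -
  obtain g where g: "linear g" "\<forall>x\<in>range v. g x = h (inv v x)"
    using linear_independent_extend[OF assms(2), of "\<lambda>x. h (inv v x)"] by (elim exE conjE) (rule that)
  have "g (v i) = h i" for i using bspec[OF g(2) rangeI] by (simp only: inv_f_f[OF assms(1)])
  with g(1) show ?thesis by (intro exI[of _ g]) simp
qed

text \<open>The linear map that sends the frame to the standard basis turns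
  \<open>frame_det v\<close> into 1 by multiplying it with a determinant.\<close>

lemma frame_det_nonzeroI:
  fixes v :: "'n \<Rightarrow> real^'n::finite"
  assumes "inj v" "independent (range v)"
  shows "frame_det v \<noteq> 0"
proof -
  obtain g :: "real^'n \<Rightarrow> real^'n" where "linear g \<and> (\<forall>i. g (v i) = axis i 1)"
    using linear_on_independent_range[OF assms, of "\<lambda>i. axis i (1::real)"] by (rule exE)
  then have g: "linear g" "\<And>i. g (v i) = axis i 1" by simp_all
  have "frame_det (\<lambda>i. g (v i)) = 1"
  proof -
    have "(\<chi> i. axis i 1) = (mat 1 :: real^'n^'n)" by (simp add: vec_eq_iff mat_def axis_def)
    then show ?thesis by (simp add: g(2) frame_det_def)
  qed
  with frame_det_linear[OF g(1), of v] show ?thesis by (metis mult_zero_right zero_neq_one)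
qed

lemma frame_extending:
  fixes V :: "(real^'n::finite) set"
  assumes "independent V"
  obtains v :: "'n \<Rightarrow> real^'n" where "frame_det v \<noteq> 0" "V \<subseteq> range v"
proof -
  obtain B where "V \<subseteq> B" "B \<subseteq> UNIV" and B: "V \<subseteq> B" "independent B" "UNIV \<subseteq> span B"
    using maximal_independent_subset_extend[OF subset_UNIV assms] by metis
  have "card B = CARD('n)"
    using dim_eq_card_independent[OF B(2)] subset_antisym[OF subset_UNIV B(3)] dim_span[of B]
      dim_UNIV[where 'a = "real^'n"] by simp
  then obtain v where v: "bij_betw v (UNIV :: 'n set) B"
    using finite_same_card_bij[OF finite independent_imp_finite[OF B(2)], of "UNIV :: 'n set"]
    using \<open>card B = CARD('n)\<close> by auto
  then have v: "inj v" "range v = B" by (auto simp: bij_betw_def)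
  show thesis
  proof (rule that)
    show "frame_det v \<noteq> 0" using v B(2) by (intro frame_det_nonzeroI) simp_all
    show "V \<subseteq> range v" using v(2) B(1) by simp
  qed
qed

lemma exists_inner_on_independent:
  fixes V :: "'a::euclidean_space set"
  assumes "independent V"
  shows "\<exists>b. \<forall>v\<in>V. b \<bullet> v = f v"
proof -
  obtain g where g: "linear g" "\<forall>v\<in>V. g v = f v"
    using linear_independent_extend[OF assms] by blast
  have "adjoint g 1 \<bullet> v = f v" if "v \<in> V" for v
    using adjoint_works[OF g(1), of v 1] g(2) that by (simp add: inner_commute)
  then show ?thesis by blast
qed

lemma frame_dual:
  assumes "frame_det v \<noteq> 0"
  shows "\<exists>w. \<forall>k. w \<bullet> v k = g k"
  using exists_inner_on_independent[OF frame_det_nonzero_imp(2)[OF assms], of "\<lambda>x. g (inv v x)"]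
  by (simp add: inv_f_f[OF frame_det_nonzero_imp(1)[OF assms]])

lemma frame_coords:
  assumes "frame_det v \<noteq> 0"
  obtains c where "x = (\<Sum>k\<in>UNIV. c k *\<^sub>R v k)"
proof -
  note fr = frame_det_nonzero_imp[OF assms]
  obtain u where "x = (\<Sum>y\<in>range v. u y *\<^sub>R y)"
    using fr(3) span_finite[of "range v"] by force
  also have "\<dots> = (\<Sum>k\<in>UNIV. u (v k) *\<^sub>R v k)"
    using fr(1) by (simp add: sum.reindex)
  finally show thesis by (rule that)
qed

text \<open>SL(n) acts transitively on the frames of a given nonzero determinant. All matrices of
  the uniqueness proof come from here.\<close>

lemma frame_map:
  fixes v v' :: "'n \<Rightarrow> real^'n::finite"
  assumes "frame_det v \<noteq> 0" "frame_det v' = frame_det v"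
  obtains \<phi> :: "real^'n^'n" where "det \<phi> = 1" "\<And>k. \<phi> *v v k = v' k"
proof -
  note fr = frame_det_nonzero_imp[OF assms(1)]
  obtain f where "linear f \<and> (\<forall>k. f (v k) = v' k)"
    using linear_on_independent_range[OF fr(1,2), of v'] by (rule exE)
  then have f: "linear f" "\<And>k. f (v k) = v' k" by simp_all
  have "det (matrix f) = 1"
    using frame_det_linear[OF f(1), of v] assms by (simp add: f(2))
  moreover have "matrix f *v v k = v' k" for k
    using f by simp
  ultimately show thesis by (rule that)
qed

section \<open>Barycentric coordinates with respect to the origin and a family of vertices\<close>

abbreviation simplex0 :: "'a::real_vector set \<Rightarrow> 'a set" where
  "simplex0 V \<equiv> convex hull (insert 0 V)"

text \<open>The vertex 0 takes the remaining weight, hence a sum of at most 1. Coefficients belong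
  to indices and not to points, so \<open>v\<close> may have repetitions and need not be
  independent.\<close>

lemma mem_simplex:
  fixes v :: "'i \<Rightarrow> 'a::real_vector"
  assumes K: "finite K"
  shows "x \<in> simplex0 (v ` K) \<longleftrightarrow>
    (\<exists>c. (\<forall>k. 0 \<le> c k) \<and> sum c K \<le> 1 \<and> x = (\<Sum>k\<in>K. c k *\<^sub>R v k))"
proof
  let ?S = "{x. \<exists>c. (\<forall>k. 0 \<le> c k) \<and> sum c K \<le> 1 \<and> x = (\<Sum>k\<in>K. c k *\<^sub>R v k)}"
  have "convex ?S"
  proof (rule convexI)
    fix x y and a b :: real
    assume ab: "0 \<le> a" "0 \<le> b" "a + b = 1" and "x \<in> ?S" "y \<in> ?S"
    then obtain c d where c: "\<forall>k. 0 \<le> c k" "sum c K \<le> 1" "x = (\<Sum>k\<in>K. c k *\<^sub>R v k)"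
      and d: "\<forall>k. 0 \<le> d k" "sum d K \<le> 1" "y = (\<Sum>k\<in>K. d k *\<^sub>R v k)" by blast
    have "(\<Sum>k\<in>K. a * c k + b * d k) = a * sum c K + b * sum d K"
      by (simp add: sum.distrib sum_distrib_left)
    also have "\<dots> \<le> a * 1 + b * 1"
      using ab c(2) d(2) by (intro add_mono mult_left_mono) auto
    finally have "(\<Sum>k\<in>K. a * c k + b * d k) \<le> 1" using ab(3) by simp
    moreover have "a *\<^sub>R x + b *\<^sub>R y = (\<Sum>k\<in>K. (a * c k + b * d k) *\<^sub>R v k)"
      unfolding c(3) d(3) by (simp add: scaleR_sum_right scaleR_add_left sum.distrib)
    moreover have "\<forall>k. 0 \<le> a * c k + b * d k" using ab c(1) d(1) by simp
    ultimately show "a *\<^sub>R x + b *\<^sub>R y \<in> ?S"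
      by (intro CollectI exI[of _ "\<lambda>k. a * c k + b * d k"] conjI)
  qed
  moreover have "insert 0 (v ` K) \<subseteq> ?S"
  proof
    fix x assume "x \<in> insert 0 (v ` K)"
    then consider "x = 0" | k where "k \<in> K" "x = v k" by blast
    then show "x \<in> ?S"
    proof cases
      case 1
      then show ?thesis by (intro CollectI exI[of _ "\<lambda>_. 0"]) simp
    next
      case 2
      have "(\<Sum>j\<in>K. (if j = k then 1 else 0) *\<^sub>R v j) = (\<Sum>j\<in>K. if j = k then v j else 0)"
        by (intro sum.cong) auto
      then have "(\<Sum>j\<in>K. (if j = k then 1 else 0) *\<^sub>R v j) = v k" using 2 K by simp
      then show ?thesis using 2 K
        by (intro CollectI exI[of _ "\<lambda>j. if j = k then 1 else 0"]) simp
    qed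
  qed
  ultimately have sub: "simplex0 (v ` K) \<subseteq> ?S" by (simp add: hull_minimal)
  assume "x \<in> simplex0 (v ` K)"
  with sub show "\<exists>c. (\<forall>k. 0 \<le> c k) \<and> sum c K \<le> 1 \<and> x = (\<Sum>k\<in>K. c k *\<^sub>R v k)" by blast
next
  let ?C = "simplex0 (v ` K)"
  assume "\<exists>c. (\<forall>k. 0 \<le> c k) \<and> sum c K \<le> 1 \<and> x = (\<Sum>k\<in>K. c k *\<^sub>R v k)"
  then obtain c where c: "\<forall>k. 0 \<le> c k" "sum c K \<le> 1" "x = (\<Sum>k\<in>K. c k *\<^sub>R v k)" by blast
  have in_hull: "0 \<in> ?C" "v k \<in> ?C" if "k \<in> K" for k
    using that by (auto intro: hull_inc)
  show "x \<in> ?C"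
  proof (cases "sum c K = 0")
    case True
    then have "c k = 0" if "k \<in> K" for k using c(1) K that by (simp add: sum_nonneg_eq_0_iff)
    then have "x = 0" unfolding c(3) by simp
    then show ?thesis by (simp add: hull_inc)
  next
    case False
    define s where "s = sum c K"
    have s: "s > 0" using False c(1) sum_nonneg[of K c] by (simp add: s_def less_le)
    have "(\<Sum>k\<in>K. (c k / s) *\<^sub>R v k) \<in> ?C"
    proof (rule convex_sum[OF K convex_convex_hull])
      show "(\<Sum>k\<in>K. c k / s) = 1" using s by (simp add: s_def flip: sum_divide_distrib)
    qed (use c(1) s in_hull in auto)
    moreover have "0 \<in> ?C" by (simp add: hull_inc)
    ultimately have "(1 - s) *\<^sub>R 0 + s *\<^sub>R (\<Sum>k\<in>K. (c k / s) *\<^sub>R v k) \<in> ?C"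
      using s c(2) by (intro convexD[OF convex_convex_hull]) (auto simp: s_def)
    moreover have "s *\<^sub>R (\<Sum>k\<in>K. (c k / s) *\<^sub>R v k) = x"
      unfolding c(3) using s by (simp add: scaleR_sum_right)
    ultimately show ?thesis by simp
  qed
qed

section \<open>Simple valuations and dissections into simplices\<close>

text \<open>A subset of full dimension has the same affine hull, and a hyperplane that contains the
  subset contains this hull.\<close>

lemma nonvanishing_on_full_dim_subset:
  fixes R Q :: "'a::euclidean_space set"
  assumes "R \<subseteq> Q" "aff_dim R = aff_dim Q" "x \<in> Q" "a \<bullet> x \<noteq> c"
  shows "\<exists>y\<in>R. a \<bullet> y \<noteq> c"
proof (rule ccontr)
  assume "\<not> ?thesis"
  then have "affine hull R \<subseteq> {y. a \<bullet> y = c}"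
    by (intro hull_minimal affine_hyperplane) auto
  moreover have "affine hull R = affine hull Q"
    using assms(1,2) aff_dim_psubset[of R Q] hull_mono[of R Q affine] by auto
  ultimately show False using assms(3,4) hull_inc[of x Q affine] by blast
qed

lemma aff_dim_Int_hyperplane_less:
  fixes Q :: "'a::euclidean_space set"
  assumes "x \<in> Q" "a \<bullet> x \<noteq> c" "R \<subseteq> Q" "R \<subseteq> {y. a \<bullet> y = c}"
  shows "aff_dim R < aff_dim Q"
proof (rule ccontr)
  assume "\<not> ?thesis"
  then have "aff_dim R = aff_dim Q" using aff_dim_subset[OF assms(3)] by simp
  then show False
    using nonvanishing_on_full_dim_subset[OF assms(3) _ assms(1,2)] assms(4) by blast
qed

text \<open>The closed cells of the central arrangement with normals \<open>A\<close>;
  \<open>E\<close> selects the normals whose nonnegative side is taken. Different cells overlap in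
  hyperplanes, to which simple valuations are blind.\<close>

definition sign_cell :: "'a::euclidean_space set \<Rightarrow> 'a set \<Rightarrow> 'a set" where
  "sign_cell A E = {x. \<forall>a\<in>A. if a \<in> E then 0 \<le> a \<bullet> x else a \<bullet> x \<le> 0}"

lemma zero_in_sign_cell: "0 \<in> sign_cell A E"
  by (simp add: sign_cell_def)

lemma polyhedron_sign_cell:
  assumes "finite A"
  shows "polyhedron (sign_cell A E)"
proof -
  have "sign_cell A E = (\<Inter>a\<in>A. if a \<in> E then {x. a \<bullet> x \<ge> 0} else {x. a \<bullet> x \<le> 0})"
    by (auto simp: sign_cell_def split: if_splits)
  also have "polyhedron \<dots>"
    using assms by (auto intro!: polyhedron_Inter polyhedron_halfspace_le polyhedron_halfspace_ge)
  finally show ?thesis .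
qed

text \<open>The dimension \<open>m\<close> is a parameter because the locale serves twice: with n -
  1 to prove vanishing on polytopes in hyperplanes, and then with n.\<close>

locale simple_valuation =
  fixes \<nu> :: "'a::euclidean_space set \<Rightarrow> real" and m :: int
  assumes val: "\<And>P Q. \<lbrakk>polytope P; 0 \<in> P; polytope Q; 0 \<in> Q; polytope (P \<union> Q)\<rbrakk>
      \<Longrightarrow> \<nu> P + \<nu> Q = \<nu> (P \<union> Q) + \<nu> (P \<inter> Q)"
    and low: "\<And>P. \<lbrakk>polytope P; 0 \<in> P; aff_dim P < m\<rbrakk> \<Longrightarrow> \<nu> P = 0"
begin

text \<open>A hyperplane through the origin leaves the origin in both halves. Their overlap has
  dimension below \<open>m\<close> unless the hyperplane contains all of an
  \<open>m\<close>-dimensional \<open>Q\<close>, which the condition on \<open>a\<close>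
  excludes.\<close>

lemma cut:
  assumes Q: "polytope Q" "0 \<in> Q" "aff_dim Q \<le> m" and a: "aff_dim Q < m \<or> (\<exists>x\<in>Q. a \<bullet> x \<noteq> 0)"
  shows "\<nu> Q = \<nu> (Q \<inter> {x. a \<bullet> x \<le> 0}) + \<nu> (Q \<inter> {x. a \<bullet> x \<ge> 0})"
proof -
  let ?L = "Q \<inter> {x. a \<bullet> x \<le> 0}" and ?G = "Q \<inter> {x. a \<bullet> x \<ge> 0}"
  have pt: "polytope ?L" "polytope ?G"
    using Q(1) by (auto intro: polytope_Int_polyhedron polyhedron_halfspace_le polyhedron_halfspace_ge)
  have un: "?L \<union> ?G = Q" by auto
  have "aff_dim (?L \<inter> ?G) < m"
  proof (cases "aff_dim Q < m")
    case True
    have "aff_dim (?L \<inter> ?G) \<le> aff_dim Q" by (intro aff_dim_subset) auto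
    with True show ?thesis by simp
  next
    case False
    then obtain x where "x \<in> Q" "a \<bullet> x \<noteq> 0" using a by blast
    then have "aff_dim (?L \<inter> ?G) < aff_dim Q"
      by (rule aff_dim_Int_hyperplane_less) auto
    with Q(3) show ?thesis by simp
  qed
  moreover have "polytope (?L \<inter> ?G)" using pt by (rule polytope_Int)
  ultimately have "\<nu> (?L \<inter> ?G) = 0" using Q(2) by (intro low) auto
  then show ?thesis using val[of ?L ?G] pt Q un by auto
qed

text \<open>The last hypothesis survives each cut: a half either has dimension below
  \<open>m\<close>, or it has the dimension of \<open>Q\<close> and then none of the remaining
  hyperplanes contains it.\<close>

lemma sum_over_sign_cells:
  assumes "finite A" "polytope Q" "0 \<in> Q" "aff_dim Q \<le> m"
    "aff_dim Q < m \<or> (\<forall>a\<in>A. \<exists>x\<in>Q. a \<bullet> x \<noteq> 0)"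
  shows "\<nu> Q = (\<Sum>E\<in>Pow A. \<nu> (Q \<inter> sign_cell A E))"
  using assms
proof (induction A arbitrary: Q rule: finite_induct)
  case empty
  then show ?case by (simp add: sign_cell_def)
next
  case (insert a A)
  let ?L = "Q \<inter> {x. a \<bullet> x \<le> 0}" and ?G = "Q \<inter> {x. a \<bullet> x \<ge> 0}"
  have half: "\<nu> R = (\<Sum>E\<in>Pow A. \<nu> (R \<inter> sign_cell A E))"
    if R: "polytope R" "0 \<in> R" "R \<subseteq> Q" for R
  proof (rule insert.IH)
    have le: "aff_dim R \<le> aff_dim Q" using R(3) by (rule aff_dim_subset)
    with insert.prems show "aff_dim R \<le> m" by simp
    show "aff_dim R < m \<or> (\<forall>a\<in>A. \<exists>x\<in>R. a \<bullet> x \<noteq> 0)"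
    proof (cases "aff_dim R < m")
      case False
      with le insert.prems(3) have "aff_dim R = aff_dim Q" "\<not> aff_dim Q < m" by auto
      show ?thesis
      proof (intro disjI2 ballI)
        fix b assume "b \<in> A"
        then obtain x where "x \<in> Q" "b \<bullet> x \<noteq> 0"
          using insert.prems(4) \<open>\<not> aff_dim Q < m\<close> by auto
        then show "\<exists>x\<in>R. b \<bullet> x \<noteq> 0"
          by (rule nonvanishing_on_full_dim_subset[OF R(3) \<open>aff_dim R = aff_dim Q\<close>])
      qed
    qed simp
  qed (use R in auto)
  have pt: "polytope ?L" "polytope ?G"
    using insert.prems(1) by (auto intro: polytope_Int_polyhedron polyhedron_halfspace_le polyhedron_halfspace_ge)
  have L: "Q \<inter> sign_cell (insert a A) E = ?L \<inter> sign_cell A E"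
    and G: "Q \<inter> sign_cell (insert a A) (insert a E) = ?G \<inter> sign_cell A E" if "E \<in> Pow A" for E
    using that insert.hyps by (auto simp: sign_cell_def)
  have "inj_on (insert a) (Pow A)"
    using insert.hyps by (auto simp: inj_on_def)
  then have "(\<Sum>E\<in>Pow (insert a A). \<nu> (Q \<inter> sign_cell (insert a A) E))
      = (\<Sum>E\<in>Pow A. \<nu> (?L \<inter> sign_cell A E)) + (\<Sum>E\<in>Pow A. \<nu> (?G \<inter> sign_cell A E))"
    unfolding Pow_insert using insert.hyps
    by (subst sum.union_disjoint) (auto simp: sum.reindex L G simp del: Int_iff)
  also have "\<dots> = \<nu> ?L + \<nu> ?G"
    using half[of ?L] half[of ?G] pt insert.prems by auto
  also have "\<dots> = \<nu> Q" using insert.prems by (intro cut[symmetric]) auto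
  finally show ?case by simp
qed

text \<open>Additivity is only given for two polytopes with convex union, and partial unions of a
  dissection need not be convex. So \<open>P\<close> and all pieces are cut along all normals: a
  cell of dimension \<open>m\<close> lies in exactly one piece, and the double sum over cells and
  pieces is evaluated in both orders. For a thin piece \<open>N\<close> has to provide a hyperplane
  that contains the piece but not \<open>P\<close>.\<close>

lemma sum_over_dissection:
  assumes P: "polytope P" "0 \<in> P" "aff_dim P = m"
    and fin: "finite \<S>" and un: "\<Union>\<S> = P"
    and S: "\<And>S. S \<in> \<S> \<Longrightarrow> polytope S \<and> 0 \<in> S \<and> finite (N S) \<and> (\<forall>b\<in>N S. \<exists>x\<in>P. b \<bullet> x \<noteq> 0)"
    and full: "\<And>S. \<lbrakk>S \<in> \<S>; aff_dim S = m\<rbrakk> \<Longrightarrow> S = {x\<in>P. \<forall>b\<in>N S. 0 \<le> b \<bullet> x}"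
    and thin: "\<And>S. \<lbrakk>S \<in> \<S>; aff_dim S < m\<rbrakk> \<Longrightarrow> \<exists>b\<in>N S. S \<subseteq> {x. b \<bullet> x = 0}"
    and disj: "\<And>S S'. \<lbrakk>S \<in> \<S>; S' \<in> \<S>; S \<noteq> S'; aff_dim S = m; aff_dim S' = m\<rbrakk> \<Longrightarrow> aff_dim (S \<inter> S') < m"
  shows "\<nu> P = (\<Sum>S\<in>\<S>. \<nu> S)"
proof -
  define A where "A = (\<Union>S\<in>\<S>. N S)"
  have A: "finite A" "\<And>a. a \<in> A \<Longrightarrow> \<exists>x\<in>P. a \<bullet> x \<noteq> 0"
    using fin S by (auto simp: A_def)
  have Sm: "aff_dim S \<le> m" if "S \<in> \<S>" for S
    using aff_dim_subset[of S P] un P(3) that by blast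
  have cell: "\<nu> (P \<inter> sign_cell A E) = (\<Sum>S\<in>\<S>. \<nu> (S \<inter> sign_cell A E))" for E
  proof -
    define C where "C = sign_cell A E"
    have C: "polyhedron C" "0 \<in> C"
      unfolding C_def by (auto intro: polyhedron_sign_cell A zero_in_sign_cell)
    have ptC: "polytope (R \<inter> C)" if "polytope R" for R
      using that C(1) by (rule polytope_Int_polyhedron)
    have PC: "aff_dim (P \<inter> C) \<le> m" using P(3) aff_dim_subset[of "P \<inter> C" P] by simp
    show ?thesis
    proof (cases "aff_dim (P \<inter> C) < m")
      case True
      have "\<nu> (S \<inter> C) = 0" if "S \<in> \<S>" for S
      proof (rule low)
        have "aff_dim (S \<inter> C) \<le> aff_dim (P \<inter> C)" using un that by (intro aff_dim_subset) auto
        with True show "aff_dim (S \<inter> C) < m" by simp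
      qed (use S[OF that] ptC C in auto)
      moreover have "\<nu> (P \<inter> C) = 0" using True P C ptC by (intro low) auto
      ultimately show ?thesis by (simp add: C_def)
    next
      case False
      with PC P(3) have dimPC: "aff_dim (P \<inter> C) = aff_dim P" by simp
      have cv: "convex (P \<inter> C)"
        using P(1) C(1) by (intro convex_Int polytope_imp_convex polyhedron_imp_convex)
      have "P \<inter> C \<noteq> {}" using P C by auto
      then obtain x where x: "x \<in> rel_interior (P \<inter> C)"
        using rel_interior_eq_empty[OF cv] by blast
      have xPC: "x \<in> P \<inter> C" using x rel_interior_subset by blast
      \<comment> \<open>If \<open>a \<bullet> x = 0\<close>, prolonging the segment from
        \<open>y\<close> beyond the relative interior point \<open>x\<close> stays in the cell and
        reverses the sign of \<open>a \<bullet> y\<close>, which no cell permits.\<close>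
      have nz: "a \<bullet> x \<noteq> 0" if a: "a \<in> A" for a
      proof
        assume ax: "a \<bullet> x = 0"
        obtain z where "z \<in> P" "a \<bullet> z \<noteq> 0" using A(2)[OF a] by blast
        then obtain y where y: "y \<in> P \<inter> C" "a \<bullet> y \<noteq> 0"
          using nonvanishing_on_full_dim_subset[OF _ dimPC] by blast
        obtain e where e: "e > 1" "(1 - e) *\<^sub>R y + e *\<^sub>R x \<in> P \<inter> C"
          using convex_rel_interior_iff[OF cv \<open>P \<inter> C \<noteq> {}\<close>] x y(1) by blast
        have 1: "a \<bullet> ((1 - e) *\<^sub>R y + e *\<^sub>R x) = (1 - e) * (a \<bullet> y)"
          using ax by (simp add: inner_add_right)
        have "0 \<le> (a \<bullet> y) * (a \<bullet> ((1 - e) *\<^sub>R y + e *\<^sub>R x))"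
          using y(1) e(2) a unfolding C_def sign_cell_def
          by (cases "a \<in> E") (auto intro: mult_nonneg_nonneg mult_nonpos_nonpos)
        then have "0 \<le> (1 - e) * (a \<bullet> y)\<^sup>2" unfolding 1 by (simp add: power2_eq_square ac_simps)
        then show False using e(1) y(2) by (simp add: zero_le_mult_iff)
      qed
      obtain S where S': "S \<in> \<S>" "x \<in> S" using xPC un by auto
      have "\<not> aff_dim S < m"
      proof
        assume "aff_dim S < m"
        then obtain b where "b \<in> N S" "S \<subseteq> {x. b \<bullet> x = 0}" using thin S' by blast
        then show False using nz[of b] S' by (auto simp: A_def)
      qed
      then have dimS: "aff_dim S = m" using Sm[OF S'(1)] by simp
      \<comment> \<open>The signs at \<open>x\<close> are strict, so all normals of \<open>S\<close>
        belong to \<open>E\<close>, and the whole cell satisfies the inequalities of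
        \<open>S\<close>.\<close>
      have sub: "P \<inter> C \<subseteq> S"
      proof
        fix y assume y: "y \<in> P \<inter> C"
        have "0 \<le> b \<bullet> y" if b: "b \<in> N S" for b
        proof -
          have bA: "b \<in> A" using b S' by (auto simp: A_def)
          have "0 \<le> b \<bullet> x" using full[OF S'(1) dimS] S'(2) b by auto
          with nz[OF bA] have "0 < b \<bullet> x" by simp
          with xPC bA have "b \<in> E" by (auto simp: C_def sign_cell_def split: if_splits)
          with y bA show ?thesis by (auto simp: C_def sign_cell_def)
        qed
        then show "y \<in> S" using full[OF S'(1) dimS] y by auto
      qed
      then have SC: "S \<inter> C = P \<inter> C" using S' un by auto
      have "\<nu> (R \<inter> C) = 0" if R: "R \<in> \<S> - {S}" for R
      proof (rule low)
        show "aff_dim (R \<inter> C) < m"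
        proof (cases "aff_dim R < m")
          case True
          then show ?thesis using aff_dim_subset[of "R \<inter> C" R] by simp
        next
          case False
          then have "aff_dim R = m" using Sm R by force
          moreover have "R \<inter> C \<subseteq> R \<inter> S" using sub R un by auto
          ultimately show ?thesis
            using disj[of R S] R S'(1) dimS aff_dim_subset[of "R \<inter> C" "R \<inter> S"] by auto
        qed
      qed (use S[of R] R ptC C in auto)
      then have "(\<Sum>S\<in>\<S>. \<nu> (S \<inter> C)) = \<nu> (S \<inter> C)"
        using fin S'(1) by (simp add: sum.remove)
      then show ?thesis unfolding SC by (simp add: C_def)
    qed
  qed
  have "\<nu> P = (\<Sum>E\<in>Pow A. \<nu> (P \<inter> sign_cell A E))"
    using A P by (intro sum_over_sign_cells) auto
  also have "\<dots> = (\<Sum>S\<in>\<S>. \<Sum>E\<in>Pow A. \<nu> (S \<inter> sign_cell A E))"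
    unfolding cell by (rule sum.swap)
  also have "\<dots> = (\<Sum>S\<in>\<S>. \<nu> S)"
  proof (intro sum.cong refl sum_over_sign_cells[symmetric] A(1))
    fix S assume S': "S \<in> \<S>"
    show "aff_dim S < m \<or> (\<forall>a\<in>A. \<exists>x\<in>S. a \<bullet> x \<noteq> 0)"
    proof (cases "aff_dim S < m")
      case False
      then have "aff_dim S = aff_dim P" using Sm[OF S'] P(3) by simp
      moreover have "S \<subseteq> P" using S' un by auto
      ultimately show ?thesis using A(2) nonvanishing_on_full_dim_subset[of S P] by blast
    qed simp
  qed (use S Sm in auto)
  finally show ?thesis .
qed

end

section \<open>Coning over the faces that avoid the origin\<close>

lemma polytope_point_in_rel_interior_face:
  fixes P :: "'a::euclidean_space set"
  assumes "polytope P" "y \<in> P"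
  shows "\<exists>F. F face_of P \<and> y \<in> rel_interior F"
  using assms
proof (induction "nat (aff_dim P + 1)" arbitrary: P rule: less_induct)
  case less
  have cv: "convex P" and cl: "closed P"
    using less.prems by (auto intro: polytope_imp_convex polytope_imp_closed)
  show ?case
  proof (cases "y \<in> rel_interior P")
    case True
    then show ?thesis using cv face_of_refl by blast
  next
    case False
    then have "y \<in> rel_frontier P" using less.prems cl by (simp add: rel_frontier_def closure_closed)
    then obtain G where G: "G face_of P" "G \<noteq> P" "y \<in> G"
      using rel_frontier_of_polyhedron_alt[OF polytope_imp_polyhedron[OF less.prems(1)]] by auto
    have "aff_dim G < aff_dim P" by (rule face_of_aff_dim_lt[OF cv G(1,2)])
    moreover have "- 1 \<le> aff_dim G" by (rule aff_dim_geq)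
    ultimately have "nat (aff_dim G + 1) < nat (aff_dim P + 1)" by simp
    moreover have "polytope G" by (rule face_of_polytope_polytope[OF less.prems(1) G(1)])
    ultimately obtain F where "F face_of G" "y \<in> rel_interior F"
      using less.hyps[of G] G(3) by blast
    then show ?thesis using face_of_trans[OF _ G(1)] by blast
  qed
qed

text \<open>The ray is followed to its last point in \<open>P\<close>. The face with this point in
  its relative interior cannot contain 0: otherwise the segment from 0 could be prolonged inside the
  face past the last point.\<close>

lemma polytope_ray_exit_face:
  fixes P :: "'a::euclidean_space set"
  assumes P: "polytope P" "0 \<in> P" and x: "x \<in> P" "x \<noteq> 0"
  obtains s F where "s \<ge> 1" "F face_of P" "0 \<notin> F" "s *\<^sub>R x \<in> F"
proof -
  define T where "T = {s. s \<ge> 1 \<and> s *\<^sub>R x \<in> P}"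
  have bdd: "bdd_above T"
  proof -
    obtain B where B: "\<forall>y\<in>P. norm y \<le> B"
      using polytope_imp_bounded[OF P(1)] bounded_iff by blast
    show ?thesis
    proof (rule bdd_aboveI)
      fix s assume "s \<in> T"
      then have "s * norm x \<le> B" using B by (force simp: T_def)
      then show "s \<le> B / norm x" using x(2) by (simp add: pos_le_divide_eq)
    qed
  qed
  have "closed T"
  proof -
    have "closed ({1..} \<inter> (\<lambda>s. s *\<^sub>R x) -` P)"
      by (intro closed_Int closed_atLeast closed_vimage continuous_intros polytope_imp_closed P)
    then show ?thesis by (simp add: T_def vimage_def Int_def atLeast_def)
  qed
  moreover have "T \<noteq> {}" using x(1) by (auto simp: T_def intro: exI[of _ 1])
  ultimately have sT: "Sup T \<in> T" using bdd closed_contains_Sup by blast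
  define s where "s = Sup T"
  have s: "s \<ge> 1" "s *\<^sub>R x \<in> P" using sT by (auto simp: s_def T_def)
  have smax: "s' \<le> s" if "s' \<in> T" for s'
    unfolding s_def using that bdd by (rule cSup_upper)
  obtain F where F: "F face_of P" "s *\<^sub>R x \<in> rel_interior F"
    using polytope_point_in_rel_interior_face[OF P(1) s(2)] by blast
  have cF: "convex F" using F(1) face_of_imp_convex by blast
  have sF: "s *\<^sub>R x \<in> F" using F(2) rel_interior_subset by blast
  have "0 \<notin> F"
  proof
    assume "0 \<in> F"
    then obtain e where e: "e > 1" "(1 - e) *\<^sub>R 0 + e *\<^sub>R (s *\<^sub>R x) \<in> F"
      using convex_rel_interior_iff[OF cF, of "s *\<^sub>R x"] F(2) by blast
    then have "(e * s) *\<^sub>R x \<in> P" using face_of_imp_subset[OF F(1)] by auto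
    have "e * s > s" using e(1) s(1) by simp
    moreover from this have "1 \<le> e * s" using s(1) by linarith
    ultimately have "e * s \<in> T" using \<open>(e * s) *\<^sub>R x \<in> P\<close> unfolding T_def by blast
    from smax[OF this] \<open>e * s > s\<close> show False by linarith
  qed
  with that s(1) F(1) sF show thesis by blast
qed

lemma polytope_face_avoiding_zero:
  fixes P :: "'a::euclidean_space set"
  assumes P: "polytope P" "0 \<in> P" and F: "F face_of P" "0 \<notin> F" "F \<noteq> {}"
  obtains w where "\<And>x. x \<in> P \<Longrightarrow> w \<bullet> x \<le> 1" "F = P \<inter> {x. w \<bullet> x = 1}"
proof -
  have "F exposed_face_of P"
    using exposed_face_of_polyhedron[OF polytope_imp_polyhedron[OF P(1)]] F(1) by blast
  then obtain a b where ab: "P \<subseteq> {x. a \<bullet> x \<le> b}" "F = P \<inter> {x. a \<bullet> x = b}"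
    unfolding exposed_face_of_def by blast
  have "0 \<le> b" using ab(1) P(2) by auto
  moreover have "b \<noteq> 0" using ab(2) P(2) F(2) by auto
  ultimately have b: "b > 0" by simp
  show thesis
  proof (rule that[of "a /\<^sub>R b"])
    show "(a /\<^sub>R b) \<bullet> x \<le> 1" if "x \<in> P" for x
      using ab(1) that b by (auto simp: field_simps)
    show "F = P \<inter> {x. (a /\<^sub>R b) \<bullet> x = 1}"
      using ab(2) b by (auto simp: field_simps)
  qed
qed

lemma mem_convex_hull_insert_0:
  assumes "convex K" "K \<noteq> {}"
  shows "x \<in> simplex0 K \<longleftrightarrow> (\<exists>s k. 0 \<le> s \<and> s \<le> 1 \<and> k \<in> K \<and> x = s *\<^sub>R k)"
proof -
  have "x \<in> simplex0 K \<longleftrightarrow> (\<exists>u\<ge>0. \<exists>v\<ge>0. \<exists>b. u + v = 1 \<and> b \<in> K \<and> x = v *\<^sub>R b)"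
    using assms by (simp add: convex_hull_insert convex_hull_eq[THEN iffD2])
  also have "\<dots> \<longleftrightarrow> (\<exists>s k. 0 \<le> s \<and> s \<le> 1 \<and> k \<in> K \<and> x = s *\<^sub>R k)"
  proof
    assume "\<exists>u\<ge>0. \<exists>v\<ge>0. \<exists>b. u + v = 1 \<and> b \<in> K \<and> x = v *\<^sub>R b"
    then obtain u v b where "u \<ge> 0" "v \<ge> 0" "u + v = 1" "b \<in> K" "x = v *\<^sub>R b" by blast
    then show "\<exists>s k. 0 \<le> s \<and> s \<le> 1 \<and> k \<in> K \<and> x = s *\<^sub>R k"
      by (intro exI[of _ v] exI[of _ b]) auto
  next
    assume "\<exists>s k. 0 \<le> s \<and> s \<le> 1 \<and> k \<in> K \<and> x = s *\<^sub>R k"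
    then obtain s k where "0 \<le> s" "s \<le> 1" "k \<in> K" "x = s *\<^sub>R k" by blast
    then show "\<exists>u\<ge>0. \<exists>v\<ge>0. \<exists>b. u + v = 1 \<and> b \<in> K \<and> x = v *\<^sub>R b"
      by (intro exI[of _ "1 - s"] conjI exI[of _ s] exI[of _ k]) auto
  qed
  finally show ?thesis .
qed

text \<open>The affine hull misses 0, so adjoining 0 keeps affine independence, and the differences
  to 0 are the vectors themselves.\<close>

lemma independent_if_affine_independent_on_hyperplane:
  fixes V :: "'a::euclidean_space set"
  assumes "\<not> affine_dependent V" "V \<subseteq> {x. w \<bullet> x = 1}"
  shows "independent V"
proof -
  have "affine hull V \<subseteq> {x. w \<bullet> x = 1}"
    using assms(2) by (intro hull_minimal affine_hyperplane)
  then have "0 \<notin> affine hull V" by auto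
  then have 1: "\<not> affine_dependent (insert 0 V)" "0 \<notin> V"
    using affine_independent_insert[OF assms(1), of 0] hull_inc[of 0 V affine] by blast+
  then show ?thesis using affine_dependent_iff_dependent[of 0 V] by simp
qed

lemma aff_dim_simplex_at_0:
  fixes V :: "'a::euclidean_space set"
  assumes "independent V"
  shows "aff_dim (simplex0 V) = int (card V)"
proof -
  have "aff_dim (simplex0 V) = aff_dim (insert 0 V)"
    by (rule aff_dim_convex_hull)
  also have "\<dots> = int (dim (insert 0 V))"
    by (rule aff_dim_zero) (simp add: hull_inc)
  also have "dim (insert 0 V) = card V"
    using dim_eq_card_independent[OF assms] dim_span[of "insert 0 V"] dim_span[of V]
    by (simp add: span_insert_0)
  finally show ?thesis .
qed

text \<open>Inside \<open>P\<close> the facet opposite to 0 requires no inequality of its own,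
  because \<open>w \<bullet> x \<le> 1\<close> bounds the sum of the coefficients. There remain the
  coordinate functionals, given by the dual basis, and their hyperplanes pass through the origin as
  \<open>cut\<close> demands.\<close>

lemma simplex_at_0_halfspaces:
  fixes P :: "'a::euclidean_space set"
  assumes V: "independent V" and VP: "simplex0 V \<subseteq> P" "P \<subseteq> span V"
    and w: "\<And>x. x \<in> P \<Longrightarrow> w \<bullet> x \<le> 1" "\<And>v. v \<in> V \<Longrightarrow> w \<bullet> v = 1"
  shows "\<exists>N. finite N \<and> (\<forall>b\<in>N. \<exists>x\<in>P. b \<bullet> x \<noteq> 0) \<and>
    simplex0 V = {x\<in>P. \<forall>b\<in>N. 0 \<le> b \<bullet> x}"
proof -
  have finV: "finite V" using V by (rule independent_imp_finite)
  have V0: "0 \<notin> V" using V dependent_zero by blast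
  have "\<forall>v. \<exists>b. \<forall>v'\<in>V. b \<bullet> v' = (if v' = v then 1 else 0)"
    using exists_inner_on_independent[OF V] by (rule allI)
  then obtain b where b: "\<And>v v'. v' \<in> V \<Longrightarrow> b v \<bullet> v' = (if v' = v then 1 else (0::real))"
    by metis
  have "simplex0 V \<subseteq> {x. 0 \<le> b v \<bullet> x}" for v
    by (intro hull_minimal convex_halfspace_ge) (use b in auto)
  then have 1: "simplex0 V \<subseteq> {x\<in>P. \<forall>c\<in>b ` V. 0 \<le> c \<bullet> x}"
    using VP(1) by blast
  have 2: "x \<in> simplex0 V" if x: "x \<in> P" "\<And>v. v \<in> V \<Longrightarrow> 0 \<le> b v \<bullet> x" for x
  proof -
    obtain c where c: "x = (\<Sum>v\<in>V. c v *\<^sub>R v)"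
      using x(1) VP(2) span_finite[OF finV] by auto
    have cb: "b v \<bullet> x = c v" if "v \<in> V" for v
      using that finV by (simp add: c inner_sum_right b if_distrib[of "(*) _"] cong: if_cong)
    have "w \<bullet> x = sum c V" using w(2) by (simp add: c inner_sum_right)
    with w(1)[OF x(1)] have sm: "sum c V \<le> 1" by simp
    define u where "u = c(0 := 1 - sum c V)"
    have "(\<forall>y\<in>insert 0 V. 0 \<le> u y) \<and> sum u (insert 0 V) = 1 \<and> (\<Sum>y\<in>insert 0 V. u y *\<^sub>R y) = x"
    proof (intro conjI)
      show "\<forall>y\<in>insert 0 V. 0 \<le> u y" using sm x(2) cb by (auto simp: u_def)
      have "sum u V = sum c V" "(\<Sum>y\<in>V. u y *\<^sub>R y) = x"
        using V0 unfolding c by (auto simp: u_def intro!: sum.cong)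
      then show "sum u (insert 0 V) = 1" "(\<Sum>y\<in>insert 0 V. u y *\<^sub>R y) = x"
        using finV V0 by (auto simp: u_def)
    qed
    then show ?thesis using finV by (subst convex_hull_finite) auto
  qed
  show ?thesis
  proof (intro exI[of _ "b ` V"] conjI ballI)
    fix c assume "c \<in> b ` V"
    then obtain v where v: "v \<in> V" "c = b v" by blast
    have "v \<in> P" using VP(1) hull_inc[of v "insert 0 V" convex] v by blast
    moreover have "c \<bullet> v \<noteq> 0" using b v by simp
    ultimately show "\<exists>x\<in>P. c \<bullet> x \<noteq> 0" by blast
  next
    show "simplex0 V = {x \<in> P. \<forall>c\<in>b ` V. 0 \<le> c \<bullet> x}"
    proof (rule antisym[OF 1 subsetI])
      fix x assume "x \<in> {x \<in> P. \<forall>c\<in>b ` V. 0 \<le> c \<bullet> x}"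
      then have "x \<in> P" "\<And>v. v \<in> V \<Longrightarrow> 0 \<le> b v \<bullet> x" by simp_all
      then show "x \<in> simplex0 V" by (rule 2)
    qed
  qed (use finV in simp)
qed

lemma exists_separating_normal:
  fixes S P :: "'a::euclidean_space set"
  assumes "0 \<in> S" "0 \<in> P" "aff_dim S < aff_dim P"
  shows "\<exists>b. (\<exists>x\<in>P. b \<bullet> x \<noteq> 0) \<and> S \<subseteq> {x. b \<bullet> x = 0}"
proof -
  have "aff_dim S = int (dim S)" "aff_dim P = int (dim P)"
    using assms by (auto intro!: aff_dim_zero hull_inc)
  then have "\<not> P \<subseteq> span S" using dim_subset[of P "span S"] assms(3) by auto
  then obtain x where x: "x \<in> P" "x \<notin> span S" by blast
  obtain y z where yz: "y \<in> span S" "\<And>v. v \<in> span S \<Longrightarrow> orthogonal z v" "x = y + z"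
    by (rule orthogonal_subspace_decomp_exists[of S x]) (rule that)
  have "z \<noteq> 0" using x(2) yz by auto
  moreover have "z \<bullet> y = 0" using yz(2)[OF yz(1)] by (simp add: orthogonal_def)
  ultimately have "z \<bullet> x \<noteq> 0" by (simp add: yz(3) inner_add_right)
  moreover have "S \<subseteq> {x. z \<bullet> x = 0}"
    using yz(2)[OF span_base] by (auto simp: orthogonal_def)
  ultimately show ?thesis using x(1) by (intro exI[of _ z]) auto
qed

context simple_valuation
begin

text \<open>The union of the faces avoiding 0 is triangulated, and the pieces are the cones over its
  simplices. On each simplex \<open>K\<close> some functional is 1 that is at most 1 on
  \<open>P\<close>. Hence points of two cones coincide only at equal heights, and the cones overlap
  only above \<open>K \<inter> K'\<close>.\<close>

lemma vanishes_if_vanishes_on_simplices: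
  assumes simp: "\<And>V. \<lbrakk>independent V; int (card V) = m\<rbrakk> \<Longrightarrow> \<nu> (simplex0 V) = 0"
    and P: "polytope P" "0 \<in> P" "aff_dim P = m"
  shows "\<nu> P = 0"
\<comment> \<open>The single point has no nonempty face avoiding 0 and would not be covered by
  cones; it is the simplex on no further vertices.\<close>
proof (cases "P = {0}")
  case True
  then have "m = 0" using P(3) by (simp add: aff_dim_sing)
  then show ?thesis using simp[of "{}"] True by (simp add: independent_empty)
next
  case False
  define \<M> where "\<M> = {F. F face_of P \<and> 0 \<notin> F}"
  have cvP: "convex P" using P(1) by (rule polytope_imp_convex)
  have M1: "finite \<M>"
    unfolding \<M>_def by (rule finite_subset[OF _ finite_polytope_faces[OF P(1)]]) auto
  have M2: "polytope F" if "F \<in> \<M>" for F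
    using face_of_polytope_polytope[OF P(1)] that by (auto simp: \<M>_def)
  have M3: "F1 \<inter> F2 face_of F1" if "F1 \<in> \<M>" "F2 \<in> \<M>" for F1 F2
    using that face_of_Int[of F1 P F2] face_of_face[of F1 P "F1 \<inter> F2"] by (auto simp: \<M>_def)
  obtain \<T> where T: "simplicial_complex \<T>" "\<Union>\<T> = \<Union>\<M>"
      and TM: "\<And>K. K \<in> \<T> \<Longrightarrow> \<exists>C. C \<in> \<M> \<and> K \<subseteq> C"
    by (rule simplicial_subdivision_of_cell_complex[OF M1 M2 M3]) (assumption+, rule that)
  define \<K> where "\<K> = \<T> - {{}}"
  define S where "S K = simplex0 K" for K :: "'a set"
  have finK: "finite \<K>" using T(1) by (auto simp: \<K>_def simplicial_complex_def)
  have inter: "K \<inter> K' face_of K" if "K \<in> \<K>" "K' \<in> \<K>" for K K'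
    using T(1) that by (auto simp: \<K>_def simplicial_complex_def)
  have Kface: "\<exists>w. (\<forall>x\<in>P. w \<bullet> x \<le> 1) \<and> K \<subseteq> P \<inter> {x. w \<bullet> x = 1}" if K: "K \<in> \<K>" for K
  proof -
    obtain C where C: "C \<in> \<M>" "K \<subseteq> C" using TM[of K] K by (auto simp: \<K>_def)
    then have "C face_of P" "0 \<notin> C" "C \<noteq> {}" using K by (auto simp: \<M>_def \<K>_def)
    then obtain w where "\<And>x. x \<in> P \<Longrightarrow> w \<bullet> x \<le> 1" "C = P \<inter> {x. w \<bullet> x = 1}"
      using polytope_face_avoiding_zero[OF P(1,2)] by metis
    with C(2) show ?thesis by (intro exI[of _ w]) simp
  qed
  have Kvert: "\<exists>V. independent V \<and> K = convex hull V \<and> S K = simplex0 V \<and>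
      aff_dim K = int (card V) - 1 \<and> aff_dim (S K) = int (card V)" if K: "K \<in> \<K>" for K
  proof -
    obtain i where "i simplex K"
      using T(1) K unfolding \<K>_def simplicial_complex_def by blast
    then obtain V where V: "\<not> affine_dependent V" "K = convex hull V"
      by (auto simp: simplex_def)
    obtain w where "K \<subseteq> {x. w \<bullet> x = 1}" using Kface[OF K] by blast
    then have "V \<subseteq> {x. w \<bullet> x = 1}" using hull_subset[of V convex] V(2) by simp
    then have ind: "independent V" by (rule independent_if_affine_independent_on_hyperplane[OF V(1)])
    have "S K = simplex0 V"
      unfolding S_def V(2) by (rule hull_insert[symmetric])
    moreover have "aff_dim K = int (card V) - 1"
      using V affine_independent_iff_card[of V] by (simp add: aff_dim_convex_hull)
    ultimately show ?thesis using ind V(2) aff_dim_simplex_at_0[OF ind] by auto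
  qed
  have cvK: "convex K" "K \<noteq> {}" if "K \<in> \<K>" for K
    using Kvert[OF that] that convex_convex_hull by (auto simp: \<K>_def)
  have memS: "x \<in> S K \<longleftrightarrow> (\<exists>s k. 0 \<le> s \<and> s \<le> 1 \<and> k \<in> K \<and> x = s *\<^sub>R k)" if "K \<in> \<K>" for x K
    unfolding S_def using cvK[OF that] by (rule mem_convex_hull_insert_0)
  have SP: "S K \<subseteq> P" if "K \<in> \<K>" for K
    unfolding S_def using Kface[OF that] P(2) cvP by (intro hull_minimal) auto
  have ptS: "polytope (S K)" if K: "K \<in> \<K>" for K
  proof -
    obtain V where "independent V" "S K = simplex0 V" using Kvert[OF K] by blast
    then show ?thesis using independent_imp_finite by (auto intro!: polytope_convex_hull)
  qed
  have S0: "0 \<in> S K" for K by (simp add: S_def hull_inc)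
  obtain z where z: "z \<in> P" "z \<noteq> 0" using False P(2) by blast
  have cover: "\<Union>(S ` \<K>) = P"
  proof (intro antisym)
    show "P \<subseteq> \<Union>(S ` \<K>)"
    proof
      fix x assume x: "x \<in> P"
      have *: "x \<in> \<Union>(S ` \<K>)" if xx: "x \<in> P" "x \<noteq> 0" for x
      proof -
        obtain s F where F: "s \<ge> 1" "F face_of P" "0 \<notin> F" "s *\<^sub>R x \<in> F"
          using polytope_ray_exit_face[OF P(1,2) xx] .
        then have "s *\<^sub>R x \<in> \<Union>\<T>" unfolding T(2) by (auto simp: \<M>_def)
        then obtain K where K: "K \<in> \<K>" "s *\<^sub>R x \<in> K" by (auto simp: \<K>_def)
        have "x = (1 / s) *\<^sub>R (s *\<^sub>R x)" using F(1) by simp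
        then have "x \<in> S K"
          unfolding memS[OF K(1)] using F(1) K(2) by (intro exI[of _ "1 / s"] exI[of _ "s *\<^sub>R x"]) auto
        with K(1) show ?thesis by blast
      qed
      show "x \<in> \<Union>(S ` \<K>)"
      proof (cases "x = 0")
        case True
        then show ?thesis using *[OF z] S0 by blast
      qed (use * x in blast)
    qed
  qed (use SP in blast)
  have m1: "1 \<le> m"
  proof -
    have "aff_dim P = int (dim P)" using P(2) by (intro aff_dim_zero hull_inc)
    moreover have "dim P \<noteq> 0" using z by (auto simp: dim_eq_0)
    ultimately show ?thesis using P(3) by linarith
  qed
  have "\<forall>S'\<in>S ` \<K>. \<exists>N. finite N \<and> (\<forall>b\<in>N. \<exists>x\<in>P. b \<bullet> x \<noteq> 0) \<and>
      (aff_dim S' = m \<longrightarrow> S' = {x\<in>P. \<forall>b\<in>N. 0 \<le> b \<bullet> x}) \<and>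
      (aff_dim S' < m \<longrightarrow> (\<exists>b\<in>N. S' \<subseteq> {x. b \<bullet> x = 0}))"
    (is "\<forall>S'\<in>_. ?N S'")
  proof
    fix S' assume S': "S' \<in> S ` \<K>"
    show "?N S'"
    proof (cases "aff_dim S' < m")
      case True
      obtain K where K: "K \<in> \<K>" "S' = S K" using S' by blast
      obtain b where "\<exists>x\<in>P. b \<bullet> x \<noteq> 0" "S' \<subseteq> {x. b \<bullet> x = 0}"
        using exists_separating_normal[of S' P] S0[of K] P True K(2) by auto
      with True show ?thesis by (intro exI[of _ "{b}"]) auto
    next
      case False
      obtain K where K: "K \<in> \<K>" "S' = S K" using S' by blast
      obtain V where V: "independent V" "K = convex hull V" "S K = simplex0 V"
          "aff_dim (S K) = int (card V)"
        using Kvert[OF K(1)] by blast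
      obtain w where w: "\<forall>x\<in>P. w \<bullet> x \<le> 1" "K \<subseteq> P \<inter> {x. w \<bullet> x = 1}" using Kface[OF K(1)] by blast
      have VK: "V \<subseteq> K" unfolding V(2) by (rule hull_subset)
      have "aff_dim S' \<le> m" using aff_dim_subset[OF SP[OF K(1)]] K(2) P(3) by simp
      with False have "aff_dim S' = m" by simp
      then have "int (card V) = int (dim P)"
        using V(4) K(2) P(2,3) aff_dim_zero[of P] by (simp add: hull_inc)
      moreover have VP: "V \<subseteq> P" using VK w(2) by blast
      ultimately have PV: "P \<subseteq> span V" by (intro card_ge_dim_independent[OF VP V(1)]) simp
      have hV: "simplex0 V \<subseteq> P" using SP[OF K(1)] V(3) by simp
      have wV: "\<And>x. x \<in> P \<Longrightarrow> w \<bullet> x \<le> 1" "\<And>v. v \<in> V \<Longrightarrow> w \<bullet> v = 1"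
        using w VK by blast+
      obtain N where "finite N" "\<forall>b\<in>N. \<exists>x\<in>P. b \<bullet> x \<noteq> 0" "S' = {x\<in>P. \<forall>b\<in>N. 0 \<le> b \<bullet> x}"
        using simplex_at_0_halfspaces[OF V(1) hV PV wV] unfolding V(3)[symmetric] K(2)[symmetric] by blast
      with False show ?thesis by (intro exI[of _ N]) blast
    qed
  qed
  from bchoice[OF this]
  obtain N where N: "\<forall>S'\<in>S ` \<K>. finite (N S') \<and> (\<forall>b\<in>N S'. \<exists>x\<in>P. b \<bullet> x \<noteq> 0) \<and>
      (aff_dim S' = m \<longrightarrow> S' = {x\<in>P. \<forall>b\<in>N S'. 0 \<le> b \<bullet> x}) \<and>
      (aff_dim S' < m \<longrightarrow> (\<exists>b\<in>N S'. S' \<subseteq> {x. b \<bullet> x = 0}))"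
    by (elim exE) (rule that)
  have disj: "aff_dim (S K \<inter> S K') < m"
    if K: "K \<in> \<K>" "K' \<in> \<K>" "S K \<noteq> S K'" "aff_dim (S K) = m" "aff_dim (S K') = m" for K K'
  proof -
    have dimK: "aff_dim K = m - 1" "aff_dim K' = m - 1"
      using Kvert[OF K(1)] Kvert[OF K(2)] K(4,5) by auto
    \<comment> \<open>A common face of full dimension would equal both \<open>K\<close> and
      \<open>K'\<close>, against \<open>S K \<noteq> S K'\<close>.\<close>
    have less: "aff_dim (K \<inter> K') < m - 1"
    proof (rule ccontr)
      assume ge: "\<not> ?thesis"
      have "K \<inter> K' = K"
        using face_of_aff_dim_lt[OF cvK(1)[OF K(1)] inter[OF K(1,2)]] ge dimK by auto
      moreover have "K' \<inter> K = K'"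
        using face_of_aff_dim_lt[OF cvK(1)[OF K(2)] inter[OF K(2,1)]] ge dimK by (auto simp: Int_commute)
      ultimately show False using K(3) by (metis Int_commute)
    qed
    obtain w where w: "\<forall>x\<in>P. w \<bullet> x \<le> 1" "K \<subseteq> P \<inter> {x. w \<bullet> x = 1}" using Kface[OF K(1)] by blast
    obtain w' where w': "\<forall>x\<in>P. w' \<bullet> x \<le> 1" "K' \<subseteq> P \<inter> {x. w' \<bullet> x = 1}" using Kface[OF K(2)] by blast
    have sub: "S K \<inter> S K' \<subseteq> span (K \<inter> K')"
    proof
      fix x assume "x \<in> S K \<inter> S K'"
      then obtain s k s' k' where k: "0 \<le> s" "k \<in> K" "x = s *\<^sub>R k" "0 \<le> s'" "k' \<in> K'" "x = s' *\<^sub>R k'"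
        using memS[OF K(1)] memS[OF K(2)] by blast
      have "w \<bullet> k = 1" "w \<bullet> k' \<le> 1" "w' \<bullet> k' = 1" "w' \<bullet> k \<le> 1" using w w' k by auto
      moreover have "s * (w \<bullet> k) = s' * (w \<bullet> k')" "s * (w' \<bullet> k) = s' * (w' \<bullet> k')"
        using k(3,6) by (metis inner_scaleR_right)+
      \<comment> \<open>Each functional is at most 1 on the other simplex, so each of the two
        heights bounds the other.\<close>
      ultimately have "s = s' * (w \<bullet> k')" "s' = s * (w' \<bullet> k)"
        "s' * (w \<bullet> k') \<le> s'" "s * (w' \<bullet> k) \<le> s"
        using k(1,4) mult_left_le[of "w \<bullet> k'" s'] mult_left_le[of "w' \<bullet> k" s] by simp_all
      then have ss: "s = s'" by linarith
      show "x \<in> span (K \<inter> K')"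
      proof (cases "s = 0")
        case False
        then have "k = k'" using k(3,6) ss by simp
        then show ?thesis using k by (auto intro: span_scale span_base)
      qed (simp add: k(3) span_zero)
    qed
    have "aff_dim (S K \<inter> S K') = int (dim (S K \<inter> S K'))"
      using S0 by (intro aff_dim_zero hull_inc) auto
    also have "\<dots> \<le> int (dim (span (K \<inter> K')))"
      using dim_subset[OF sub] by linarith
    also have "\<dots> = int (dim (insert 0 (K \<inter> K')))"
      by (metis dim_span span_insert_0)
    also have "\<dots> = aff_dim (insert 0 (K \<inter> K'))"
      by (intro aff_dim_zero[symmetric] hull_inc) auto
    also have "\<dots> \<le> aff_dim (K \<inter> K') + 1"
      by (simp add: aff_dim_insert)
    finally show ?thesis using less by simp
  qed
  have "\<nu> P = (\<Sum>S'\<in>S ` \<K>. \<nu> S')"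
  proof (rule sum_over_dissection[OF P, where N = N])
    show "finite (S ` \<K>)" using finK by simp
    show "\<Union>(S ` \<K>) = P" by (rule cover)
  next
    fix S' assume S': "S' \<in> S ` \<K>"
    note NS = N[rule_format, OF S']
    show "polytope S' \<and> 0 \<in> S' \<and> finite (N S') \<and> (\<forall>b\<in>N S'. \<exists>x\<in>P. b \<bullet> x \<noteq> 0)"
      using S' ptS S0 NS by blast
    show "S' = {x\<in>P. \<forall>b\<in>N S'. 0 \<le> b \<bullet> x}" if "aff_dim S' = m" using NS that by blast
    show "\<exists>b\<in>N S'. S' \<subseteq> {x. b \<bullet> x = 0}" if "aff_dim S' < m" using NS that by blast
  next
    fix S1 S2 assume "S1 \<in> S ` \<K>" "S2 \<in> S ` \<K>" "S1 \<noteq> S2" "aff_dim S1 = m" "aff_dim S2 = m"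
    then show "aff_dim (S1 \<inter> S2) < m" using disj by blast
  qed
  also have "\<dots> = 0"
  proof (rule sum.neutral, intro ballI)
    fix S' assume "S' \<in> S ` \<K>"
    then obtain K where K: "K \<in> \<K>" "S' = S K" by blast
    obtain V where V: "independent V" "S K = simplex0 V" "aff_dim (S K) = int (card V)"
      using Kvert[OF K(1)] by blast
    have "aff_dim (S K) \<le> m" using aff_dim_subset[OF SP[OF K(1)]] P(3) by simp
    then consider "aff_dim (S K) < m" | "aff_dim (S K) = m" by linarith
    then show "\<nu> S' = 0"
    proof cases
      case 1
      then show ?thesis using low[OF ptS[OF K(1)] S0] K(2) by simp
    next
      case 2
      then show ?thesis using simp[OF V(1)] V K(2) by simp
    qed
  qed
  finally show ?thesis .
qed

end

section \<open>Lebesgue measure of linear images and of prisms\<close>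

text \<open>The library proves the next lemma only for well-ordered index types.\<close>

lemma measure_linear_image_cart:
  fixes f :: "real^'n::finite \<Rightarrow> real^'n"
  assumes f: "linear f" and S: "S \<in> lmeasurable"
  shows "f ` S \<in> lmeasurable \<and> measure lebesgue (f ` S) = \<bar>det (matrix f)\<bar> * measure lebesgue S"
proof -
  let ?P = "\<lambda>f :: real^'n \<Rightarrow> real^'n. \<forall>S\<in>lmeasurable. f ` S \<in> lmeasurable \<and>
    measure lebesgue (f ` S) = \<bar>det (matrix f)\<bar> * measure lebesgue S"
  have unimod: "?P h" if lin: "linear h" and det: "\<bar>det (matrix h)\<bar> = 1"
    and im: "\<And>a b. measure lebesgue (h ` cbox a b) = 1 * measure lebesgue (cbox a b)" for h
    unfolding det by (metis measure_linear_sufficient[OF lin _ im])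
  have "?P f"
  proof (rule induct_linear_elementary[OF f])
    fix f g :: "real^'n \<Rightarrow> real^'n"
    assume fg: "linear f" "linear g" "?P f" "?P g"
    show "?P (f \<circ> g)"
    proof
      fix S :: "(real^'n) set" assume "S \<in> lmeasurable"
      with fg have g: "g ` S \<in> lmeasurable" "measure lebesgue (g ` S) = \<bar>det (matrix g)\<bar> * measure lebesgue S"
        by auto
      have "(f \<circ> g) ` S = f ` (g ` S)" by (simp only: image_comp)
      with fg(3) g show "(f \<circ> g) ` S \<in> lmeasurable \<and>
          measure lebesgue ((f \<circ> g) ` S) = \<bar>det (matrix (f \<circ> g))\<bar> * measure lebesgue S"
        by (simp add: matrix_compose[OF fg(2,1)] det_mul abs_mult del: image_comp o_apply)
    qed
  next
    fix f :: "real^'n \<Rightarrow> real^'n" and i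
    assume f: "linear f" "\<And>x. f x $ i = 0"
    have "row i (matrix f) = 0"
      by (simp add: vec_eq_iff row_def matrix_def f(2))
    then have "det (matrix f) = 0" by (rule det_zero_row(2))
    moreover have "negligible (f ` S)" for S
      by (rule negligible_subset[OF negligible_standard_hyperplane_cart[of i]]) (auto simp: f(2))
    ultimately show "?P f"
      by (simp add: negligible_iff_measure)
  next
    fix c :: "'n \<Rightarrow> real"
    have "matrix (\<lambda>x::real^'n. \<chi> i. c i * x $ i) = (\<chi> i j. if i = j then c i else 0)"
      by (auto simp: matrix_def axis_def vec_eq_iff)
    then have "det (matrix (\<lambda>x::real^'n. \<chi> i. c i * x $ i)) = prod c UNIV"
      by (simp add: det_diagonal)
    then show "?P (\<lambda>x. \<chi> i. c i * x $ i)"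
      using measurable_stretch[of _ c] measure_stretch[of _ c] by simp
  next
    fix m n :: 'n
    let ?h = "\<lambda>x::real^'n. \<chi> i. x $ Transposition.transpose m n i"
    have lin: "linear ?h" by (rule linearI) (simp_all add: vec_eq_iff)
    have "?h \<circ> ?h = id" by (simp add: fun_eq_iff vec_eq_iff)
    then have "matrix ?h ** matrix ?h = mat 1"
      by (simp only: matrix_compose[OF lin lin, symmetric] matrix_id_mat_1)
    then have "(det (matrix ?h))\<^sup>2 = 1"
      by (metis det_I det_mul power2_eq_square)
    then have "\<bar>det (matrix ?h)\<bar> = 1" by (simp only: abs_square_eq_1)
    moreover have "measure lebesgue (?h ` cbox a b) = 1 * measure lebesgue (cbox a b)" for a b
    proof (cases "cbox a b = {}")
      case False
      have img: "?h ` cbox a b = cbox (?h a) (?h b)"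
      proof (intro antisym subsetI)
        fix y assume y: "y \<in> cbox (?h a) (?h b)"
        have "?h y \<in> cbox a b"
          unfolding mem_box_cart
        proof
          fix i
          show "a $ i \<le> ?h y $ i \<and> ?h y $ i \<le> b $ i"
            using y[unfolded mem_box_cart, rule_format, of "Transposition.transpose m n i"] by simp
        qed
        moreover have "y = ?h (?h y)" by (simp add: vec_eq_iff)
        ultimately show "y \<in> ?h ` cbox a b" by blast
      qed (auto simp: mem_box_cart)
      have c: "measure lebesgue (cbox x y) = (\<Prod>i\<in>UNIV. y $ i - x $ i)"
        if "cbox x y \<noteq> {}" for x y :: "real^'n"
        using content_cbox_cart[OF that] by simp
      have ne: "cbox (?h a) (?h b) \<noteq> {}"
        unfolding img[symmetric] using False by (simp only: image_is_empty not_False_eq_True)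
      have pm: "(\<Prod>i\<in>UNIV. ?h b $ i - ?h a $ i) = (\<Prod>i\<in>UNIV. b $ i - a $ i)"
        using prod.permute[OF permutes_swap_id[of m UNIV n], of "\<lambda>i. b $ i - a $ i"]
        by (simp only: o_def vec_lambda_beta UNIV_I)
      show ?thesis
        unfolding img c[OF ne] c[OF False] pm by simp
    qed (simp only: image_empty measure_empty mult_zero_right)
    ultimately show "?P ?h"
      by (intro unimod lin)
  next
    fix m n :: 'n assume mn: "m \<noteq> n"
    let ?h = "\<lambda>x::real^'n. \<chi> i. if i = m then x $ m + x $ n else x $ i"
    have lin: "linear ?h" by (rule linearI) (auto simp: vec_eq_iff algebra_simps)
    have "matrix ?h = (\<chi> k. if k = m then row m (mat 1) + 1 *s row n (mat 1) else row k (mat 1))"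
      using mn by (auto simp: matrix_def row_def mat_def axis_def vec_eq_iff)
    then have "\<bar>det (matrix ?h)\<bar> = 1"
      using det_row_operation[OF mn, of "mat 1 :: real^'n^'n" 1] by simp
    moreover have "measure lebesgue (?h ` cbox a b) = 1 * measure lebesgue (cbox a b)" for a b
    proof (cases "cbox a b = {}")
      case False
      \<comment> \<open>The formula for sheared boxes asks for a nonnegative coordinate at the lower
        corner, so the box is moved to have 0 as that corner.\<close>
      have tr: "cbox a b = (+) a ` cbox 0 (b - a)"
        using cbox_translation[of a 0 "b - a"] by simp
      then have ne: "cbox 0 (b - a) \<noteq> {}" using False by auto
      have "?h ` cbox a b = (+) (?h a) ` (?h ` cbox 0 (b - a))"
        unfolding tr image_image using linear_add[OF lin] by simp
      then have "measure lebesgue (?h ` cbox a b) = measure lebesgue (?h ` cbox 0 (b - a))"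
        by (simp only: measure_translation)
      also have "\<dots> = measure lebesgue (cbox 0 (b - a))"
        by (rule measure_shear_interval[OF mn ne]) simp
      also have "\<dots> = measure lebesgue (cbox a b)"
        unfolding tr by (rule measure_translation[symmetric])
      finally show ?thesis by simp
    qed (simp only: image_empty measure_empty mult_zero_right)
    ultimately show "?P ?h"
      by (intro unimod lin)
  qed
  with S show ?thesis by blast
qed

text \<open>Boxes determine Lebesgue measure, and the preimage of a box is its image under the
  inverse isometry, whose determinant is 1 or -1.\<close>

lemma lborel_distr_isometry:
  fixes f :: "real^'n::finite \<Rightarrow> real^'n"
  assumes f: "orthogonal_transformation f"
  shows "distr lborel borel f = lborel"
proof (rule lborel_eqI[symmetric])
  have lin: "linear f" using f by (rule orthogonal_transformation_linear)
  have contf: "continuous_on UNIV f" using lin by (rule linear_continuous_on_compose[OF continuous_on_id, simplified])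
  then have mf[measurable]: "f \<in> borel_measurable lborel"
    by (simp add: borel_measurable_continuous_onI)
  have bij: "bij f" using f by (rule orthogonal_transformation_bij)
  define g where "g = inv f"
  have g: "orthogonal_transformation g" unfolding g_def using f by (rule orthogonal_transformation_inv)
  then have ling: "linear g" by (rule orthogonal_transformation_linear)
  have "orthogonal_matrix (matrix g)" using g orthogonal_transformation_matrix by blast
  then have "\<bar>det (matrix g)\<bar> = 1" using det_orthogonal_matrix by fastforce
  fix l u :: "real^'n" assume le: "\<And>b. b \<in> Basis \<Longrightarrow> l \<bullet> b \<le> u \<bullet> b"
  have img: "f -` box l u = g ` box l u"
    unfolding g_def using bij by (simp add: bij_vimage_eq_inv_image)
  have lm: "box l u \<in> lmeasurable" by simp
  have gm: "g ` box l u \<in> lmeasurable" "measure lebesgue (g ` box l u) = measure lebesgue (box l u)"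
    using measure_linear_image_cart[OF ling lm] \<open>\<bar>det (matrix g)\<bar> = 1\<close> by simp_all
  have sb: "f -` box l u \<in> sets borel"
    using measurable_sets[OF mf, of "box l u"] by simp
  have "emeasure (distr lborel borel f) (box l u) = emeasure lborel (f -` box l u)"
    by (subst emeasure_distr) auto
  also have "\<dots> = emeasure lebesgue (f -` box l u)"
    using sb by simp
  also have "\<dots> = ennreal (measure lebesgue (box l u))"
    unfolding img gm(2)[symmetric] using gm(1) by (rule emeasure_eq_measure2)
  also have "\<dots> = ennreal (measure lborel (box l u))" by simp
  also have "\<dots> = (\<Prod>b\<in>Basis. (u - l) \<bullet> b)"
    using le by (simp add: measure_lborel_box_eq)
  finally show "emeasure (distr lborel borel f) (box l u) = (\<Prod>b\<in>Basis. (u - l) \<bullet> b)" .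
qed simp

text \<open>The link between the product measure behind \<open>hyperplane_volume\<close> and
  Lebesgue measure on the whole space. The isometry from the standard basis to \<open>B\<close>
  reduces the claim to standard coordinates.\<close>

lemma PiM_lborel_orthonormal:
  fixes B :: "(real^'n::finite) set"
  assumes B: "pairwise orthogonal B" "\<And>b. b \<in> B \<Longrightarrow> norm b = 1" "span B = UNIV"
  shows "distr lborel (PiM B (\<lambda>_. lborel)) (\<lambda>x. \<lambda>b\<in>B. x \<bullet> b) = PiM B (\<lambda>_. lborel :: real measure)"
proof -
  interpret product_sigma_finite "\<lambda>_. lborel :: real measure"
    by standard
  have "0 \<notin> B" using B(2) by force
  then have ind: "independent B" using B(1) pairwise_orthogonal_independent by blast
  then have finB: "finite B" using independent_imp_finite by blast
  have "card B = card (Basis :: (real^'n) set)"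
    using dim_eq_card_independent[OF ind] B(3) dim_span[of B] dim_UNIV[where 'a = "real^'n"] by simp
  then obtain g where g: "bij_betw g (Basis :: (real^'n) set) B"
    using finite_same_card_bij[OF finite_Basis finB] by metis
  have gB: "g e \<in> B" if "e \<in> Basis" for e using g that bij_betw_apply by metis
  have gg: "g d \<bullet> g e = (if d = e then 1 else 0)" if "d \<in> Basis" "e \<in> Basis" for d e
  proof (cases "d = e")
    case False
    then have "g d \<noteq> g e" using g that by (auto simp: bij_betw_def inj_on_def)
    then have "orthogonal (g d) (g e)" using B(1) gB that by (auto simp: pairwise_def)
    then show ?thesis using False by (simp add: orthogonal_def)
  qed (use B(2) gB that in \<open>simp add: norm_eq_1\<close>)
  define f where "f x = (\<Sum>e\<in>Basis. (x \<bullet> e) *\<^sub>R g e)" for x :: "real^'n"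
  have lin: "linear f"
    by (rule linearI) (simp_all add: f_def inner_add_left scaleR_add_left sum.distrib scaleR_sum_right)
  have fg: "f x \<bullet> g e = x \<bullet> e" if "e \<in> Basis" for x e
  proof -
    have "f x \<bullet> g e = (\<Sum>d\<in>Basis. (x \<bullet> d) * (if d = e then 1 else 0))"
      unfolding f_def inner_sum_left using gg that by (intro sum.cong) auto
    also have "\<dots> = x \<bullet> e" using that by (simp add: if_distrib[of "(*) _"] cong: if_cong)
    finally show ?thesis .
  qed
  have "f x \<bullet> f y = x \<bullet> y" for x y
  proof -
    have "f x \<bullet> f y = (\<Sum>e\<in>Basis. (y \<bullet> e) * (f x \<bullet> g e))"
      by (subst f_def[of y]) (simp add: inner_sum_right)
    also have "\<dots> = x \<bullet> y" by (simp add: fg euclidean_inner[of x y] mult.commute)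
    finally show ?thesis .
  qed
  then have orth: "orthogonal_transformation f"
    using lin by (simp add: orthogonal_transformation_def)
  have meas: "(\<lambda>x. \<lambda>b\<in>B. x \<bullet> b) \<in> measurable lborel (PiM B (\<lambda>_. lborel :: real measure))"
    by (intro measurable_restrict) simp
  show ?thesis
  proof (rule PiM_eqI[OF finB])
    fix A :: "real^'n \<Rightarrow> real set" assume A: "\<And>b. b \<in> B \<Longrightarrow> A b \<in> sets lborel"
    have AM: "Pi\<^sub>E B A \<in> sets (PiM B (\<lambda>_. lborel))"
      using A finB by (intro sets_PiM_I_finite) auto
    define X where "X = {x :: real^'n. \<forall>b\<in>B. x \<bullet> b \<in> A b}"
    have X: "X = (\<lambda>x. \<lambda>b\<in>B. x \<bullet> b) -` Pi\<^sub>E B A \<inter> space lborel"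
      by (auto simp: X_def PiE_iff)
    have Xs: "X \<in> sets borel" using measurable_sets[OF meas AM] by (simp only: X sets_lborel)
    have contf: "f \<in> borel_measurable borel"
      using linear_continuous_on[of f UNIV] lin by (intro borel_measurable_continuous_onI) (simp add: linear_linear)
    have AgM: "Pi\<^sub>E Basis (\<lambda>e. A (g e)) \<in> sets (PiM (Basis :: (real^'n) set) (\<lambda>_. lborel))"
      using A gB by (intro sets_PiM_I_finite) auto
    have "emeasure (distr lborel (PiM B (\<lambda>_. lborel)) (\<lambda>x. \<lambda>b\<in>B. x \<bullet> b)) (Pi\<^sub>E B A) = emeasure lborel X"
      using meas AM by (simp add: emeasure_distr X)
    also have "\<dots> = emeasure (distr lborel borel f) X"
      by (simp only: lborel_distr_isometry[OF orth])
    also have "\<dots> = emeasure lborel (f -` X)"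
      using contf Xs by (subst emeasure_distr) auto
    also have "f -` X = {x. \<forall>e\<in>Basis. x \<bullet> e \<in> A (g e)}"
      using g fg by (auto simp: X_def bij_betw_def)
    also have "emeasure lborel \<dots> = emeasure (distr (PiM Basis (\<lambda>_. lborel)) borel (\<lambda>h. \<Sum>e\<in>Basis. h e *\<^sub>R e)) \<dots>"
      by (simp only: lborel_eq[symmetric])
    also have "\<dots> = emeasure (PiM Basis (\<lambda>_. lborel)) (Pi\<^sub>E Basis (\<lambda>e. A (g e)))"
    proof (subst emeasure_distr)
      have "{x. \<forall>e\<in>Basis. x \<bullet> e \<in> A (g e)} = f -` X"
        using g fg by (auto simp: X_def bij_betw_def)
      then show "{x. \<forall>e\<in>Basis. x \<bullet> e \<in> A (g e)} \<in> sets borel"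
        using measurable_sets[OF contf Xs] by simp
      show "emeasure (PiM Basis (\<lambda>_. lborel)) ((\<lambda>h. \<Sum>e\<in>Basis. h e *\<^sub>R e) -` {x :: real^'n. \<forall>e\<in>Basis. x \<bullet> e \<in> A (g e)}
            \<inter> space (PiM Basis (\<lambda>_. lborel)))
          = emeasure (PiM Basis (\<lambda>_. lborel)) (Pi\<^sub>E Basis (\<lambda>e. A (g e)))"
        by (intro arg_cong2[where f = emeasure] refl) (auto simp: space_PiM PiE_iff inner_sum_left inner_Basis if_distrib cong: if_cong)
    qed simp
    also have "\<dots> = (\<Prod>e\<in>Basis. emeasure lborel (A (g e)))"
      using A gB by (intro emeasure_PiM) auto
    also have "\<dots> = (\<Prod>b\<in>B. emeasure lborel (A b))"
      by (rule prod.reindex_bij_betw[OF g])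
    finally show "emeasure (distr lborel (PiM B (\<lambda>_. lborel)) (\<lambda>x. \<lambda>b\<in>B. x \<bullet> b)) (Pi\<^sub>E B A)
        = (\<Prod>b\<in>B. emeasure lborel (A b))" .
  qed simp
qed

lemma inner_sum_orthonormal:
  assumes "finite B" "pairwise orthogonal B" "\<And>b. b \<in> B \<Longrightarrow> norm b = 1" "b \<in> B"
  shows "(\<Sum>d\<in>B. c d *\<^sub>R d) \<bullet> b = c b"
proof -
  have "(\<Sum>d\<in>B. c d *\<^sub>R d) \<bullet> b = (\<Sum>d\<in>B. if d = b then c d else 0)"
    unfolding inner_sum_left
  proof (rule sum.cong[OF refl])
    fix d assume "d \<in> B"
    then show "c d *\<^sub>R d \<bullet> b = (if d = b then c d else 0)"
      using assms by (cases "d = b") (auto simp: pairwise_def orthogonal_def norm_eq_1)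
  qed
  then show ?thesis using assms by simp
qed

text \<open>The cylinder swept by \<open>F\<close> along \<open>- z\<close>. If a functional is 1 on
  \<open>F\<close> and at \<open>z\<close>, the cylinder ends in the parallel hyperplane through 0,
  and its volume is n times that of the cone over \<open>F\<close> with apex 0.\<close>

definition prism :: "'a::real_vector set \<Rightarrow> 'a \<Rightarrow> 'a set" where
  "prism F z = {y - s *\<^sub>R z | y s. y \<in> F \<and> 0 \<le> s \<and> s \<le> 1}"

lemma compact_prism:
  fixes F :: "'a::euclidean_space set"
  assumes "compact F"
  shows "compact (prism F z)"
proof -
  have "prism F z = (\<lambda>(y, s). y - s *\<^sub>R z) ` (F \<times> {0..1})"
    by (force simp: prism_def)
  also have "compact \<dots>"
    using assms by (intro compact_continuous_image compact_Times)
      (auto intro!: continuous_intros simp: case_prod_unfold)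
  finally show ?thesis .
qed

text \<open>In coordinates with respect to \<open>B\<close> and \<open>u\<close> the prism is the
  product of the coordinate image \<open>E\<close> of \<open>F\<close> with an interval of length
  \<open>h\<close>. Integration over the \<open>u\<close> coordinate leaves the measure of
  \<open>E\<close>.\<close>

lemma measure_prism_normal:
  fixes u :: "real^'n::finite"
  assumes u: "norm u = 1" and h: "h > 0" and F: "compact F" "F \<subseteq> {y. y \<bullet> u = h}"
  shows "measure lebesgue (prism F (h *\<^sub>R u)) = h * hyperplane_volume u F"
proof -
  define B where "B = (SOME B. orthonormal_basis_perp u B)"
  have "orthonormal_basis_perp u B"
    unfolding B_def using orthonormal_basis_perp_exists by (rule someI_ex)
  then have B: "pairwise orthogonal B" "\<And>b. b \<in> B \<Longrightarrow> norm b = 1" "span B = {x. u \<bullet> x = 0}" "finite B"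
    using orthonormal_basis_perp_card(1)[of u B] u by (force simp: orthonormal_basis_perp_def)+
  have ub: "u \<bullet> b = 0" if "b \<in> B" for b using B(3) that span_base[of b B] by auto
  have uu: "u \<bullet> u = 1" using u by (simp add: norm_eq_1)
  have uB: "u \<notin> B" using ub uu by force
  interpret product_sigma_finite "\<lambda>_. lborel :: real measure"
    by standard
  let ?B' = "insert u B" and ?M = "\<lambda>I :: (real^'n) set. PiM I (\<lambda>_. lborel :: real measure)"
  define crd where "crd C x = (\<lambda>b\<in>C. x \<bullet> b)" for C and x :: "real^'n"
  have rep: "(\<Sum>b\<in>B. (x \<bullet> b) *\<^sub>R b) + (x \<bullet> u) *\<^sub>R u = x" for x
  proof -
    let ?y = "x - (x \<bullet> u) *\<^sub>R u"
    have "u \<bullet> ?y = 0" using uu by (simp add: inner_diff_right inner_commute)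
    then have "?y \<in> span B" using B(3) by simp
    then obtain c where c: "?y = (\<Sum>b\<in>B. c b *\<^sub>R b)" using span_finite[OF B(4)] by auto
    have "x \<bullet> b = c b" if "b \<in> B" for b
    proof -
      have "x \<bullet> b = ?y \<bullet> b" using ub[OF that] by (simp add: inner_diff_left)
      also have "\<dots> = c b" unfolding c by (rule inner_sum_orthonormal[OF B(4,1,2) that])
      finally show ?thesis .
    qed
    then have "?y = (\<Sum>b\<in>B. (x \<bullet> b) *\<^sub>R b)" using c by simp
    then show ?thesis by (simp add: algebra_simps)
  qed
  have ext: "pairwise orthogonal ?B'" "\<And>b. b \<in> ?B' \<Longrightarrow> norm b = 1" "span ?B' = UNIV"
  proof -
    show "pairwise orthogonal ?B'"
      using B(1) ub by (auto simp: pairwise_insert orthogonal_def inner_commute)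
    show "\<And>b. b \<in> ?B' \<Longrightarrow> norm b = 1" using B(2) u by auto
    have "x \<in> span ?B'" for x
      by (subst rep[of x, symmetric]) (intro span_add span_sum span_scale span_base; simp)
    then show "span ?B' = UNIV" by auto
  qed
  define E where "E = crd B ` F"
  \<comment> \<open>An image under coordinates need not be visibly measurable; the preimage under
    the map that reconstructs the point is.\<close>
  have E: "E = (\<lambda>f. (\<Sum>b\<in>B. f b *\<^sub>R b) + h *\<^sub>R u) -` F \<inter> space (?M B)"
  proof (intro antisym subsetI)
    fix f assume "f \<in> E"
    then obtain y where y: "y \<in> F" "f = crd B y" by (auto simp: E_def)
    then have "(\<Sum>b\<in>B. f b *\<^sub>R b) + h *\<^sub>R u = y"
      using rep[of y] F(2) by (auto simp: crd_def)
    with y show "f \<in> (\<lambda>f. (\<Sum>b\<in>B. f b *\<^sub>R b) + h *\<^sub>R u) -` F \<inter> space (?M B)"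
      by (simp add: space_PiM crd_def)
  next
    fix f assume f: "f \<in> (\<lambda>f. (\<Sum>b\<in>B. f b *\<^sub>R b) + h *\<^sub>R u) -` F \<inter> space (?M B)"
    define y where "y = (\<Sum>b\<in>B. f b *\<^sub>R b) + h *\<^sub>R u"
    have "y \<bullet> b = f b" if b: "b \<in> B" for b
    proof -
      have "y \<bullet> b = (\<Sum>d\<in>B. f d *\<^sub>R d) \<bullet> b"
        unfolding y_def using ub[OF b] by (simp add: inner_add_left)
      also have "\<dots> = f b" by (rule inner_sum_orthonormal[OF B(4,1,2) b])
      finally show ?thesis .
    qed
    then have "f = crd B y"
      using f by (auto simp: crd_def space_PiM PiE_iff extensional_def fun_eq_iff)
    moreover have "y \<in> F" using f by (simp add: y_def)
    ultimately show "f \<in> E" by (auto simp: E_def)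
  qed
  have "(\<lambda>f. (\<Sum>b\<in>B. f b *\<^sub>R b) + h *\<^sub>R u) \<in> borel_measurable (?M B)"
    by measurable
  then have Es: "E \<in> sets (?M B)"
    unfolding E using F(1) by (intro measurable_sets[of _ _ borel]) (auto intro: borel_closed compact_imp_closed)
  let ?Q = "prism F (h *\<^sub>R u)"
  have Q: "?Q = {x. crd B x \<in> E \<and> x \<bullet> u \<in> {0..h}}"
  proof (intro antisym subsetI)
    fix x assume "x \<in> ?Q"
    then obtain y s where y: "y \<in> F" "0 \<le> s" "s \<le> 1" "x = y - s *\<^sub>R (h *\<^sub>R u)" by (auto simp: prism_def)
    have "crd B x = crd B y" using ub by (auto simp: crd_def y(4) inner_diff_left fun_eq_iff)
    moreover have "x \<bullet> u = h - s * h" using y F(2) uu by (auto simp: inner_diff_left)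
    moreover have "s * h \<le> h" "0 \<le> s * h" using y h by (auto simp: mult_left_le_one_le)
    ultimately show "x \<in> {x. crd B x \<in> E \<and> x \<bullet> u \<in> {0..h}}" using y(1) by (auto simp: E_def)
  next
    fix x assume "x \<in> {x. crd B x \<in> E \<and> x \<bullet> u \<in> {0..h}}"
    then obtain y where y: "y \<in> F" "crd B x = crd B y" and xu: "0 \<le> x \<bullet> u" "x \<bullet> u \<le> h"
      by (auto simp: E_def)
    have yu: "y \<bullet> u = h" using y F(2) by auto
    have "x \<bullet> b = y \<bullet> b" if "b \<in> B" for b
      using fun_cong[OF y(2), of b] that by (simp add: crd_def)
    then have "x - (x \<bullet> u) *\<^sub>R u = y - h *\<^sub>R u"
      using rep[of x] rep[of y] yu by (metis (no_types, lifting) add_diff_cancel_right' sum.cong)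
    then have "x = y - (h - x \<bullet> u) *\<^sub>R u" by (simp add: algebra_simps)
    moreover have "h - x \<bullet> u = (1 - (x \<bullet> u) / h) * h" using h by (simp add: field_simps)
    ultimately have "x = y - (1 - (x \<bullet> u) / h) *\<^sub>R (h *\<^sub>R u)" by (simp only: scaleR_scaleR)
    moreover have "0 \<le> 1 - (x \<bullet> u) / h" "1 - (x \<bullet> u) / h \<le> 1" using xu h by (auto simp: field_simps)
    ultimately show "x \<in> ?Q" using y(1) unfolding prism_def by blast
  qed
  define Z where "Z = {f \<in> space (?M ?B'). restrict f B \<in> E \<and> f u \<in> {0..h}}"
  have Zs: "Z \<in> sets (?M ?B')"
  proof -
    have "(\<lambda>f. restrict f B) \<in> measurable (?M ?B') (?M B)"
      by (rule measurable_restrict_subset) auto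
    from measurable_sets[OF this Es]
    have "{f \<in> space (?M ?B'). restrict f B \<in> E} \<in> sets (?M ?B')"
      by (simp add: vimage_def Int_def conj_commute)
    moreover have "(\<lambda>f. f u) \<in> measurable (?M ?B') lborel"
      by (rule measurable_component_singleton) simp
    from measurable_sets[OF this, of "{0..h}"]
    have "{f \<in> space (?M ?B'). f u \<in> {0..h}} \<in> sets (?M ?B')"
      by (simp add: vimage_def Int_def conj_commute)
    ultimately have "{f \<in> space (?M ?B'). restrict f B \<in> E} \<inter> {f \<in> space (?M ?B'). f u \<in> {0..h}} \<in> sets (?M ?B')"
      by (rule sets.Int)
    also have "{f \<in> space (?M ?B'). restrict f B \<in> E} \<inter> {f \<in> space (?M ?B'). f u \<in> {0..h}} = Z"
      by (auto simp: Z_def)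
    finally show ?thesis .
  qed
  have mc: "crd ?B' \<in> measurable lborel (?M ?B')"
    unfolding crd_def[abs_def] by (intro measurable_restrict) simp
  have "emeasure (?M ?B') Z = emeasure (distr lborel (?M ?B') (crd ?B')) Z"
    using PiM_lborel_orthonormal[OF ext] by (simp add: crd_def[abs_def])
  also have "\<dots> = emeasure lborel (crd ?B' -` Z \<inter> space lborel)"
    using mc Zs by (rule emeasure_distr)
  also have "crd ?B' -` Z \<inter> space lborel = ?Q"
  proof -
    have "restrict (crd ?B' x) B = crd B x" "crd ?B' x u = x \<bullet> u" for x
      by (auto simp: crd_def restrict_def fun_eq_iff)
    moreover have "crd ?B' x \<in> space (?M ?B')" for x by (simp add: crd_def space_PiM)
    ultimately show ?thesis unfolding Q by (auto simp: Z_def)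
  qed
  finally have 1: "emeasure lborel ?Q = emeasure (?M ?B') Z" ..
  have "emeasure (?M ?B') Z = (\<integral>\<^sup>+ f. indicator Z f \<partial>?M ?B')"
    using Zs by simp
  also have "\<dots> = (\<integral>\<^sup>+ f. (\<integral>\<^sup>+ t. indicator Z (f(u := t)) \<partial>lborel) \<partial>?M B)"
    using Zs uB B(4) by (intro product_nn_integral_insert) auto
  also have "\<dots> = (\<integral>\<^sup>+ f. ennreal h * indicator E f \<partial>?M B)"
  proof (rule nn_integral_cong)
    fix f assume f: "f \<in> space (?M B)"
    have "restrict (f(u := t)) B = f" for t
      using f uB by (auto simp: space_PiM PiE_iff extensional_def restrict_def fun_eq_iff)
    moreover have "f(u := t) \<in> space (?M ?B')" for t
      using f uB by (auto simp: space_PiM PiE_iff extensional_def)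
    ultimately have "indicator Z (f(u := t)) = indicator E f * (indicator {0..h} t :: ennreal)" for t
      by (auto simp: Z_def indicator_def)
    then have "(\<integral>\<^sup>+ t. indicator Z (f(u := t)) \<partial>lborel) = (\<integral>\<^sup>+ t. indicator E f * indicator {0..h} t \<partial>lborel)"
      by simp
    also have "\<dots> = indicator E f * emeasure lborel {0..h}"
      by (subst nn_integral_cmult) auto
    finally show "(\<integral>\<^sup>+ t. indicator Z (f(u := t)) \<partial>lborel) = ennreal h * indicator E f"
      using h by (simp add: mult.commute)
  qed
  also have "\<dots> = ennreal h * emeasure (?M B) E"
    using Es by (simp add: nn_integral_cmult)
  finally have 2: "emeasure lborel ?Q = ennreal h * emeasure (?M B) E" using 1 by simp
  have "measure lebesgue ?Q = measure lborel ?Q"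
    using compact_prism[OF F(1)] by (simp add: borel_closed compact_imp_closed)
  also have "\<dots> = h * measure (?M B) E"
    using h by (simp add: measure_def 2 enn2real_mult)
  also have "measure (?M B) E = hyperplane_volume u F"
    by (simp add: hyperplane_volume_def Let_def B_def[symmetric] E_def crd_def[abs_def])
  finally show ?thesis .
qed

text \<open>In a frame with n - 1 vectors in the hyperplane normal to \<open>w\<close>, only the
  remaining vector changes, by a multiple of \<open>d\<close>, which lies in the span of the
  others.\<close>

lemma det_shear:
  fixes w d :: "real^'n::finite"
  assumes "w \<bullet> d = 0"
  shows "det (matrix (\<lambda>x. x - (w \<bullet> x) *\<^sub>R d)) = 1"
proof (cases "w = 0")
  case True
  then show ?thesis by (simp add: matrix_id_mat_1 flip: id_def)
next
  case False
  let ?f = "\<lambda>x. x - (w \<bullet> x) *\<^sub>R d" and ?H = "{x. w \<bullet> x = 0}"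
  have lin: "linear ?f"
    by (rule linearI) (simp_all add: algebra_simps inner_add_right)
  obtain V where V: "V \<subseteq> ?H" "independent V" "?H \<subseteq> span V" "card V = dim ?H"
    using basis_exists[of ?H] by metis
  obtain v :: "'n \<Rightarrow> real^'n" where v: "frame_det v \<noteq> 0" "V \<subseteq> range v"
    using frame_extending[OF V(2)] .
  have "V \<noteq> range v"
  proof
    assume "V = range v"
    then have "w \<in> span V" using frame_det_nonzero_imp(3)[OF v(1)] by simp
    then have "w \<in> ?H" using span_minimal[OF V(1) subspace_hyperplane] by blast
    with False show False by simp
  qed
  then obtain k where k: "v k \<notin> V" using v(2) by blast
  have "card (v ` (- {k})) = CARD('n) - 1"
    using card_image[OF inj_on_subset[OF frame_det_nonzero_imp(1)[OF v(1)] subset_UNIV], of "- {k}"]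
    by (simp add: Compl_eq_Diff_UNIV card_Diff_singleton)
  moreover have "card V = CARD('n) - 1"
    using V(4) dim_hyperplane[OF False] by simp
  moreover have "V \<subseteq> v ` (- {k})" using v(2) k by blast
  ultimately have Vk: "V = v ` (- {k})"
    by (intro card_subset_eq finite_imageI finite) simp_all
  have "?f (v i) = (v(k := v k + - (w \<bullet> v k) *\<^sub>R d)) i" for i
  proof (cases "i = k")
    case False
    then have "v i \<in> ?H" using V(1) Vk by blast
    then show ?thesis using False by simp
  qed simp
  then have eq: "(\<lambda>i. ?f (v i)) = v(k := v k + - (w \<bullet> v k) *\<^sub>R d)" by (rule ext)
  have "d \<in> span V" using V(3) assms by blast
  then have "- (w \<bullet> v k) *\<^sub>R d \<in> span (v ` (- {k}))"
    unfolding Vk by (rule span_scale)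
  then have "frame_det (v(k := v k + - (w \<bullet> v k) *\<^sub>R d)) = frame_det v"
    by (subst frame_det_add_span) simp_all
  with frame_det_linear[OF lin, of v] v(1) show ?thesis unfolding eq by simp
qed

section \<open>Facets not containing the origin\<close>

definition face_at :: "(real^'n::finite) set \<Rightarrow> real^'n \<Rightarrow> (real^'n) set" where
  "face_at P w = {y \<in> P. w \<bullet> y = 1}"

definition in_slab :: "(real^'n::finite) set \<Rightarrow> real^'n \<Rightarrow> bool" where
  "in_slab P w \<longleftrightarrow> (\<forall>y\<in>P. w \<bullet> y \<le> 1)"

text \<open>Under a linear bijection these vectors transform linearly, by the inverse transpose,
  whereas a unit normal would have to be renormalized.\<close>

definition facet_vectors :: "(real^'n::finite) set \<Rightarrow> (real^'n) set" where
  "facet_vectors P = {w. in_slab P w \<and> aff_dim (face_at P w) = int CARD('n) - 1}"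

text \<open>For nonzero \<open>w\<close> the direction \<open>w /\<^sub>R (w \<bullet> w)\<close> is
  the foot of the perpendicular from 0 to the hyperplane \<open>w \<bullet> y = 1\<close>. The value
  0 outside the slab discards sections by hyperplanes with points of \<open>P\<close> beyond them,
  which are not faces.\<close>

definition cvol :: "(real^'n::finite) set \<Rightarrow> real^'n \<Rightarrow> real" where
  "cvol P w = (if in_slab P w then measure lebesgue (prism (face_at P w) (w /\<^sub>R (w \<bullet> w))) / CARD('n) else 0)"

lemma polytopes_o_facts:
  assumes "P \<in> polytopes_o"
  shows "polytope P" "0 \<in> P" "compact P" "convex P" "closed P"
  using assms by (auto simp: polytopes_o_def polytope_imp_compact polytope_imp_convex polytope_imp_closed)

lemma compact_face_at: "compact P \<Longrightarrow> compact (face_at P w)"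
proof -
  have "face_at P w = P \<inter> {y. w \<bullet> y = 1}" by (auto simp: face_at_def)
  then show "compact P \<Longrightarrow> compact (face_at P w)"
    by (simp add: compact_Int_closed closed_hyperplane)
qed

lemma convex_face_at: "convex P \<Longrightarrow> convex (face_at P w)"
proof -
  have "face_at P w = P \<inter> {y. w \<bullet> y = 1}" by (auto simp: face_at_def)
  then show "convex P \<Longrightarrow> convex (face_at P w)"
    by (simp add: convex_Int convex_hyperplane)
qed

text \<open>A shear along \<open>z - z'\<close> followed by a translation carries one prism to the
  other. The freedom of direction is needed because a linear map does not take the perpendicular of
  a face to the perpendicular of its image.\<close>

lemma measure_prism_direction:
  fixes w :: "real^'n::finite"
  assumes F: "compact F" "F \<subseteq> {y. w \<bullet> y = 1}" and z: "w \<bullet> z = 1" "w \<bullet> z' = 1"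
  shows "measure lebesgue (prism F z') = measure lebesgue (prism F z)"
proof -
  let ?d = "z - z'" and ?g = "\<lambda>x. x - (w \<bullet> x) *\<^sub>R (z - z')"
  have wd: "w \<bullet> ?d = 0" using z by (simp add: inner_diff_right)
  have lin: "linear ?g"
    by (rule linearI) (simp_all add: algebra_simps inner_add_right)
  have pt: "?d + ?g (y - s *\<^sub>R z) = y - s *\<^sub>R z'" if "y \<in> F" for y s
  proof -
    have "w \<bullet> (y - s *\<^sub>R z) = 1 - s" using F(2) that z by (auto simp: inner_diff_right)
    then show ?thesis by (simp only:) (simp add: algebra_simps)
  qed
  have "prism F z' = (+) ?d ` (?g ` prism F z)"
  proof (intro antisym subsetI)
    fix x assume "x \<in> prism F z'"
    then obtain y s where y: "y \<in> F" "0 \<le> s" "s \<le> 1" "x = y - s *\<^sub>R z'" by (auto simp: prism_def)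
    then have "x = ?d + ?g (y - s *\<^sub>R z)" using pt by simp
    moreover have "y - s *\<^sub>R z \<in> prism F z" using y by (auto simp: prism_def)
    ultimately show "x \<in> (+) ?d ` (?g ` prism F z)" by blast
  next
    fix x assume "x \<in> (+) ?d ` (?g ` prism F z)"
    then obtain q where q: "q \<in> prism F z" "x = ?d + ?g q" by blast
    then obtain y s where y: "y \<in> F" "0 \<le> s" "s \<le> 1" "q = y - s *\<^sub>R z" by (auto simp: prism_def)
    then have "x = y - s *\<^sub>R z'" using pt q by simp
    with y show "x \<in> prism F z'" by (auto simp: prism_def)
  qed
  moreover have "prism F z \<in> lmeasurable" using compact_prism[OF F(1)] by (rule lmeasurable_compact)
  ultimately show ?thesis
    using measure_linear_image_cart[OF lin] det_shear[OF wd] by (simp add: measure_translation)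
qed

lemma cvol_eq:
  fixes P :: "(real^'n::finite) set"
  assumes "compact P" "in_slab P w" "w \<bullet> z = 1"
  shows "cvol P w = measure lebesgue (prism (face_at P w) z) / CARD('n)"
proof -
  have "w \<noteq> 0" using assms(3) by auto
  then have 1: "w \<bullet> (w /\<^sub>R (w \<bullet> w)) = 1" by simp
  have "face_at P w \<subseteq> {y. w \<bullet> y = 1}" by (auto simp: face_at_def)
  then show ?thesis
    unfolding cvol_def
    using measure_prism_direction[OF compact_face_at[OF assms(1)] _ assms(3) 1] assms(2) by simp
qed

lemma facet_vectors_nonzero:
  fixes P :: "(real^'n::finite) set"
  assumes "w \<in> facet_vectors P"
  shows "w \<noteq> 0"
  using assms one_le_card_finite[where 'a = 'n]
  by (auto simp: facet_vectors_def face_at_def)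

text \<open>Normal and height are recovered from \<open>w\<close> as
  \<open>w /\<^sub>R norm w\<close> and \<open>1 / norm w\<close>. With direction
  \<open>h *\<^sub>R u\<close> the prism stands perpendicular to the facet, so its volume is height
  times surface area.\<close>

lemma facet_normals_o_eq:
  fixes P :: "(real^'n::finite) set"
  assumes P: "P \<in> polytopes_o"
  shows "bij_betw (\<lambda>u. u /\<^sub>R support_fun P u) (facet_normals_o P) (facet_vectors P)"
    and "\<And>u. u \<in> facet_normals_o P \<Longrightarrow> cone_volume P u = cvol P (u /\<^sub>R support_fun P u)"
proof -
  note Pf = polytopes_o_facts[OF P]
  have pos: "support_fun P u > 0" if "u \<in> facet_normals_o P" for u
    using that support_fun_upper[OF Pf(3,2), of u] by (auto simp: facet_normals_o_def)
  have slab: "in_slab P (u /\<^sub>R h)" if "h > 0" "h = support_fun P u" for u h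
    using support_fun_upper[OF Pf(3), of _ u] that by (auto simp: in_slab_def field_simps)
  have face: "face_at P (u /\<^sub>R h) = support_face P u" if "h > 0" "h = support_fun P u" for u h
    using that by (auto simp: face_at_def support_face_def field_simps inner_commute)
  have norm1: "norm u = 1" if "u \<in> facet_normals_o P" for u
    using that by (simp add: facet_normals_o_def facet_normals_def)
  show "bij_betw (\<lambda>u. u /\<^sub>R support_fun P u) (facet_normals_o P) (facet_vectors P)"
  proof (rule bij_betw_imageI)
    show "inj_on (\<lambda>u. u /\<^sub>R support_fun P u) (facet_normals_o P)"
    proof (rule inj_onI)
      fix u v assume uv: "u \<in> facet_normals_o P" "v \<in> facet_normals_o P"
        and eq: "u /\<^sub>R support_fun P u = v /\<^sub>R support_fun P v"
      have "norm (u /\<^sub>R support_fun P u) = norm (v /\<^sub>R support_fun P v)" using eq by simp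
      then have "support_fun P u = support_fun P v"
        using pos uv norm1 by (simp add: order_less_imp_le)
      with eq pos[OF uv(1)] show "u = v" by simp
    qed
    show "(\<lambda>u. u /\<^sub>R support_fun P u) ` facet_normals_o P = facet_vectors P"
    proof (intro antisym subsetI)
      fix w assume "w \<in> (\<lambda>u. u /\<^sub>R support_fun P u) ` facet_normals_o P"
      then obtain u where u: "u \<in> facet_normals_o P" "w = u /\<^sub>R support_fun P u" by blast
      then show "w \<in> facet_vectors P"
        using slab[OF pos refl] face[OF pos refl]
        by (simp add: facet_vectors_def facet_normals_o_def facet_normals_def)
    next
      fix w assume w: "w \<in> facet_vectors P"
      then have w0: "w \<noteq> 0" by (rule facet_vectors_nonzero)
      define u where "u = w /\<^sub>R norm w"
      have "face_at P w \<noteq> {}"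
        using w one_le_card_finite[where 'a = 'n] by (auto simp: facet_vectors_def)
      then obtain y where y: "y \<in> P" "w \<bullet> y = 1" by (auto simp: face_at_def)
      have "support_fun P u = 1 / norm w"
        unfolding support_fun_def
      proof (rule cSup_eq_maximum)
        show "1 / norm w \<in> (\<bullet>) u ` P"
          using y by (intro image_eqI[of _ _ y]) (auto simp: u_def field_simps)
        show "x \<le> 1 / norm w" if "x \<in> (\<bullet>) u ` P" for x
          using that w w0 by (auto simp: u_def facet_vectors_def in_slab_def field_simps)
      qed
      then have h: "support_fun P u = 1 / norm w" "1 / norm w > 0" using w0 by auto
      have wu: "u /\<^sub>R (1 / norm w) = w" using w0 by (simp add: u_def)
      have "support_face P u = face_at P w"
        using face[OF h(2), of u] h wu by simp
      then have "u \<in> facet_normals_o P"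
        using w w0 h by (simp add: facet_normals_o_def facet_normals_def facet_vectors_def u_def)
      then show "w \<in> (\<lambda>u. u /\<^sub>R support_fun P u) ` facet_normals_o P"
        using wu h by (intro image_eqI[of _ _ u]) auto
    qed
  qed
  fix u assume u: "u \<in> facet_normals_o P"
  define h where "h = support_fun P u"
  have h: "h > 0" using pos[OF u] by (simp add: h_def)
  have uu: "u \<bullet> u = 1" using norm1[OF u] by (simp add: norm_eq_1)
  have "cvol P (u /\<^sub>R h) = measure lebesgue (prism (face_at P (u /\<^sub>R h)) (h *\<^sub>R u)) / CARD('n)"
    using h uu by (intro cvol_eq Pf slab) (auto simp: h_def)
  also have "face_at P (u /\<^sub>R h) = support_face P u" using face[OF h] by (simp add: h_def)
  also have "measure lebesgue (prism (support_face P u) (h *\<^sub>R u)) = h * hyperplane_volume u (support_face P u)"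
  proof (rule measure_prism_normal[OF norm1[OF u] h])
    show "compact (support_face P u)"
      using compact_face_at[OF Pf(3), of "u /\<^sub>R h"] face[OF h] by (simp add: h_def)
  qed (auto simp: support_face_def h_def)
  finally show "cone_volume P u = cvol P (u /\<^sub>R support_fun P u)"
    by (simp add: cone_volume_def surface_area_def h_def)
qed

lemma finite_facet_vectors:
  assumes "P \<in> polytopes_o"
  shows "finite (facet_vectors P)"
  using bij_betw_finite[OF facet_normals_o_eq(1)[OF assms]] finite_facet_normals_o[OF assms] by simp

lemma M0_eq_sum_facet_vectors:
  assumes "P \<in> polytopes_o"
  shows "M0 \<xi> p P x = (\<Sum>w\<in>facet_vectors P. tensor_power w p x * \<xi> (cvol P w))"
proof -
  have "M0 \<xi> p P x = (\<Sum>u\<in>facet_normals_o P. tensor_power (u /\<^sub>R support_fun P u) p x * \<xi> (cvol P (u /\<^sub>R support_fun P u)))"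
    unfolding M0_def using facet_normals_o_eq(2)[OF assms] by simp
  also have "\<dots> = (\<Sum>w\<in>facet_vectors P. tensor_power w p x * \<xi> (cvol P w))"
    by (rule sum.reindex_bij_betw[OF facet_normals_o_eq(1)[OF assms]])
  finally show ?thesis .
qed

section \<open>The cone volume at a fixed vector as a valuation\<close>

lemma convex_prism:
  assumes "convex F"
  shows "convex (prism F z)"
proof -
  have "prism F z = (\<Union>y\<in>F. \<Union>q\<in>(\<lambda>s. s *\<^sub>R z) ` {0..1}. {y - q})"
    by (force simp: prism_def)
  also have "convex \<dots>"
  proof (rule convex_differences[OF assms])
    have "linear (\<lambda>s :: real. s *\<^sub>R z)" by (rule linearI) (simp_all add: scaleR_add_left)
    then show "convex ((\<lambda>s. s *\<^sub>R z) ` {0..1})" by (rule convex_linear_image) simp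
  qed
  finally show ?thesis .
qed

lemma zero_notin_affine_hull_face_at: "0 \<notin> affine hull (face_at P w)"
proof -
  have "affine hull (face_at P w) \<subseteq> {y. w \<bullet> y = 1}"
    by (intro hull_minimal affine_hyperplane) (auto simp: face_at_def)
  then show ?thesis by auto
qed

text \<open>The prism contains the facet and a point off its affine hull, so it has dimension n and,
  being convex, interior points.\<close>

lemma cvol_pos:
  fixes P :: "(real^'n::finite) set"
  assumes "compact P" "convex P" "w \<in> facet_vectors P"
  shows "cvol P w > 0"
proof -
  define F z where "F = face_at P w" and "z = w /\<^sub>R (w \<bullet> w)"
  have w0: "w \<noteq> 0" using assms(3) by (rule facet_vectors_nonzero)
  then have wz: "w \<bullet> z = 1" by (simp add: z_def)
  have F: "aff_dim F = int CARD('n) - 1" "in_slab P w" using assms(3) by (auto simp: facet_vectors_def F_def)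
  then have "F \<noteq> {}" using one_le_card_finite[where 'a = 'n] by auto
  then obtain y where y: "y \<in> F" by blast
  have sub: "insert (y - z) F \<subseteq> prism F z"
  proof -
    have "y - z = y - 1 *\<^sub>R z" "\<And>y. y = y - 0 *\<^sub>R z" by simp_all
    with y show ?thesis unfolding prism_def by fastforce
  qed
  have "affine hull F \<subseteq> {y. w \<bullet> y = 1}"
    by (intro hull_minimal affine_hyperplane) (auto simp: face_at_def F_def)
  moreover have "w \<bullet> (y - z) = 0" using y wz by (simp add: F_def face_at_def inner_diff_right)
  ultimately have "y - z \<notin> affine hull F" by auto
  then have "aff_dim (insert (y - z) F) = int CARD('n)" using F(1) by (simp add: aff_dim_insert)
  then have "aff_dim (prism F z) = int DIM(real^'n)"
    using aff_dim_subset[OF sub] aff_dim_le_DIM[of "prism F z"] by simp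
  then have hull: "affine hull (prism F z) = UNIV" by (simp only: aff_dim_eq_full)
  have cv: "convex (prism F z)" unfolding F_def by (intro convex_prism convex_face_at assms)
  have "prism F z \<noteq> {}" using sub by blast
  then have "rel_interior (prism F z) \<noteq> {}" using rel_interior_eq_empty[OF cv] by simp
  then have "interior (prism F z) \<noteq> {}" using rel_interior_interior[OF hull] by simp
  then have "\<not> negligible (prism F z)" using negligible_convex_interior[OF cv] by simp
  moreover have "prism F z \<in> lmeasurable"
    unfolding F_def by (intro lmeasurable_compact compact_prism compact_face_at assms)
  ultimately have "measure lebesgue (prism F z) \<noteq> 0" by (simp add: negligible_iff_measure)
  then show ?thesis
    using F(2) by (simp add: cvol_def F_def[symmetric] z_def[symmetric] less_le)
qed

text \<open>A face of smaller dimension and one further point span an affine set of dimension below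
  n that contains the prism. Sums over facets may thus be extended to larger finite sets of
  vectors.\<close>

lemma cvol_zero:
  fixes P :: "(real^'n::finite) set"
  assumes "convex P" "w \<notin> facet_vectors P"
  shows "cvol P w = 0"
proof (cases "in_slab P w \<and> face_at P w \<noteq> {}")
  case False
  then show ?thesis by (auto simp: cvol_def prism_def)
next
  case True
  define F z where "F = face_at P w" and "z = w /\<^sub>R (w \<bullet> w)"
  obtain y0 where y0: "y0 \<in> F" using True by (auto simp: F_def)
  have w0: "w \<noteq> 0" using y0 by (auto simp: F_def face_at_def)
  have "F \<subseteq> {y. w \<bullet> y = 1}" by (auto simp: F_def face_at_def)
  from aff_dim_subset[OF this] have "aff_dim F \<le> int CARD('n) - 1"
    using w0 one_le_card_finite[where 'a = 'n] by (simp add: aff_dim_hyperplane)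
  moreover have "aff_dim F \<noteq> int CARD('n) - 1"
    using True assms(2) by (auto simp: facet_vectors_def F_def)
  ultimately have dF: "aff_dim F < int CARD('n) - 1" by simp
  let ?H = "affine hull (insert (y0 - z) F)"
  have "prism F z \<subseteq> ?H"
  proof
    fix x assume "x \<in> prism F z"
    then obtain y s where y: "y \<in> F" "x = y - s *\<^sub>R z" by (auto simp: prism_def)
    have "y + s *\<^sub>R ((y0 - z) - y0) \<in> ?H"
      using y y0 by (intro mem_affine_3_minus affine_affine_hull hull_inc) auto
    then show "x \<in> ?H" using y by simp
  qed
  from aff_dim_subset[OF this] have "aff_dim (prism F z) \<le> aff_dim (insert (y0 - z) F)"
    by (simp add: aff_dim_affine_hull)
  also have "\<dots> \<le> aff_dim F + 1" by (simp add: aff_dim_insert)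
  finally have "aff_dim (prism F z) < int DIM(real^'n)" using dF by simp
  then have "interior (prism F z) = {}" using aff_dim_nonempty_interior by force
  moreover have "convex (prism F z)" unfolding F_def by (intro convex_prism convex_face_at assms)
  ultimately have "negligible (prism F z)" by (simp add: negligible_convex_interior)
  then have "measure lebesgue (prism F z) = 0" by (rule negligible_imp_measure0)
  then show ?thesis by (simp add: cvol_def F_def z_def)
qed

lemma cvol_nonneg: "cvol P w \<ge> 0"
  by (simp add: cvol_def)

lemma prism_Int:
  assumes "F \<subseteq> {y. w \<bullet> y = 1}" "G \<subseteq> {y. w \<bullet> y = 1}" "w \<bullet> z = 1"
  shows "prism F z \<inter> prism G z = prism (F \<inter> G) z"
proof (intro antisym subsetI)
  fix x assume "x \<in> prism F z \<inter> prism G z"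
  then obtain y s y' s' where y: "y \<in> F" "0 \<le> s" "s \<le> 1" "x = y - s *\<^sub>R z"
    and y': "y' \<in> G" "x = y' - s' *\<^sub>R z" by (auto simp: prism_def)
  have "w \<bullet> x = 1 - s" using y assms by (auto simp: inner_diff_right)
  moreover have "w \<bullet> x = 1 - s'" using y' assms by (auto simp: inner_diff_right)
  ultimately have "s = s'" by simp
  then have "y = y'" using y(4) y'(2) by simp
  then show "x \<in> prism (F \<inter> G) z" using y y'(1) by (auto simp: prism_def)
qed (auto simp: prism_def)

text \<open>If both polytopes lie in the slab, prisms turn unions and intersections of faces into
  those of sets. If just one does, segments from its face to a point of the other beyond the
  hyperplane run in the other, so by closedness the face lies in the intersection. If neither does,
  a segment beyond the hyperplane joins the two and by connectedness meets the intersection, so all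
  terms are 0.\<close>

lemma cvol_valuation:
  fixes P Q :: "(real^'n::finite) set"
  assumes P: "compact P" "convex P" and Q: "compact Q" "convex Q" and U: "convex (P \<union> Q)"
  shows "cvol P w + cvol Q w = cvol (P \<union> Q) w + cvol (P \<inter> Q) w"
proof -
  have one_sided: "cvol R w + cvol R' w = cvol (R \<union> R') w + cvol (R \<inter> R') w"
    if R: "compact R'" "convex (R \<union> R')" "in_slab R w" "\<not> in_slab R' w" for R R'
  proof -
    obtain q where q: "q \<in> R'" "w \<bullet> q > 1" using R(4) by (auto simp: in_slab_def not_le)
    have "x \<in> R'" if x: "x \<in> R" "w \<bullet> x = 1" for x
    proof -
      have beyond: "(1 - e) *\<^sub>R x + e *\<^sub>R q \<in> R'" if e: "0 < e" "e \<le> 1" for e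
      proof -
        have "(1 - e) *\<^sub>R x + e *\<^sub>R q \<in> R \<union> R'"
          using R(2) x q e by (intro convexD) auto
        moreover have "w \<bullet> ((1 - e) *\<^sub>R x + e *\<^sub>R q) > 1"
          using x(2) q(2) e by (simp add: inner_add_right algebra_simps)
        ultimately show ?thesis using R(3) by (force simp: in_slab_def)
      qed
      have lim: "(\<lambda>n. (1 - 1 / real (Suc n)) *\<^sub>R x + (1 / real (Suc n)) *\<^sub>R q) \<longlonglongrightarrow> (1 - 0) *\<^sub>R x + 0 *\<^sub>R q"
        by (intro tendsto_intros LIMSEQ_Suc[OF lim_1_over_n])
      have "(1 - 0) *\<^sub>R x + 0 *\<^sub>R q \<in> R'"
        by (rule closed_sequentially[OF compact_imp_closed[OF R(1)] beyond lim]) simp_all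
      then show ?thesis by simp
    qed
    then have "face_at (R \<inter> R') w = face_at R w" by (auto simp: face_at_def)
    moreover have "in_slab (R \<inter> R') w" "\<not> in_slab (R \<union> R') w"
      using R(3,4) by (auto simp: in_slab_def)
    ultimately show ?thesis using R(3,4) by (simp add: cvol_def)
  qed
  consider "in_slab P w" "in_slab Q w" | "in_slab P w" "\<not> in_slab Q w"
    | "\<not> in_slab P w" "in_slab Q w" | "\<not> in_slab P w" "\<not> in_slab Q w" by blast
  then show ?thesis
  proof cases
    case 1
    then have slab: "in_slab (P \<union> Q) w" "in_slab (P \<inter> Q) w" by (auto simp: in_slab_def)
    show ?thesis
    proof (cases "w = 0")
      case True
      then have "cvol R w = 0" for R :: "(real^'n) set"
        by (simp add: cvol_def face_at_def prism_def)
      then show ?thesis by simp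
    next
      case False
      define z where "z = w /\<^sub>R (w \<bullet> w)"
      have wz: "w \<bullet> z = 1" using False by (simp add: z_def)
      have meas: "prism (face_at P w) z \<in> lmeasurable" "prism (face_at Q w) z \<in> lmeasurable"
        using P Q by (auto intro!: lmeasurable_compact compact_prism compact_face_at)
      have un: "face_at (P \<union> Q) w = face_at P w \<union> face_at Q w" "face_at (P \<inter> Q) w = face_at P w \<inter> face_at Q w"
        by (auto simp: face_at_def)
      have "prism (face_at (P \<union> Q) w) z = prism (face_at P w) z \<union> prism (face_at Q w) z"
        unfolding un by (auto simp: prism_def)
      moreover have "prism (face_at (P \<inter> Q) w) z = prism (face_at P w) z \<inter> prism (face_at Q w) z"
        unfolding un by (rule prism_Int[OF _ _ wz, symmetric]) (auto simp: face_at_def)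
      ultimately show ?thesis
        using measure_Un3[OF meas] 1 slab by (simp add: cvol_def z_def[symmetric] flip: add_divide_distrib)
    qed
  next
    case 2
    then show ?thesis using one_sided[of Q P] Q(1) U by simp
  next
    case 3
    then show ?thesis using one_sided[of P Q] P(1) U by (simp add: Un_commute Int_commute)
  next
    case 4
    obtain a b where a: "a \<in> P" "w \<bullet> a > 1" and b: "b \<in> Q" "w \<bullet> b > 1"
      using 4 by (auto simp: in_slab_def not_le)
    have seg: "closed_segment a b \<subseteq> P \<union> Q"
      using a b U by (intro closed_segment_subset) auto
    have above: "w \<bullet> x > 1" if "x \<in> closed_segment a b" for x
    proof -
      have "closed_segment a b \<subseteq> {x. w \<bullet> x > 1}"
        using a b by (intro closed_segment_subset convex_halfspace_gt) auto
      with that show ?thesis by blast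
    qed
    have "P \<inter> Q \<inter> closed_segment a b \<noteq> {}"
    proof
      assume "P \<inter> Q \<inter> closed_segment a b = {}"
      then have "P \<inter> closed_segment a b = {} \<or> Q \<inter> closed_segment a b = {}"
        using P(1) Q(1) seg compact_imp_closed connected_closedD[OF connected_segment] by metis
      moreover have "a \<in> P \<inter> closed_segment a b" "b \<in> Q \<inter> closed_segment a b" using a b by simp_all
      ultimately show False by blast
    qed
    then obtain x where "x \<in> P \<inter> Q" "w \<bullet> x > 1" using above by blast
    then have "\<not> in_slab (P \<inter> Q) w" by (force simp: in_slab_def)
    moreover have "\<not> in_slab (P \<union> Q) w" using 4 by (auto simp: in_slab_def)
    ultimately show ?thesis using 4 by (simp add: cvol_def)
  qed
qed

text \<open>\<open>Cauchy_function\<close> leaves the value at 0 open. With the value 0 there,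
  additivity extends, and vectors without a facet contribute nothing.\<close>

lemma Cauchy_function_extend_0:
  assumes "Cauchy_function \<xi>" "r \<ge> 0" "s \<ge> 0"
  shows "(if r + s > 0 then \<xi> (r + s) else 0) = (if r > 0 then \<xi> r else 0) + (if s > 0 then \<xi> s else 0)"
  using assms by (cases "r = 0"; cases "s = 0") (auto simp: Cauchy_function_def)

text \<open>The four polytopes have different facets; over a common finite set \<open>X\<close> of
  vectors the sums can be compared term by term.\<close>

lemma M0_valuation:
  fixes p :: nat
  assumes "Cauchy_function \<xi>"
  shows "valuation_on (polytopes_o :: (real^'n::finite) set set) (M0 \<xi> p)"
  unfolding valuation_on_def
proof (intro allI impI)
  fix P Q :: "(real^'n) set" and x
  assume as: "P \<in> polytopes_o \<and> Q \<in> polytopes_o \<and> P \<union> Q \<in> polytopes_o \<and> P \<inter> Q \<in> polytopes_o"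
  define \<xi>' where "\<xi>' r = (if r > 0 then \<xi> r else 0)" for r :: real
  define X where "X = facet_vectors P \<union> facet_vectors Q \<union> facet_vectors (P \<union> Q) \<union> facet_vectors (P \<inter> Q)"
  have X: "finite X" using as by (auto simp: X_def intro: finite_facet_vectors)
  have M: "M0 \<xi> p R x = (\<Sum>w\<in>X. tensor_power w p x * \<xi>' (cvol R w))"
    if R: "R \<in> polytopes_o" "facet_vectors R \<subseteq> X" for R
  proof -
    note Rf = polytopes_o_facts[OF R(1)]
    have "M0 \<xi> p R x = (\<Sum>w\<in>facet_vectors R. tensor_power w p x * \<xi>' (cvol R w))"
      unfolding M0_eq_sum_facet_vectors[OF R(1)]
      using cvol_pos[OF Rf(3,4)] by (intro sum.cong) (auto simp: \<xi>'_def)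
    also have "\<dots> = (\<Sum>w\<in>X. tensor_power w p x * \<xi>' (cvol R w))"
      using cvol_zero[OF Rf(4)] by (intro sum.mono_neutral_left X R(2)) (auto simp: \<xi>'_def)
    finally show ?thesis .
  qed
  have sp: "\<xi>' (cvol P w) + \<xi>' (cvol Q w) = \<xi>' (cvol (P \<union> Q) w) + \<xi>' (cvol (P \<inter> Q) w)" for w
  proof -
    have "cvol P w + cvol Q w = cvol (P \<union> Q) w + cvol (P \<inter> Q) w"
      using as by (intro cvol_valuation) (simp_all add: polytopes_o_facts)
    moreover have "\<xi>' (r + s) = \<xi>' r + \<xi>' s" if "r \<ge> 0" "s \<ge> 0" for r s
      unfolding \<xi>'_def by (rule Cauchy_function_extend_0[OF assms that])
    ultimately show ?thesis by (metis cvol_nonneg)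
  qed
  have "M0 \<xi> p P x + M0 \<xi> p Q x = (\<Sum>w\<in>X. tensor_power w p x * (\<xi>' (cvol P w) + \<xi>' (cvol Q w)))"
    using as by (subst (1 2) M) (auto simp: X_def sum.distrib distrib_left)
  also have "\<dots> = M0 \<xi> p (P \<union> Q) x + M0 \<xi> p (P \<inter> Q) x"
    unfolding sp using as by (subst (1 2) M) (auto simp: X_def sum.distrib distrib_left)
  finally show "M0 \<xi> p P x + M0 \<xi> p Q x = M0 \<xi> p (P \<union> Q) x + M0 \<xi> p (P \<inter> Q) x" .
qed

lemma inner_transpose_matrix:
  fixes A :: "real^'n::finite^'n"
  shows "(transpose A *v x) \<bullet> y = x \<bullet> (A *v y)"
proof -
  have "transpose A *v x = x v* A"
    using vector_transpose_matrix[of x "transpose A"] by simp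
  then show ?thesis by (simp add: dot_lmul_matrix)
qed

lemma adjoint_matrix_inv:
  fixes \<phi> :: "real^'n::finite^'n"
  assumes "det \<phi> = 1"
  shows "(transpose (matrix_inv \<phi>) *v w) \<bullet> (\<phi> *v y) = w \<bullet> y"
    and "matrix_inv \<phi> *v (\<phi> *v y) = y" and "\<phi> *v (matrix_inv \<phi> *v y) = y"
proof -
  have "invertible \<phi>" using assms by (simp add: invertible_det_nz)
  then have inv: "matrix_inv \<phi> ** \<phi> = mat 1" "\<phi> ** matrix_inv \<phi> = mat 1"
    unfolding invertible_def matrix_inv_def by (rule someI2_ex, blast)+
  then show 1: "matrix_inv \<phi> *v (\<phi> *v y) = y" "\<phi> *v (matrix_inv \<phi> *v y) = y"
    by (simp_all add: matrix_vector_mul_assoc)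
  have "(transpose (matrix_inv \<phi>) *v w) \<bullet> (\<phi> *v y) = w \<bullet> (matrix_inv \<phi> *v (\<phi> *v y))"
    by (rule inner_transpose_matrix)
  with 1 show "(transpose (matrix_inv \<phi>) *v w) \<bullet> (\<phi> *v y) = w \<bullet> y" by simp
qed

lemma prism_linear_image:
  assumes "linear f"
  shows "prism (f ` F) (f z) = f ` prism F z"
  by (force simp: prism_def linear_diff[OF assms] linear_scale[OF assms] image_iff)

lemma cvol_linear_image:
  fixes f :: "real^'n::finite \<Rightarrow> real^'n"
  assumes f: "linear f" "inj f" and P: "compact P" and w: "\<And>y. w' \<bullet> f y = w \<bullet> y" "w \<noteq> 0"
  shows "w' \<in> facet_vectors (f ` P) \<longleftrightarrow> w \<in> facet_vectors P"
    and "cvol (f ` P) w' = \<bar>det (matrix f)\<bar> * cvol P w"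
proof -
  have slab: "in_slab (f ` P) w' = in_slab P w" by (simp add: in_slab_def w(1))
  have face: "face_at (f ` P) w' = f ` face_at P w" by (auto simp: face_at_def w(1))
  show "w' \<in> facet_vectors (f ` P) \<longleftrightarrow> w \<in> facet_vectors P"
    by (simp add: facet_vectors_def slab face aff_dim_injective_linear_image[OF f])
  define z where "z = w /\<^sub>R (w \<bullet> w)"
  have wz: "w \<bullet> z = 1" using w(2) by (simp add: z_def)
  show "cvol (f ` P) w' = \<bar>det (matrix f)\<bar> * cvol P w"
  proof (cases "in_slab P w")
    case True
    have cfP: "compact (f ` P)" using P by (rule compact_continuous_image[OF linear_continuous_on[OF f(1)[unfolded linear_conv_bounded_linear]]])
    have "cvol (f ` P) w' = measure lebesgue (prism (f ` face_at P w) (f z)) / CARD('n)"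
      using cvol_eq[OF cfP, of w' "f z"] True slab wz by (simp add: w(1) face)
    also have "\<dots> = \<bar>det (matrix f)\<bar> * measure lebesgue (prism (face_at P w) z) / CARD('n)"
      using measure_linear_image_cart[OF f(1) lmeasurable_compact[OF compact_prism[OF compact_face_at[OF P]]]]
      by (simp add: prism_linear_image[OF f(1)])
    also have "\<dots> = \<bar>det (matrix f)\<bar> * cvol P w"
      using cvol_eq[OF P True wz] by simp
    finally show ?thesis .
  qed (simp add: cvol_def slab)
qed

text \<open>The inverse transpose maps the facet vectors of \<open>P\<close> bijectively to those of
  the image, and determinant 1 preserves the cone volumes.\<close>

lemma M0_SL_contravariant:
  fixes p :: nat
  shows "SL_contravariant (M0 \<xi> p :: (real^'n::finite) set \<Rightarrow> 'n tensor)"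
  unfolding SL_contravariant_def
proof (intro allI ballI impI ext)
  fix \<phi> :: "real^'n^'n" and P :: "(real^'n) set" and x
  assume P: "P \<in> polytopes_o" and det: "det \<phi> = 1"
  define \<psi> where "\<psi> = transpose (matrix_inv \<phi>)"
  let ?f = "\<lambda>y. \<phi> *v y"
  note inv = adjoint_matrix_inv[OF det, folded \<psi>_def]
  have f: "linear ?f" "inj ?f"
    using inv(2) by (auto intro!: injI) (metis inv(2))
  have fP: "?f ` P \<in> polytopes_o"
    using P polytope_linear_image[OF f(1)] by (auto simp: polytopes_o_def intro: image_eqI[of _ _ 0])
  note Pf = polytopes_o_facts[OF P]
  have inj: "inj_on ((*v) \<psi>) A" for A
  proof (rule inj_onI)
    fix a b assume "\<psi> *v a = \<psi> *v b"
    then have "a \<bullet> y = b \<bullet> y" for y using inv(1)[of a y] inv(1)[of b y] by simp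
    then show "a = b" by (metis vector_eq_rdot)
  qed
  have fv: "facet_vectors (?f ` P) = (*v) \<psi> ` facet_vectors P"
  proof (intro antisym subsetI)
    fix w' assume w': "w' \<in> facet_vectors (?f ` P)"
    define w where "w = transpose \<phi> *v w'"
    have ww: "w \<bullet> y = w' \<bullet> ?f y" for y
      unfolding w_def by (rule inner_transpose_matrix)
    have "(\<psi> *v w) \<bullet> y = w' \<bullet> y" for y
      using inv(1)[of w "matrix_inv \<phi> *v y"] ww[of "matrix_inv \<phi> *v y"] by (simp add: inv(3))
    then have "\<psi> *v w = w'" by (metis vector_eq_rdot)
    moreover have "w \<noteq> 0" using facet_vectors_nonzero[OF w'] calculation by auto
    ultimately show "w' \<in> (*v) \<psi> ` facet_vectors P"
      using cvol_linear_image(1)[OF f Pf(3), of w' w] ww w' by auto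
  next
    fix w' assume "w' \<in> (*v) \<psi> ` facet_vectors P"
    then obtain w where w: "w \<in> facet_vectors P" "w' = \<psi> *v w" by blast
    then show "w' \<in> facet_vectors (?f ` P)"
      using cvol_linear_image(1)[OF f Pf(3), of w' w] inv(1) facet_vectors_nonzero[OF w(1)] by simp
  qed
  have cv: "cvol (?f ` P) (\<psi> *v w) = cvol P w" if "w \<in> facet_vectors P" for w
    using cvol_linear_image(2)[OF f Pf(3), of "\<psi> *v w" w] inv(1) facet_vectors_nonzero[OF that] det by simp
  have tp: "tensor_power (\<psi> *v w) p x = tensor_power w p (\<lambda>i. transpose \<psi> *v x i)" for w
    unfolding tensor_power_def
    by (intro prod.cong refl) (metis inner_transpose_matrix inner_commute)
  have "M0 \<xi> p (?f ` P) x = (\<Sum>w\<in>facet_vectors P. tensor_power (\<psi> *v w) p x * \<xi> (cvol (?f ` P) (\<psi> *v w)))"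
    unfolding M0_eq_sum_facet_vectors[OF fP] fv by (simp add: sum.reindex[OF inj])
  also have "\<dots> = (\<Sum>w\<in>facet_vectors P. tensor_power w p (\<lambda>i. transpose \<psi> *v x i) * \<xi> (cvol P w))"
    using cv by (simp add: tp)
  also have "\<dots> = tensor_act \<psi> (M0 \<xi> p P) x"
    unfolding tensor_act_def M0_eq_sum_facet_vectors[OF P] ..
  finally show "M0 \<xi> p (?f ` P) x = tensor_act (transpose (matrix_inv \<phi>)) (M0 \<xi> p P) x"
    unfolding \<psi>_def .
qed

text \<open>A facet off the origin spans, together with the origin, the full dimension.\<close>

lemma facet_vectors_lowdim:
  fixes P :: "(real^'n::finite) set"
  assumes "0 \<in> P" "aff_dim P < int CARD('n)"
  shows "facet_vectors P = {}"
proof (rule ccontr)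
  assume "facet_vectors P \<noteq> {}"
  then obtain w where w: "aff_dim (face_at P w) = int CARD('n) - 1" by (auto simp: facet_vectors_def)
  have "insert 0 (face_at P w) \<subseteq> P" using assms(1) by (auto simp: face_at_def)
  from aff_dim_subset[OF this] w assms(2) show False
    by (simp add: aff_dim_insert zero_notin_affine_hull_face_at)
qed

text \<open>A vertex with \<open>w' \<bullet> v i < 1\<close> gets weight 0 in every point of the
  face, so the face would lie in the span of the other vertices. Adjoining 0 to a facet there would
  give dimension n inside a hyperplane.\<close>

lemma facet_vectors_simplex:
  fixes v :: "'n \<Rightarrow> real^'n::finite"
  assumes v: "frame_det v \<noteq> 0" and w: "\<And>k. w \<bullet> v k = 1"
  shows "facet_vectors (simplex0 (range v)) = {w}"
proof -
  let ?P = "simplex0 (range v)"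
  note fr = frame_det_nonzero_imp[OF v]
  have vP: "v k \<in> ?P" for k by (simp add: hull_inc)
  have "?P \<subseteq> {x. w \<bullet> x \<le> 1}"
    by (intro hull_minimal convex_halfspace_le) (use w in auto)
  then have slab: "in_slab ?P w" by (auto simp: in_slab_def)
  have w0: "w \<noteq> 0" using w by force
  have "aff_dim (face_at ?P w) = int CARD('n) - 1"
  proof (rule antisym)
    have "face_at ?P w \<subseteq> {y. w \<bullet> y = 1}" by (auto simp: face_at_def)
    from aff_dim_subset[OF this] show "aff_dim (face_at ?P w) \<le> int CARD('n) - 1"
      using w0 one_le_card_finite[where 'a = 'n] by (simp add: aff_dim_hyperplane)
    have "aff_dim ?P = int CARD('n)"
      using aff_dim_simplex_at_0[OF fr(2)] fr(1) by (simp add: card_image)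
    then have "int CARD('n) \<le> aff_dim (range v) + 1"
      by (simp add: aff_dim_convex_hull aff_dim_insert split: if_splits)
    moreover have "aff_dim (range v) \<le> aff_dim (face_at ?P w)"
      using vP w by (intro aff_dim_subset) (auto simp: face_at_def)
    ultimately show "int CARD('n) - 1 \<le> aff_dim (face_at ?P w)" by simp
  qed
  with slab have "w \<in> facet_vectors ?P" by (simp add: facet_vectors_def)
  moreover have "w' = w" if w': "w' \<in> facet_vectors ?P" for w'
  proof -
    have le: "w' \<bullet> v k \<le> 1" for k using w' vP by (auto simp: facet_vectors_def in_slab_def)
    have "w' \<bullet> v i = 1" for i
    proof (rule ccontr)
      assume "w' \<bullet> v i \<noteq> 1"
      with le[of i] have less: "w' \<bullet> v i < 1" by simp
      obtain b where b: "\<And>k. b \<bullet> v k = (if k = i then 1 else 0)"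
        using frame_dual[OF v, of "\<lambda>k. if k = i then 1 else 0"] by blast
      have "face_at ?P w' \<subseteq> {x. b \<bullet> x = 0}"
      proof
        fix x assume x: "x \<in> face_at ?P w'"
        then have "x \<in> ?P" "w' \<bullet> x = 1" by (auto simp: face_at_def)
        then obtain c where c: "\<forall>k. 0 \<le> c k" "sum c UNIV \<le> 1" "x = (\<Sum>k\<in>UNIV. c k *\<^sub>R v k)"
          using mem_simplex[of UNIV x v] by auto
        have "(\<Sum>k\<in>UNIV. c k * (1 - w' \<bullet> v k)) = sum c UNIV - w' \<bullet> x"
          unfolding c(3) by (simp add: inner_sum_right sum_subtractf right_diff_distrib)
        also have "\<dots> \<le> 0" using c(2) \<open>w' \<bullet> x = 1\<close> by simp
        finally have le0: "(\<Sum>k\<in>UNIV. c k * (1 - w' \<bullet> v k)) \<le> 0" .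
        have "c i * (1 - w' \<bullet> v i) \<le> (\<Sum>k\<in>UNIV. c k * (1 - w' \<bullet> v k))"
          using c(1) le by (intro member_le_sum) auto
        with le0 have "c i * (1 - w' \<bullet> v i) \<le> 0" by simp
        with less c(1)[rule_format, of i] have "c i = 0" by (simp add: mult_le_0_iff)
        moreover have "b \<bullet> x = c i"
          unfolding c(3) by (simp add: inner_sum_right b if_distrib[of "(*) _"] cong: if_cong)
        ultimately show "x \<in> {x. b \<bullet> x = 0}" by simp
      qed
      then have "insert 0 (face_at ?P w') \<subseteq> {x. b \<bullet> x = 0}" by simp
      from aff_dim_subset[OF this] have "aff_dim (face_at ?P w') + 1 \<le> aff_dim {x. b \<bullet> x = 0}"
        by (simp add: aff_dim_insert zero_notin_affine_hull_face_at)
      moreover have "b \<noteq> 0" using b[of i] by auto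
      ultimately show False
        using w' one_le_card_finite[where 'a = 'n] by (simp add: facet_vectors_def aff_dim_hyperplane)
    qed
    then have "(w' - w) \<bullet> v k = 0" for k using w by (simp add: inner_diff_left)
    then have "range v \<subseteq> {x. (w' - w) \<bullet> x = 0}" by auto
    from span_minimal[OF this subspace_hyperplane] have "(w' - w) \<bullet> (w' - w) = 0"
      unfolding fr(3) by blast
    then show "w' = w" by simp
  qed
  ultimately show ?thesis by blast
qed

text \<open>The constant is the cone volume for the standard simplex, that is, 1/n!. Every other
  frame is a linear image of the standard one and contributes its determinant.\<close>

lemma cvol_simplex:
  obtains \<kappa> where "\<kappa> > 0"
    "\<And>v w. \<lbrakk>frame_det v \<noteq> 0; \<And>k. w \<bullet> v k = 1\<rbrakk>
      \<Longrightarrow> cvol (simplex0 (range v)) (w :: real^'n::finite) = \<kappa> * \<bar>frame_det v\<bar>"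
proof -
  define e :: "'n \<Rightarrow> real^'n" where "e k = axis k 1" for k
  define w0 :: "real^'n" where "w0 = (\<chi> i. 1)"
  let ?S = "simplex0 (range e)"
  have "(\<chi> i. e i) = mat 1" by (simp add: e_def vec_eq_iff mat_def axis_def)
  then have e1: "frame_det e = 1" by (simp add: frame_det_def)
  then have e: "frame_det e \<noteq> 0" by simp
  have w0: "w0 \<bullet> e k = 1" for k by (simp add: w0_def e_def inner_axis)
  have S: "compact ?S" "convex ?S"
    by (auto intro: finite_imp_compact_convex_hull)
  have fv: "w0 \<in> facet_vectors ?S" using facet_vectors_simplex[OF e w0] by simp
  show thesis
  proof (rule that)
    show "cvol ?S w0 > 0" by (rule cvol_pos[OF S fv])
    fix v and w :: "real^'n" assume v: "frame_det v \<noteq> 0" and w: "\<And>k. w \<bullet> v k = 1"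
    obtain f where "linear f \<and> (\<forall>k. f (e k) = v k)"
      using linear_on_independent_range[OF frame_det_nonzero_imp(1,2)[OF e], of v] by (rule exE)
    then have f: "linear f" "\<And>k. f (e k) = v k" by simp_all
    have det: "det (matrix f) = frame_det v"
      using frame_det_linear[OF f(1), of e] by (simp add: f(2) e1)
    then have "inj f" using v det_nz_iff_inj[OF f(1)] by simp
    have img: "f ` ?S = simplex0 (range v)"
      by (simp add: convex_hull_linear_image[OF f(1)] linear_0[OF f(1)] image_image f(2))
    have "w \<bullet> f y = w0 \<bullet> y" for y
    proof -
      obtain c where c: "y = (\<Sum>k\<in>UNIV. c k *\<^sub>R e k)" by (rule frame_coords[OF e])
      show ?thesis
        unfolding c by (simp add: linear_sum[OF f(1)] linear_scale[OF f(1)] f(2) inner_sum_right w w0)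
    qed
    moreover have "w0 \<noteq> 0" using w0 by force
    ultimately show "cvol (simplex0 (range v)) w = cvol ?S w0 * \<bar>frame_det v\<bar>"
      using cvol_linear_image(2)[OF f(1) \<open>inj f\<close> S(1), of w w0] by (simp add: img det)
  qed
qed

section \<open>Vanishing on lower-dimensional polytopes\<close>

lemma finite_convex_hull_polytopes_o:
  assumes "finite V"
  shows "simplex0 V \<in> polytopes_o"
  using assms by (simp add: polytopes_o_def polytope_convex_hull hull_inc)

lemma simplex0_subset_span: "simplex0 V \<subseteq> span V"
  by (intro hull_minimal subspace_imp_convex subspace_span) (auto simp: span_0 span_base)

locale contravariant_valuation =
  fixes \<mu> :: "(real^'n::finite) set \<Rightarrow> 'n tensor" and p :: nat
  assumes dim: "CARD('n) \<ge> 3" and order: "p \<ge> 1"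
    and tensor: "\<And>P. P \<in> polytopes_o \<Longrightarrow> \<mu> P \<in> Sym_tensors p"
    and contra: "SL_contravariant \<mu>" and valuation: "valuation_on polytopes_o \<mu>"
begin

text \<open>Contravariance as invariance of the pairing: polytope and arguments move together, and
  no inverse appears.\<close>

lemma SL_image:
  assumes "det \<phi> = 1" "P \<in> polytopes_o"
  shows "\<mu> ((\<lambda>x. \<phi> *v x) ` P) (\<lambda>l. \<phi> *v x l) = \<mu> P x"
proof -
  have "\<mu> ((\<lambda>x. \<phi> *v x) ` P) = tensor_act (transpose (matrix_inv \<phi>)) (\<mu> P)"
    using contra assms by (simp add: SL_contravariant_def)
  then show ?thesis
    by (simp add: tensor_act_def adjoint_matrix_inv(2)[OF assms(1)])
qed

text \<open>The map from \<open>v\<close> to \<open>v'\<close> fixes vectors spanning a space that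
  contains \<open>P\<close>, hence \<open>P\<close> pointwise, while it moves the argument
  \<open>v i\<close>.\<close>

lemma frame_fixing:
  assumes v: "frame_det v \<noteq> 0" "frame_det v' = frame_det v" "\<And>k. k \<in> K \<Longrightarrow> v' k = v k"
    and P: "P \<in> polytopes_o" "P \<subseteq> span (v ` K)"
  shows "\<mu> P (\<lambda>_. v' i) = \<mu> P (\<lambda>_. v i)"
proof -
  obtain \<phi> :: "real^'n^'n" where \<phi>: "det \<phi> = 1" "\<And>k. \<phi> *v v k = v' k"
    by (rule frame_map[OF v(1,2)]) (rule that)
  have "\<phi> *v x = x" if x: "x \<in> P" for x
  proof -
    have "x \<in> span (v ` K)" using x P(2) by blast
    then have "\<phi> *v x = id x"
      by (rule linear_eq_on_span[OF matrix_vector_mul_linear linear_id, rotated]) (auto simp: \<phi>(2) v(3))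
    then show ?thesis by simp
  qed
  then have "(\<lambda>x. \<phi> *v x) ` P = P" by simp
  then show ?thesis using SL_image[OF \<phi>(1) P(1), of "\<lambda>_. v i"] by (simp add: \<phi>(2))
qed

text \<open>Each \<open>y\<close> off the hyperplane is a multiple of some \<open>v i + r\<close>
  with \<open>r\<close> in the hyperplane, and the shear taking \<open>v i\<close> to
  \<open>v i + r\<close> fixes \<open>P\<close>. So the value at \<open>v i\<close> determines the
  tensor.\<close>

lemma vanishes_in_hyperplane:
  assumes v: "frame_det v \<noteq> 0" and P: "P \<in> polytopes_o" "P \<subseteq> span (v ` (- {i}))"
    and vi: "\<mu> P (\<lambda>_. v i) = 0"
  shows "\<mu> P x = 0"
proof -
  obtain a where a: "\<And>k. a \<bullet> v k = (if k = i then 1 else 0)"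
    using frame_dual[OF v, of "\<lambda>k. if k = i then 1 else 0"] by blast
  have "\<mu> P (\<lambda>_. y) = 0" if y: "a \<bullet> y \<noteq> 0" for y
  proof -
    obtain c where c: "y = (\<Sum>k\<in>UNIV. c k *\<^sub>R v k)" by (rule frame_coords[OF v])
    have ci: "a \<bullet> y = c i"
      unfolding c by (simp add: inner_sum_right a if_distrib[of "(*) _"] cong: if_cong)
    define r where "r = (\<Sum>k\<in>-{i}. (c k / c i) *\<^sub>R v k)"
    have r: "r \<in> span (v ` (- {i}))"
      unfolding r_def by (intro span_sum span_scale span_base) auto
    have "y = c i *\<^sub>R v i + (\<Sum>k\<in>-{i}. c k *\<^sub>R v k)"
      unfolding c by (subst sum.remove[of UNIV i]) (simp_all add: Compl_eq_Diff_UNIV)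
    also have "(\<Sum>k\<in>-{i}. c k *\<^sub>R v k) = c i *\<^sub>R r"
      unfolding r_def scaleR_sum_right using y ci by (intro sum.cong) auto
    finally have yr: "y = c i *\<^sub>R (v i + r)" by (simp add: scaleR_add_right)
    have "frame_det (v(i := v i + r)) = frame_det v"
      using frame_det_add_span[OF r, of "v i"] by simp
    then have "\<mu> P (\<lambda>_. (v(i := v i + r)) i) = \<mu> P (\<lambda>_. v i)"
      by (intro frame_fixing[OF v, of "v(i := v i + r)" "- {i}" P i] P) auto
    then have "\<mu> P (\<lambda>_. v i + r) = 0" using vi by simp
    then show ?thesis unfolding yr by (simp add: Sym_tensors_scale[OF tensor[OF P(1)]])
  qed
  note off = this
  have "a \<noteq> 0"
  proof
    assume "a = 0"
    with a[of i] show False by simp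
  qed
  then show ?thesis
    by (rule Sym_tensors_eq_0_if_diag_off_hyperplane[OF tensor[OF P(1)]]) (rule off)
qed

text \<open>With two free directions, doubling one and halving the other has determinant 1 and fixes
  \<open>P\<close>, but multiplies the value at \<open>v i\<close> by \<open>2 ^ p\<close>.\<close>

lemma vanishes_in_codim_2:
  assumes v: "frame_det v \<noteq> 0" and ij: "i \<noteq> j" and P: "P \<in> polytopes_o" "P \<subseteq> span (v ` (- {i, j}))"
  shows "\<mu> P x = 0"
proof (rule vanishes_in_hyperplane[OF v P(1)])
  show "P \<subseteq> span (v ` (- {i}))" using P(2) span_mono[of "v ` (- {i, j})" "v ` (- {i})"] by auto
  define v' where "v' = v(i := 2 *\<^sub>R v i, j := (1/2) *\<^sub>R v j)"
  have "frame_det v' = frame_det v"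
    unfolding v'_def using ij by (simp add: frame_det_scale fun_upd_twist[of j i] fun_upd_idem)
  then have "\<mu> P (\<lambda>_. v' i) = \<mu> P (\<lambda>_. v i)"
    by (intro frame_fixing[OF v, of v' "- {i, j}" P i] P) (auto simp: v'_def)
  then have "2 ^ p * \<mu> P (\<lambda>_. v i) = \<mu> P (\<lambda>_. v i)"
    using ij by (simp add: v'_def Sym_tensors_scale[OF tensor[OF P(1)]])
  moreover have "(2::real) ^ p \<noteq> 1" using one_less_power[of "2 :: real" p] order by force
  ultimately show "\<mu> P (\<lambda>_. v i) = 0" by simp
qed

lemma vanishes_if_aff_dim_less:
  assumes P: "P \<in> polytopes_o" "aff_dim P < int CARD('n) - 1"
  shows "\<mu> P x = 0"
proof -
  obtain B where B: "B \<subseteq> P" "independent B" "P \<subseteq> span B" "card B = dim P"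
    by (rule basis_exists)
  obtain v :: "'n \<Rightarrow> real^'n" where v: "frame_det v \<noteq> 0" "B \<subseteq> range v"
    using frame_extending[OF B(2)] .
  define K where "K = v -` B"
  have inj: "inj v" using frame_det_nonzero_imp[OF v(1)] by simp
  have BK: "B = v ` K" using v(2) by (auto simp: K_def)
  then have "card K = card B" using card_image[OF inj_on_subset[OF inj subset_UNIV]] by metis
  moreover have "aff_dim P = int (dim P)"
    using P(1) by (intro aff_dim_zero hull_inc) (simp add: polytopes_o_def)
  ultimately have "card K + 1 < CARD('n)" using B(4) P(2) by simp
  then have "\<not> card (- K) \<le> Suc 0" by (simp add: Compl_eq_Diff_UNIV card_Diff_subset)
  then obtain i j where "i \<in> - K" "j \<in> - K" "i \<noteq> j" by (auto simp: card_le_Suc0_iff_eq)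
  then have ij: "i \<noteq> j" "K \<subseteq> - {i, j}" by auto
  have "P \<subseteq> span (v ` (- {i, j}))"
    using B(3) span_mono[OF image_mono[OF ij(2), of v]] unfolding BK by blast
  from vanishes_in_codim_2[OF v(1) ij(1) P(1) this] show ?thesis .
qed

text \<open>The hyperplane through 0, \<open>m\<close> and the vertices other than
  \<open>v i\<close> and \<open>v j\<close> cuts the simplex in two. Vanishing on the common part is
  a hypothesis because the lemma is applied in dimension n - 1, where it rests on codimension 2, and
  in dimension n, where it rests on vanishing in hyperplanes.\<close>

lemma cut_simplex:
  assumes v: "frame_det v \<noteq> 0" and ij: "i \<in> K" "j \<in> K" "i \<noteq> j" and l: "0 < \<theta>" "\<theta> < 1"
    and m: "m = (1 - \<theta>) *\<^sub>R v i + \<theta> *\<^sub>R v j"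
    and van: "\<And>P. \<lbrakk>P \<in> polytopes_o; P \<subseteq> span ((v(j := m)) ` (K - {i}))\<rbrakk> \<Longrightarrow> \<mu> P x = 0"
  shows "\<mu> (simplex0 (v ` K)) x =
    \<mu> (simplex0 ((v(j := m)) ` K)) x + \<mu> (simplex0 ((v(i := m)) ` K)) x"
proof -
  define S P Q where "S = simplex0 (v ` K)" and "P = simplex0 ((v(j := m)) ` K)"
    and "Q = simplex0 ((v(i := m)) ` K)"
  have po: "S \<in> polytopes_o" "P \<in> polytopes_o" "Q \<in> polytopes_o"
    unfolding S_def P_def Q_def by (simp_all add: finite_convex_hull_polytopes_o)
  have cvS: "convex S" by (simp add: S_def)
  have vS: "v k \<in> S" if "k \<in> K" for k using that by (simp add: S_def hull_inc)
  have mS: "m \<in> S" unfolding m using l ij by (intro convexD[OF cvS] vS) auto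
  have S0: "0 \<in> S" by (simp add: S_def hull_inc)
  have "P \<subseteq> S" unfolding P_def using mS vS S0 by (intro hull_minimal cvS) auto
  moreover have "Q \<subseteq> S" unfolding Q_def using mS vS S0 by (intro hull_minimal cvS) auto
  moreover have "S \<subseteq> P \<union> Q"
  proof
    have half: "x \<in> simplex0 ((v(b := m)) ` K)"
      if ab: "a \<in> K" "b \<in> K" "a \<noteq> b" and r: "0 < r" and m: "m = (1 - r) *\<^sub>R v a + r *\<^sub>R v b"
        and c: "\<forall>k. 0 \<le> c k" "sum c K \<le> 1" "x = (\<Sum>k\<in>K. c k *\<^sub>R v k)" "c b * (1 - r) \<le> c a * r"
      for a b r c x
    proof -
      have K: "(\<Sum>k\<in>K. f k) = f a + f b + (\<Sum>k\<in>K - {a, b}. f k)" for f :: "'n \<Rightarrow> 'b::ab_group_add"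
      proof -
        have "K - {a, b} = K - {a} - {b}" by auto
        then show ?thesis
          using sum.remove[OF finite ab(1), of f] sum.remove[of "K - {a}" b f] ab by (simp add: add.assoc)
      qed
      \<comment> \<open>Obtained by substituting
        \<open>v b = (m - (1 - r) *\<^sub>R v a) /\<^sub>R r\<close>; the sum of the weights is
        unchanged.\<close>
      define d where "d = c(a := c a - (c b / r - c b), b := c b / r)"
      have e: "c b / r * (1 - r) = c b / r - c b" "c b / r * r = c b"
        using r by (simp_all add: right_diff_distrib diff_divide_distrib)
      have "c b / r * (1 - r) \<le> c a" using c(4) r by (simp add: pos_divide_le_eq)
      moreover have "0 \<le> c b / r" using c(1) r by simp
      ultimately have "\<forall>k. 0 \<le> d k" using c(1) unfolding e by (simp add: d_def)
      moreover have "sum d K = sum c K"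
        using ab unfolding K by (simp add: d_def)
      moreover have "(\<Sum>k\<in>K. d k *\<^sub>R (v(b := m)) k) = x"
      proof -
        have dd: "d a = c a - (c b / r - c b)" "d b = c b / r" using ab by (simp_all add: d_def)
        have "d a *\<^sub>R v a + d b *\<^sub>R m = c a *\<^sub>R v a + c b *\<^sub>R v b"
          unfolding dd m scaleR_add_right scaleR_scaleR e by (simp add: scaleR_diff_left)
        then show ?thesis
          unfolding c(3) K using ab by (simp add: d_def)
      qed
      ultimately show ?thesis
        using c(2) by (subst mem_simplex) (auto intro!: exI[of _ d])
    qed
    fix x assume "x \<in> S"
    then obtain c where c: "\<forall>k. 0 \<le> c k" "sum c K \<le> 1" "x = (\<Sum>k\<in>K. c k *\<^sub>R v k)"
      unfolding S_def by (subst (asm) mem_simplex) auto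
    have m': "m = (1 - (1 - \<theta>)) *\<^sub>R v j + (1 - \<theta>) *\<^sub>R v i" by (simp add: m)
    show "x \<in> P \<union> Q"
    proof (cases "c j * (1 - \<theta>) \<le> c i * \<theta>")
      case True
      from half[OF ij l(1) m c True] show ?thesis by (simp add: P_def)
    next
      case False
      then have "c i * (1 - (1 - \<theta>)) \<le> c j * (1 - \<theta>)" by simp
      from half[OF ij(2,1) ij(3)[symmetric] _ m' c this] l show ?thesis by (simp add: Q_def)
    qed
  qed
  ultimately have un: "P \<union> Q = S" by blast
  have "P \<inter> Q \<in> polytopes_o"
    using po by (auto simp: polytopes_o_def intro: polytope_Int)
  moreover have "P \<inter> Q \<subseteq> span ((v(j := m)) ` (K - {i}))"
  proof
    fix x assume x: "x \<in> P \<inter> Q"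
    \<comment> \<open>The normal of the cut: it vanishes at \<open>m\<close> and separates
      \<open>v i\<close> from \<open>v j\<close>.\<close>
    obtain a where a: "\<And>k. a \<bullet> v k = (if k = i then - \<theta> else if k = j then 1 - \<theta> else 0)"
      using frame_dual[OF v, of "\<lambda>k. if k = i then - \<theta> else if k = j then 1 - \<theta> else 0"] by blast
    have am: "a \<bullet> m = 0" using ij by (simp add: m inner_add_right a)
    have "Q \<subseteq> {x. a \<bullet> x \<ge> 0}"
      unfolding Q_def by (intro hull_minimal convex_halfspace_ge) (use am a l in auto)
    then have ax: "a \<bullet> x \<ge> 0" using x by blast
    obtain c where c: "\<forall>k. 0 \<le> c k" "x = (\<Sum>k\<in>K. c k *\<^sub>R (v(j := m)) k)"
    proof -
      have "x \<in> P" using x by simp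
      then show thesis using that unfolding P_def by (subst (asm) mem_simplex) auto
    qed
    have "a \<bullet> (v(j := m)) k = (if k = i then - \<theta> else 0)" for k using ij am by (auto simp: a)
    then have "a \<bullet> x = c i * - \<theta>"
      unfolding c(2) using ij by (simp add: inner_sum_right if_distrib[of "(*) _"] cong: if_cong)
    with ax l have "c i \<le> 0" by (simp add: mult_le_0_iff zero_le_mult_iff)
    then have "c i = 0" using c(1) by (simp add: order_antisym)
    then have "x = (\<Sum>k\<in>K - {i}. c k *\<^sub>R (v(j := m)) k)"
      unfolding c(2) using ij by (simp add: sum.remove[of K i])
    also have "\<dots> \<in> span ((v(j := m)) ` (K - {i}))"
      by (intro span_sum span_scale span_base) blast
    finally show "x \<in> span ((v(j := m)) ` (K - {i}))" .
  qed
  ultimately have "\<mu> (P \<inter> Q) x = 0" by (rule van)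
  moreover have "\<mu> P x + \<mu> Q x = \<mu> (P \<union> Q) x + \<mu> (P \<inter> Q) x"
    using valuation po \<open>P \<inter> Q \<in> polytopes_o\<close> un unfolding valuation_on_def by simp
  ultimately have "\<mu> S x = \<mu> P x + \<mu> Q x" using un by simp
  then show ?thesis by (simp add: S_def P_def Q_def)
qed

text \<open>The map between the frames carries the simplex and the arguments at once, so only
  coordinates relative to the frame matter.\<close>

lemma simplex_frame_change:
  assumes v: "frame_det v \<noteq> 0" "frame_det v' = frame_det v"
  shows "\<mu> (simplex0 (v' ` K)) (\<lambda>l. \<Sum>k\<in>UNIV. c l k *\<^sub>R v' k) =
    \<mu> (simplex0 (v ` K)) (\<lambda>l. \<Sum>k\<in>UNIV. c l k *\<^sub>R v k)"
proof -
  obtain \<phi> :: "real^'n^'n" where \<phi>: "det \<phi> = 1" "\<And>k. \<phi> *v v k = v' k"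
    by (rule frame_map[OF v]) (rule that)
  have lin: "linear (\<lambda>x. \<phi> *v x)" by (rule matrix_vector_mul_linear)
  have "(\<lambda>x. \<phi> *v x) ` (simplex0 (v ` K)) = simplex0 (v' ` K)"
    by (simp add: convex_hull_linear_image[OF lin] image_image \<phi>(2))
  moreover have "\<phi> *v (\<Sum>k\<in>UNIV. c l k *\<^sub>R v k) = (\<Sum>k\<in>UNIV. c l k *\<^sub>R v' k)" for l
    by (simp add: linear_sum[OF lin] linear_scale[OF lin] \<phi>(2))
  ultimately show ?thesis
    using SL_image[OF \<phi>(1) finite_convex_hull_polytopes_o[of "v ` K"], of "\<lambda>l. \<Sum>k\<in>UNIV. c l k *\<^sub>R v k"]
    by simp
qed

lemma simplex_frame_change_vertex:
  assumes v: "frame_det v \<noteq> 0" "frame_det v' = frame_det v"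
  shows "\<mu> (simplex0 (v' ` K)) (\<lambda>_. v' i) = \<mu> (simplex0 (v ` K)) (\<lambda>_. v i)"
proof -
  have "(\<Sum>k\<in>UNIV. (if k = i then 1 else 0) *\<^sub>R u k) = u i" for u :: "'n \<Rightarrow> real^'n"
    by (simp add: if_distrib[of "\<lambda>r. r *\<^sub>R _"] cong: if_cong)
  then show ?thesis
    using simplex_frame_change[OF v, of K "\<lambda>_ k. if k = i then 1 else 0"] by simp
qed

end

lemma simple_valuation_eval:
  fixes \<mu>' :: "(real^'n::finite) set \<Rightarrow> 'n tensor"
  assumes "valuation_on polytopes_o \<mu>'"
    and "\<And>P. \<lbrakk>P \<in> polytopes_o; aff_dim P < m\<rbrakk> \<Longrightarrow> \<mu>' P x = 0"
  shows "simple_valuation (\<lambda>P. \<mu>' P x) m"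
proof
  fix P Q :: "(real^'n) set"
  assume "polytope P" "0 \<in> P" "polytope Q" "0 \<in> Q" "polytope (P \<union> Q)"
  then have "P \<in> polytopes_o" "Q \<in> polytopes_o" "P \<union> Q \<in> polytopes_o" "P \<inter> Q \<in> polytopes_o"
    by (simp_all add: polytopes_o_def polytope_Int)
  then show "\<mu>' P x + \<mu>' Q x = \<mu>' (P \<union> Q) x + \<mu>' (P \<inter> Q) x"
    using assms(1) unfolding valuation_on_def by simp
qed (use assms(2) in \<open>simp add: polytopes_o_def\<close>)

context contravariant_valuation
begin

lemma frame_det_midpoint:
  assumes "i \<noteq> j"
  shows "frame_det (v(j := (1 - \<theta>) *\<^sub>R v i + \<theta> *\<^sub>R v j)) = \<theta> * frame_det v"
    and "frame_det (v(i := (1 - \<theta>) *\<^sub>R v i + \<theta> *\<^sub>R v j)) = (1 - \<theta>) * frame_det v"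
  using frame_det_combine[OF assms, of v "1 - \<theta>" \<theta>]
    frame_det_combine[OF assms[symmetric], of v \<theta> "1 - \<theta>"] by (simp_all add: add.commute)

lemma two_indices_avoiding:
  obtains i j :: 'n where "i \<noteq> k" "j \<noteq> k" "i \<noteq> j"
proof -
  have "\<not> card (- {k}) \<le> Suc 0"
    using dim by (simp add: Compl_eq_Diff_UNIV card_Diff_subset)
  then show thesis using that by (auto simp: card_le_Suc0_iff_eq)
qed

text \<open>Only the value \<open>C\<close> at the transversal vector \<open>v k\<close> matters.
  Bisecting an edge halves the determinant and doubling \<open>v k\<close> restores it, so
  \<open>C = 2 * C / 2 ^ p\<close>. This says nothing for \<open>p = 1\<close>; there, exchanging
  two vertices and reversing \<open>v k\<close> has determinant 1 and preserves the simplex, so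
  \<open>C = - C\<close>.\<close>

lemma vanishes_on_simplices_in_hyperplane:
  assumes v: "frame_det v \<noteq> 0"
  shows "\<mu> (simplex0 (v ` (- {k}))) x = 0"
proof -
  obtain i j :: 'n where ij: "i \<noteq> k" "j \<noteq> k" "i \<noteq> j" by (rule two_indices_avoiding)
  let ?S = "\<lambda>u. simplex0 (u ` (- {k})) :: (real^'n) set"
  define C where "C = \<mu> (?S v) (\<lambda>_. v k)"
  have po: "?S u \<in> polytopes_o" for u by (simp add: finite_convex_hull_polytopes_o)
  have scale: "\<mu> (?S u) (\<lambda>_. r *\<^sub>R y) = r ^ p * \<mu> (?S u) (\<lambda>_. y)" for u r y
    by (rule Sym_tensors_scale[OF tensor[OF po]])
  have "C = 0"
  proof (cases "p = 1")
    case True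
    define v' where "v' = (v \<circ> Transposition.transpose i j)(k := - 1 *\<^sub>R v k)"
    have "v' = (v \<circ> Transposition.transpose i j)(k := - 1 *\<^sub>R (v \<circ> Transposition.transpose i j) k)"
      using ij by (simp add: v'_def)
    then have "frame_det v' = - frame_det (v \<circ> Transposition.transpose i j)"
      using frame_det_scale[of "v \<circ> Transposition.transpose i j" k "- 1" "(v \<circ> Transposition.transpose i j) k"]
      by (simp only: fun_upd_triv)
    also have "frame_det (v \<circ> Transposition.transpose i j) = - frame_det v"
      using frame_det_permute[OF permutes_swap_id[of i UNIV j], of v] ij by (simp add: sign_swap_id)
    finally have det: "frame_det v' = frame_det v" by simp
    have "v' ` (- {k}) = v ` (- {k})"
    proof -
      have "v' ` (- {k}) = v ` (Transposition.transpose i j ` (- {k}))"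
        by (auto simp: v'_def image_iff)
      also have "Transposition.transpose i j ` (- {k}) = - {k}"
        using ij by (auto simp: image_iff Transposition.transpose_def)
      finally show ?thesis .
    qed
    then have "\<mu> (?S v) (\<lambda>_. v' k) = \<mu> (?S v) (\<lambda>_. v k)"
      using simplex_frame_change_vertex[OF v det, of "- {k}" k] by simp
    then show ?thesis using True scale[of v "- 1" "v k"] by (simp add: v'_def C_def)
  next
    case False
    define m where "m = (1 - 1/2) *\<^sub>R v i + (1/2) *\<^sub>R v j"
    have half: "\<mu> (?S (v(l := m))) (\<lambda>_. v k) = C / 2 ^ p" if l: "l = i \<or> l = j" for l
    proof -
      have lk: "l \<noteq> k" using l ij by auto
      have "frame_det (v(l := m)) = frame_det v / 2"
        using l frame_det_midpoint[OF ij(3), of v "1/2"] by (auto simp: m_def)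
      moreover have "(v(l := m))(k := 2 *\<^sub>R v k) = (v(l := m))(k := 2 *\<^sub>R (v(l := m)) k)"
        using lk by simp
      ultimately have "frame_det ((v(l := m))(k := 2 *\<^sub>R v k)) = frame_det v"
        by (simp only: frame_det_scale fun_upd_triv)
      from simplex_frame_change_vertex[OF v this, of "- {k}" k]
      have "\<mu> (simplex0 ((v(l := m))(k := 2 *\<^sub>R v k) ` (- {k}))) (\<lambda>_. 2 *\<^sub>R v k) = C"
        by (simp add: C_def)
      moreover have "(v(l := m))(k := 2 *\<^sub>R v k) ` (- {k}) = (v(l := m)) ` (- {k})"
        by (intro image_cong) auto
      ultimately have "2 ^ p * \<mu> (?S (v(l := m))) (\<lambda>_. v k) = C"
        by (simp only: scale)
      then show ?thesis by (simp add: field_simps)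
    qed
    have "\<mu> (?S v) (\<lambda>_. v k) = \<mu> (?S (v(j := m))) (\<lambda>_. v k) + \<mu> (?S (v(i := m))) (\<lambda>_. v k)"
    proof (rule cut_simplex[OF v _ _ ij(3) _ _ m_def])
      fix P assume P: "P \<in> polytopes_o" "P \<subseteq> span ((v(j := m)) ` (- {k} - {i}))"
      have "- {k} - {i} = - {k, i}" by auto
      moreover have "frame_det (v(j := m)) \<noteq> 0"
        using v frame_det_midpoint[OF ij(3), of v "1/2"] by (simp add: m_def)
      ultimately show "\<mu> P (\<lambda>_. v k) = 0"
        using vanishes_in_codim_2[of "v(j := m)" k i P] P ij by simp
    qed (use ij in auto)
    then have "C = C / 2 ^ p + C / 2 ^ p"
      unfolding C_def[symmetric] using half[of i] half[of j] by simp
    from arg_cong[OF this, of "\<lambda>t. t * 2 ^ p"] have "C * 2 ^ p = C + C"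
      by (simp only: distrib_right) simp
    then have "C * (2 ^ p - 2) = 0" by (simp add: right_diff_distrib)
    moreover have "(2::real) ^ p > 2 ^ 1"
      using False order by (intro power_strict_increasing) auto
    ultimately show ?thesis by simp
  qed
  moreover have "?S v \<subseteq> span (v ` (- {k}))" by (rule simplex0_subset_span)
  ultimately show ?thesis
    using vanishes_in_hyperplane[OF v po[of v]] by (simp add: C_def)
qed

text \<open>Vanishing in codimension 2 makes the valuation simple at dimension n - 1, where
  simplices decide.\<close>

lemma vanishes_if_lowdim:
  assumes P: "P \<in> polytopes_o" "aff_dim P < int CARD('n)"
  shows "\<mu> P x = 0"
proof (cases "aff_dim P < int CARD('n) - 1")
  case False
  interpret simple_valuation "\<lambda>P. \<mu> P x" "int CARD('n) - 1"
    by (rule simple_valuation_eval[OF valuation vanishes_if_aff_dim_less])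
  show ?thesis
  proof (rule vanishes_if_vanishes_on_simplices)
    fix V :: "(real^'n) set" assume V: "independent V" "int (card V) = int CARD('n) - 1"
    obtain v :: "'n \<Rightarrow> real^'n" where v: "frame_det v \<noteq> 0" "V \<subseteq> range v"
      using frame_extending[OF V(1)] .
    have inj: "inj v" using frame_det_nonzero_imp[OF v(1)] by simp
    define K where "K = v -` V"
    have VK: "V = v ` K" using v(2) by (auto simp: K_def)
    then have "card K = card V" using card_image[OF inj_on_subset[OF inj subset_UNIV]] by metis
    then have "card (- K) = 1" using V(2) by (simp add: Compl_eq_Diff_UNIV card_Diff_subset)
    then obtain k where "- K = {k}" by (rule card_1_singletonE)
    then have "K = - {k}" by auto
    then show "\<mu> (simplex0 V) x = 0"
      using vanishes_on_simplices_in_hyperplane[OF v(1), of k] VK by simp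
  qed (use P False in \<open>auto simp: polytopes_o_def\<close>)
qed (use vanishes_if_aff_dim_less P in simp)

end

section \<open>Simplices with a vertex at the origin\<close>

text \<open>The direction space of the face with vertices indexed by \<open>T\<close>: the plane of
  a triangle for three indices, the facet opposite to 0 for \<open>UNIV\<close>.\<close>

definition tangent :: "('i \<Rightarrow> 'a::real_vector) \<Rightarrow> 'i set \<Rightarrow> 'a set" where
  "tangent v T = span {v l - v l' | l l'. l \<in> T \<and> l' \<in> T}"

lemma subspace_tangent: "subspace (tangent v T)"
  by (simp add: tangent_def)

lemma diff_in_tangent: "l \<in> T \<Longrightarrow> l' \<in> T \<Longrightarrow> v l - v l' \<in> tangent v T"
  unfolding tangent_def by (rule span_base) blast

lemma tangent_subset:
  assumes "\<And>l. l \<in> T \<Longrightarrow> v' l - v l \<in> tangent v T"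
  shows "tangent v' T \<subseteq> tangent v T"
  unfolding tangent_def[of v' T]
proof (intro span_minimal subspace_tangent subsetI)
  fix x assume "x \<in> {v' l - v' l' | l l'. l \<in> T \<and> l' \<in> T}"
  then obtain l l' where l: "l \<in> T" "l' \<in> T" "x = v' l - v' l'" by blast
  have "x = (v' l - v l) + (v l - v l') - (v' l' - v l')" by (simp add: l(3))
  also have "\<dots> \<in> tangent v T"
    by (rule subspace_diff[OF subspace_tangent subspace_add[OF subspace_tangent assms[OF l(1)]
          diff_in_tangent[OF l(1,2)]] assms[OF l(2)]])
  finally show "x \<in> tangent v T" .
qed

text \<open>The map between two such frames preserves the direction space and is the identity modulo
  it. The condition ranges over all indices, so every vector moves only by a tangent vector.\<close>

definition same_plane :: "'i set \<Rightarrow> ('i \<Rightarrow> 'a::real_vector) \<Rightarrow> ('i \<Rightarrow> 'a) \<Rightarrow> bool" where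
  "same_plane T v v' \<longleftrightarrow> tangent v' T = tangent v T \<and> (\<forall>l. v' l - v l \<in> tangent v T)"

lemma same_plane_sym: "same_plane T v v' \<Longrightarrow> same_plane T v' v"
  unfolding same_plane_def using subspace_neg[OF subspace_tangent] by (metis minus_diff_eq)

lemma same_plane_trans: "same_plane T v v' \<Longrightarrow> same_plane T v' v'' \<Longrightarrow> same_plane T v v''"
proof -
  assume a: "same_plane T v v'" "same_plane T v' v''"
  have "v'' l - v l \<in> tangent v T" for l
  proof -
    have "(v'' l - v' l) + (v' l - v l) \<in> tangent v T"
      using a unfolding same_plane_def by (intro subspace_add subspace_tangent) auto
    then show ?thesis by simp
  qed
  then show "same_plane T v v''" using a unfolding same_plane_def by simp
qed

lemma tangent_update_diff:
  assumes ab: "a \<in> T" "b \<in> T" "\<alpha> + \<beta> = 1"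
  shows "(v(b := \<alpha> *\<^sub>R v a + \<beta> *\<^sub>R v b)) l - v l \<in> tangent v T"
proof (cases "l = b")
  case True
  have "\<beta> = 1 - \<alpha>" using ab(3) by simp
  then have "\<alpha> *\<^sub>R v a + \<beta> *\<^sub>R v b - v b = \<alpha> *\<^sub>R (v a - v b)"
    by (simp add: scaleR_diff_left scaleR_diff_right)
  then show ?thesis
    using True ab by (simp add: subspace_scale[OF subspace_tangent] diff_in_tangent)
qed (simp add: subspace_0[OF subspace_tangent])

text \<open>For nonzero \<open>\<beta>\<close> the inverse substitution is again an affine
  combination of the same two vertices, so the tangent spaces contain each other.\<close>

lemma same_plane_update:
  assumes ab: "a \<in> T" "b \<in> T" "a \<noteq> b" "\<alpha> + \<beta> = 1" "\<beta> \<noteq> 0"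
  shows "same_plane T v (v(b := \<alpha> *\<^sub>R v a + \<beta> *\<^sub>R v b))"
proof -
  define v' where "v' = v(b := \<alpha> *\<^sub>R v a + \<beta> *\<^sub>R v b)"
  have 1: "v' l - v l \<in> tangent v T" for l
    unfolding v'_def by (rule tangent_update_diff[OF ab(1,2,4)])
  have eq: "v = v'(b := (- \<alpha> / \<beta>) *\<^sub>R v' a + (1 / \<beta>) *\<^sub>R v' b)"
    using ab by (auto simp: v'_def fun_eq_iff scaleR_add_right)
  have "\<alpha> = 1 - \<beta>" using ab(4) by simp
  then have "- \<alpha> / \<beta> + 1 / \<beta> = 1" using ab(5) by (simp add: field_simps)
  then have "v l - v' l \<in> tangent v' T" for l
    by (subst eq) (rule tangent_update_diff[OF ab(1,2)])
  then have "tangent v T = tangent v' T"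
    using tangent_subset[of T v' v] tangent_subset[of T v v'] 1 by blast
  with 1 show ?thesis unfolding same_plane_def v'_def by simp
qed

lemma same_plane_permute:
  assumes "\<pi> permutes T"
  shows "same_plane T v (v \<circ> \<pi>)"
proof -
  have im: "\<pi> l \<in> T \<longleftrightarrow> l \<in> T" for l using assms by (rule permutes_in_image)
  have "(v \<circ> \<pi>) l - v l \<in> tangent v T" for l
  proof (cases "l \<in> T")
    case False
    then show ?thesis using permutes_not_in[OF assms] by (simp add: subspace_0[OF subspace_tangent])
  qed (simp add: im diff_in_tangent)
  moreover have "tangent (v \<circ> \<pi>) T = tangent v T"
  proof -
    have "{(v \<circ> \<pi>) l - (v \<circ> \<pi>) l' | l l'. l \<in> T \<and> l' \<in> T} = {v l - v l' | l l'. l \<in> T \<and> l' \<in> T}"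
    proof (intro antisym subsetI)
      fix x assume "x \<in> {v l - v l' | l l'. l \<in> T \<and> l' \<in> T}"
      then obtain l l' where l: "l \<in> T" "l' \<in> T" "x = v l - v l'" by blast
      then obtain k k' where "k \<in> T" "k' \<in> T" "l = \<pi> k" "l' = \<pi> k'"
        using permutes_image[OF assms] by (metis imageE)
      then show "x \<in> {(v \<circ> \<pi>) l - (v \<circ> \<pi>) l' | l l'. l \<in> T \<and> l' \<in> T}" using l by auto
    qed (use im in auto)
    then show ?thesis by (simp add: tangent_def)
  qed
  ultimately show ?thesis by (simp add: same_plane_def)
qed

context contravariant_valuation
begin

section \<open>The tensor of a simplex as a function of its frame, and the descent over
  slots\<close>

definition simplex_tensor :: "('n \<Rightarrow> real^'n) \<Rightarrow> 'n tensor" where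
  "simplex_tensor v = \<mu> (simplex0 (range v))"

lemma simplex_tensor_Sym: "simplex_tensor v \<in> Sym_tensors p"
  unfolding simplex_tensor_def by (intro tensor finite_convex_hull_polytopes_o) simp

lemma simplex_tensor_permute: "\<pi> permutes UNIV \<Longrightarrow> simplex_tensor (v \<circ> \<pi>) = simplex_tensor v"
  unfolding simplex_tensor_def by (simp only: image_comp[symmetric] permutes_image)

lemma simplex_tensor_frame_change:
  assumes "frame_det v \<noteq> 0" "frame_det v' = frame_det v"
  shows "simplex_tensor v' (\<lambda>l. \<Sum>k\<in>UNIV. c l k *\<^sub>R v' k) = simplex_tensor v (\<lambda>l. \<Sum>k\<in>UNIV. c l k *\<^sub>R v k)"
  unfolding simplex_tensor_def by (rule simplex_frame_change[OF assms])

lemma simplex_tensor_cut: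
  assumes v: "frame_det v \<noteq> 0" and ij: "i \<noteq> j" and l: "0 < \<theta>" "\<theta> < 1"
    and m: "m = (1 - \<theta>) *\<^sub>R v i + \<theta> *\<^sub>R v j"
  shows "simplex_tensor v x = simplex_tensor (v(j := m)) x + simplex_tensor (v(i := m)) x"
  unfolding simplex_tensor_def
proof (rule cut_simplex[OF v _ _ ij l m])
  fix P assume P: "P \<in> polytopes_o" "P \<subseteq> span ((v(j := m)) ` (UNIV - {i}))"
  have "aff_dim P = int (dim P)"
    using P(1) by (intro aff_dim_zero hull_inc) (simp add: polytopes_o_def)
  moreover have "dim P \<le> card ((v(j := m)) ` (UNIV - {i}))"
    by (rule dim_le_card[OF P(2)]) simp
  moreover have "card ((v(j := m)) ` (UNIV - {i})) \<le> CARD('n) - 1"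
    using card_image_le[of "UNIV - {i}" "v(j := m)"] by (simp add: card_Diff_subset)
  ultimately have "aff_dim P < int CARD('n)" using dim by simp
  then show "\<mu> P x = 0" by (rule vanishes_if_lowdim[OF P(1)])
qed auto

definition mixed :: "nat \<Rightarrow> (nat \<Rightarrow> real^'n) \<Rightarrow> ('n \<Rightarrow> real^'n) \<Rightarrow> real^'n \<Rightarrow> real" where
  "mixed d z v y = simplex_tensor v (\<lambda>l. if l < d then y else z l)"

lemma mixed_scale:
  assumes "d \<le> p"
  shows "mixed d z v (c *\<^sub>R y) = c ^ d * mixed d z v y"
  unfolding mixed_def by (rule Sym_tensors_scale_first[OF simplex_tensor_Sym assms])

lemma mixed_cut:
  assumes "frame_det v \<noteq> 0" "i \<noteq> j" "0 < \<theta>" "\<theta> < 1" "m = (1 - \<theta>) *\<^sub>R v i + \<theta> *\<^sub>R v j"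
  shows "mixed d z v y = mixed d z (v(j := m)) y + mixed d z (v(i := m)) y"
  unfolding mixed_def by (rule simplex_tensor_cut[OF assms])

lemma mixed_invariant:
  assumes d: "d \<le> p"
    and higher: "\<And>v x. \<lbrakk>d < p; frame_det v \<noteq> 0; \<And>l. l \<le> d \<Longrightarrow> x l \<in> tangent v T\<rbrakk> \<Longrightarrow> simplex_tensor v x = 0"
    and v: "frame_det v \<noteq> 0" "frame_det v' = frame_det v" "same_plane T v v'"
    and ab: "a \<in> T" "b \<in> T"
  shows "mixed d z v' (s *\<^sub>R (v' b - v' a)) = mixed d z v (s *\<^sub>R (v b - v a))"
proof -
  define c0 where "c0 k = s * ((if k = b then 1 else 0) - (if k = a then 1 else 0))" for k
  have c0: "(\<Sum>k\<in>UNIV. c0 k *\<^sub>R u k) = s *\<^sub>R (u b - u a)" for u :: "'n \<Rightarrow> real^'n"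
  proof -
    have "(\<Sum>k\<in>UNIV. c0 k *\<^sub>R u k) = s *\<^sub>R (\<Sum>k\<in>UNIV. (if k = b then u k else 0) - (if k = a then u k else 0))"
      unfolding scaleR_sum_right c0_def by (intro sum.cong refl) auto
    then show ?thesis by (simp add: sum_subtractf)
  qed
  have "\<forall>l. \<exists>c. z l = (\<Sum>k\<in>UNIV. c k *\<^sub>R v k)" using frame_coords[OF v(1)] by metis
  then obtain cz where cz: "\<And>l. z l = (\<Sum>k\<in>UNIV. cz l k *\<^sub>R v k)" by metis
  define c where "c l = (if l < d then c0 else cz l)" for l
  have frv: "frame_det v' \<noteq> 0" using v by simp
  have tan: "tangent v' T = tangent v T" "\<And>l. v' l - v l \<in> tangent v T"
    using v(3) by (auto simp: same_plane_def)
  have "mixed d z v (s *\<^sub>R (v b - v a)) = simplex_tensor v (\<lambda>l. \<Sum>k\<in>UNIV. c l k *\<^sub>R v k)"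
    unfolding mixed_def by (intro arg_cong[of _ _ "simplex_tensor v"] ext) (simp add: c_def c0 cz)
  also have "\<dots> = simplex_tensor v' (\<lambda>l. \<Sum>k\<in>UNIV. c l k *\<^sub>R v' k)"
    by (rule simplex_tensor_frame_change[OF v(1,2), symmetric])
  also have "\<dots> = mixed d z v' (s *\<^sub>R (v' b - v' a))"
    unfolding mixed_def
  proof (rule Sym_tensors_slots_mod[OF simplex_tensor_Sym subspace_tangent[of v' T], of d])
    show "simplex_tensor v' x = 0" if "d < p" "\<And>l. l \<le> d \<Longrightarrow> x l \<in> tangent v' T" for x
      using higher[OF that(1) frv] that(2) .
    show "(\<Sum>k\<in>UNIV. c l k *\<^sub>R v' k) \<in> tangent v' T" if "l < d" for l
      using that ab by (simp add: c_def c0 subspace_scale[OF subspace_tangent] diff_in_tangent)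
    show "(if l < d then s *\<^sub>R (v' b - v' a) else z l) = (\<Sum>k\<in>UNIV. c l k *\<^sub>R v' k)" if "l < d" for l
      using that by (simp add: c_def c0)
    show "(\<Sum>k\<in>UNIV. c l k *\<^sub>R v' k) - (if l < d then s *\<^sub>R (v' b - v' a) else z l) \<in> tangent v' T"
      if "d \<le> l" "l < p" for l
    proof -
      have "(\<Sum>k\<in>UNIV. c l k *\<^sub>R v' k) - z l = (\<Sum>k\<in>UNIV. cz l k *\<^sub>R (v' k - v k))"
        unfolding cz[of l] using that by (simp add: c_def sum_subtractf scaleR_diff_right)
      also have "\<dots> \<in> tangent v' T"
        unfolding tan(1) by (intro subspace_sum subspace_scale subspace_tangent tan(2))
      finally show ?thesis using that by simp
    qed
  qed
  finally show ?thesis ..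
qed

context
  fixes d :: nat and T :: "'n set" and z :: "nat \<Rightarrow> real^'n"
  assumes d: "1 \<le> d" "d \<le> p"
    and higher: "\<And>v x. \<lbrakk>d < p; frame_det v \<noteq> 0; \<And>l. l \<le> d \<Longrightarrow> x l \<in> tangent v T\<rbrakk> \<Longrightarrow> simplex_tensor v x = 0"
begin

lemma invariant:
  assumes "frame_det v \<noteq> 0" "frame_det v' = frame_det v" "same_plane T v v'" "a \<in> T" "b \<in> T"
    and "y = s *\<^sub>R (v b - v a)" "y' = s *\<^sub>R (v' b - v' a)"
  shows "mixed d z v' y' = mixed d z v y"
  unfolding assms(6,7)
  by (rule mixed_invariant[OF d(2) _ assms(1-5)]) (rule higher)

text \<open>The halves have equal determinants and lie in the same plane, and the given vector is
  the same multiple of the edge in each, so their values agree.\<close>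

lemma mixed_halve_edge:
  assumes v: "frame_det v \<noteq> 0" and ab: "a \<in> T" "b \<in> T" "a \<noteq> b"
  shows "mixed d z (v(b := (1/2) *\<^sub>R v a + (1/2) *\<^sub>R v b)) (s *\<^sub>R (v b - v a)) = mixed d z v (s *\<^sub>R (v b - v a)) / 2"
proof -
  define m where "m = (1/2) *\<^sub>R v a + (1/2) *\<^sub>R v b"
  define va vb where "va = v(b := m)" and "vb = v(a := m)"
  have m': "m = (1 - 1/2) *\<^sub>R v a + (1/2) *\<^sub>R v b" by (simp add: m_def)
  have det: "frame_det va = frame_det v / 2" "frame_det vb = frame_det va"
    using frame_det_midpoint[OF ab(3), of v "1/2"] by (simp_all add: va_def vb_def m_def)
  have "same_plane T v va" unfolding va_def m_def using ab by (intro same_plane_update) auto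
  moreover have "same_plane T v vb"
    using same_plane_update[of b T a "1/2" "1/2" v] ab unfolding vb_def m_def by (simp add: add.commute)
  ultimately have pl: "same_plane T va vb" by (rule same_plane_trans[OF same_plane_sym])
  have "frame_det va \<noteq> 0" using det v by simp
  have "va b - va a = (1/2) *\<^sub>R (v b - v a)" "vb b - vb a = (1/2) *\<^sub>R (v b - v a)"
    using ab(3) by (simp_all add: va_def vb_def m_def vec_eq_iff field_simps)
  then have "s *\<^sub>R (v b - v a) = (2 * s) *\<^sub>R (va b - va a)" "s *\<^sub>R (v b - v a) = (2 * s) *\<^sub>R (vb b - vb a)"
    by simp_all
  from invariant[OF \<open>frame_det va \<noteq> 0\<close> det(2) pl ab(1,2) this]
  have "mixed d z vb (s *\<^sub>R (v b - v a)) = mixed d z va (s *\<^sub>R (v b - v a))" .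
  moreover have "mixed d z v (s *\<^sub>R (v b - v a)) = mixed d z va (s *\<^sub>R (v b - v a)) + mixed d z vb (s *\<^sub>R (v b - v a))"
    unfolding va_def vb_def by (rule mixed_cut[OF v ab(3) _ _ m']) auto
  ultimately show ?thesis by (simp add: va_def m_def)
qed

text \<open>
  The midpoints of two edges cut the triangle into three smaller ones.  Each of them is comparable with
  a triangle obtained by halving the edge \<open>v b - v a\<close> once or twice; with \<open>e = 2\<^sup>-\<^sup>d\<close> this gives
  \<open>t = e t / 2 \<plusminus> e t / 4 + e t / 4\<close>.
\<close>

lemma mixed_edge_zero:
  assumes v: "frame_det v \<noteq> 0" and abc: "a \<in> T" "b \<in> T" "c \<in> T" "a \<noteq> b" "a \<noteq> c" "b \<noteq> c"
  shows "mixed d z v (v b - v a) = 0"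
proof -
  define y where "y = v b - v a"
  define t where "t = mixed d z v y"
  define m m' where "m = (1/2) *\<^sub>R v b + (1/2) *\<^sub>R v c" and "m' = (1/2) *\<^sub>R v a + (1/2) *\<^sub>R v c"
  have mm: "m = (1 - 1/2) *\<^sub>R v b + (1/2) *\<^sub>R v c" "m' = (1 - 1/2) *\<^sub>R v a + (1/2) *\<^sub>R v c"
    by (simp_all add: m_def m'_def)
  have pm: "same_plane T u (u(j := (1/2) *\<^sub>R u i + (1/2) *\<^sub>R u j))"
    "same_plane T u (u(i := (1/2) *\<^sub>R u i + (1/2) *\<^sub>R u j))"
    if "i \<in> T" "j \<in> T" "i \<noteq> j" for u :: "'n \<Rightarrow> real^'n" and i j
    using same_plane_update[of i T j "1/2" "1/2" u] same_plane_update[of j T i "1/2" "1/2" u] that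
    by (simp_all add: add.commute)
  have dm: "frame_det (u(j := (1/2) *\<^sub>R u i + (1/2) *\<^sub>R u j)) = frame_det u / 2"
    "frame_det (u(i := (1/2) *\<^sub>R u i + (1/2) *\<^sub>R u j)) = frame_det u / 2"
    if "i \<noteq> j" for u :: "'n \<Rightarrow> real^'n" and i j
    using frame_det_midpoint[OF that, of u "1/2"] by simp_all

  \<comment> \<open>\<open>h\<close> and \<open>q\<close> are reference triangles with 1/2 and 1/4
    of the determinant; their edge from \<open>a\<close> to \<open>b\<close> is \<open>y\<close>
    scaled by the same factor, and their values are known multiples of \<open>t\<close>.\<close>
  define h where "h = v(b := (1/2) *\<^sub>R v a + (1/2) *\<^sub>R v b)"
  define q where "q = h(b := (1/2) *\<^sub>R h a + (1/2) *\<^sub>R h b)"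
  have half: "u - ((1/2) *\<^sub>R u + (1/2) *\<^sub>R x) = (1/2) *\<^sub>R (u - x)"
    "((1/2) *\<^sub>R u + (1/2) *\<^sub>R x) - x = (1/2) *\<^sub>R (u - x)"
    "((1/2) *\<^sub>R u + (1/2) *\<^sub>R x) - u = (1/2) *\<^sub>R (x - u)" for u x :: "real^'n"
    by (simp_all add: vec_eq_iff field_simps)
  have h: "frame_det h = frame_det v / 2" "same_plane T v h" "h b - h a = (1/2) *\<^sub>R y"
    unfolding h_def using abc dm[of a b v] pm[of a b v] half by (simp_all add: y_def)
  have q: "frame_det q = frame_det v / 4" "same_plane T v q" "q b - q a = (1/4) *\<^sub>R y"
    unfolding q_def using abc dm[of a b h] h same_plane_trans[OF h(2) pm(1)[of a b h]] half[of "h a" "h b"]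
    by simp_all
  have h0: "frame_det h \<noteq> 0" and q0: "frame_det q \<noteq> 0" using v h(1) q(1) by simp_all
  have th: "mixed d z h (r *\<^sub>R y) = r ^ d * (t / 2)" for r
    using mixed_halve_edge[OF v abc(1,2,4), of 1]
    by (simp add: mixed_scale[OF d(2)] t_def h_def y_def)
  have tq: "mixed d z q (r *\<^sub>R y) = r ^ d * (t / 4)" for r
    using mixed_halve_edge[OF h0 abc(1,2,4), of 2] th[of 1]
    by (simp add: mixed_scale[OF d(2)] q_def h(3))

  define v1 v2 where "v1 = v(c := m)" and "v2 = v(b := m)"
  have cut1: "t = mixed d z v1 y + mixed d z v2 y"
    unfolding t_def v1_def v2_def by (rule mixed_cut[OF v abc(6) _ _ mm(1)]) auto
  have v1: "frame_det v1 = frame_det h" "same_plane T v v1"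
    unfolding v1_def m_def using abc dm(1)[of b c v] pm(1)[of b c v] h(1) by simp_all
  have v2: "frame_det v2 = frame_det v / 2" "same_plane T v v2"
    unfolding v2_def m_def using abc dm(2)[of b c v] pm(2)[of b c v] by simp_all
  have "mixed d z v1 y = mixed d z h ((1/2) *\<^sub>R y)"
  proof (rule invariant[OF h0 v1(1) same_plane_trans[OF same_plane_sym[OF h(2)] v1(2)] abc(1,2)])
    show "(1/2) *\<^sub>R y = 1 *\<^sub>R (h b - h a)" "y = 1 *\<^sub>R (v1 b - v1 a)"
      using abc by (simp_all add: h(3) v1_def y_def)
  qed
  then have t1: "mixed d z v1 y = (1/2) ^ d * (t / 2)" by (simp only: th)

  define v3 v4 where "v3 = v2(c := m')" and "v4 = v2(a := m')"
  have v20: "frame_det v2 \<noteq> 0" using v v2(1) by simp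
  have m'2: "m' = (1/2) *\<^sub>R v2 a + (1/2) *\<^sub>R v2 c" using abc by (simp add: m'_def v2_def)
  have cut2: "mixed d z v2 y = mixed d z v3 y + mixed d z v4 y"
    unfolding v3_def v4_def by (rule mixed_cut[OF v20 abc(5), of "1/2"]) (simp_all add: m'2)
  have v3: "frame_det v3 = frame_det v / 4" "same_plane T v v3"
    unfolding v3_def m'2 using abc dm(1)[of a c v2] v2 same_plane_trans[OF v2(2) pm(1)[of a c v2]] by simp_all
  have v4: "frame_det v4 = frame_det q" "same_plane T v v4"
    unfolding v4_def m'2 using abc dm(2)[of a c v2] v2 q(1) same_plane_trans[OF v2(2) pm(2)[of a c v2]] by simp_all
  have mdiff: "m - m' = (1/2) *\<^sub>R y" by (simp add: m_def m'_def y_def scaleR_diff_right)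
  have "mixed d z v4 y = mixed d z q ((1/2) *\<^sub>R y)"
  proof (rule invariant[OF q0 v4(1) same_plane_trans[OF same_plane_sym[OF q(2)] v4(2)] abc(1,2)])
    have "v4 b - v4 a = (1/2) *\<^sub>R y" using abc by (simp add: v4_def v2_def mdiff)
    then show "(1/2) *\<^sub>R y = 2 *\<^sub>R (q b - q a)" "y = 2 *\<^sub>R (v4 b - v4 a)"
      by (simp_all add: q(3))
  qed
  then have t4: "mixed d z v4 y = (1/2) ^ d * (t / 4)" by (simp only: tq)

  \<comment> \<open>In \<open>v3\<close> the edge parallel to \<open>y\<close> joins positions
    \<open>b\<close> and \<open>c\<close>. A 3-cycle moves it to \<open>a\<close> and
    \<open>b\<close>; it is even, so the determinant is kept, but the edge now points against
    \<open>y\<close>. Hence the power of -1/2.\<close>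
  define \<pi> where "\<pi> = Transposition.transpose a b \<circ> Transposition.transpose b c"
  have \<pi>: "\<pi> a = b" "\<pi> b = c" "\<pi> c = a"
    using abc by (simp_all add: \<pi>_def Transposition.transpose_def)
  have \<pi>T: "\<pi> permutes T" and \<pi>U: "\<pi> permutes UNIV"
    unfolding \<pi>_def using abc by (auto intro!: permutes_compose permutes_swap_id)
  have "sign \<pi> = 1"
    unfolding \<pi>_def using abc
    by (simp add: sign_compose permutation_swap_id sign_swap_id)
  then have v5: "frame_det (v3 \<circ> \<pi>) = frame_det q" "same_plane T v (v3 \<circ> \<pi>)"
    using frame_det_permute[OF \<pi>U, of v3] v3 q(1) same_plane_trans[OF v3(2) same_plane_permute[OF \<pi>T]] by simp_all
  have "mixed d z (v3 \<circ> \<pi>) y = mixed d z q ((- 1/2) *\<^sub>R y)"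
  proof (rule invariant[OF q0 v5(1) same_plane_trans[OF same_plane_sym[OF q(2)] v5(2)] abc(1,2)])
    have "(v3 \<circ> \<pi>) b - (v3 \<circ> \<pi>) a = - (m - m')" using abc by (simp add: \<pi> v3_def v2_def)
    then show "(- 1/2) *\<^sub>R y = (- 2) *\<^sub>R (q b - q a)" "y = (- 2) *\<^sub>R ((v3 \<circ> \<pi>) b - (v3 \<circ> \<pi>) a)"
      by (simp_all add: q(3) mdiff)
  qed
  then have t3: "mixed d z v3 y = (- 1/2) ^ d * (t / 4)"
    unfolding tq by (simp add: mixed_def simplex_tensor_permute[OF \<pi>U])

  define e where "e = (1/2 :: real) ^ d"
  have e: "0 < e" "e \<le> 1/2"
    using d(1) power_decreasing[of 1 d "1/2 :: real"] by (simp_all add: e_def)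
  have "(- 1/2 :: real) ^ d = e \<or> (- 1/2 :: real) ^ d = - e"
    unfolding e_def by (cases "even d") (simp_all add: power_divide)
  moreover have "t = e * (t / 2) + ((- 1/2) ^ d * (t / 4) + e * (t / 4))"
    using cut1 cut2 t1 t3 t4 by (simp add: e_def)
  ultimately have "t = t * e \<or> t = t * (e / 2)" by (auto simp: field_simps)
  then have "t = 0" using e by auto
  then show ?thesis by (simp add: t_def y_def)
qed

lemma edge_zero:
  assumes v: "frame_det v \<noteq> 0" and abc: "a \<in> T" "b \<in> T" "c \<in> T" "a \<noteq> b" "a \<noteq> c" "b \<noteq> c"
  shows "mixed d z v (s *\<^sub>R (v b - v a)) = 0"
proof -
  have "mixed d z v (v b - v a) = 0" by (rule mixed_edge_zero[OF v abc])
  then show ?thesis by (simp add: mixed_scale[OF d(2)])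
qed

text \<open>The line through \<open>v a\<close> in direction \<open>y\<close> meets the opposite edge and cuts the triangle in two.\<close>

lemma mixed_apex_zero:
  assumes v: "frame_det v \<noteq> 0" and abc: "a \<in> T" "b \<in> T" "c \<in> T" "a \<noteq> b" "a \<noteq> c" "b \<noteq> c"
    and y: "y = \<beta> *\<^sub>R (v b - v a) + \<gamma> *\<^sub>R (v c - v a)" "\<beta> * \<gamma> \<ge> 0"
  shows "mixed d z v y = 0"
proof -
  consider "\<beta> = 0" | "\<gamma> = 0" | "\<beta> \<noteq> 0" "\<gamma> \<noteq> 0" by blast
  then show ?thesis
  proof cases
    case 1
    then show ?thesis using edge_zero[OF v abc(1,3,2,5,4) abc(6)[symmetric]] by (simp add: y(1))
  next
    case 2
    then show ?thesis using edge_zero[OF v abc] by (simp add: y(1))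
  next
    case 3
    have s0: "\<beta> + \<gamma> \<noteq> 0" using 3 y(2) by (smt (verit) zero_le_mult_iff)
    \<comment> \<open>Chosen so that \<open>y = (\<beta> + \<gamma>) *\<^sub>R (m - v a)\<close>: in
      both pieces \<open>y\<close> is then parallel to an edge.\<close>
    define \<theta> where "\<theta> = \<gamma> / (\<beta> + \<gamma>)"
    have "(\<beta> > 0 \<and> \<gamma> > 0) \<or> (\<beta> < 0 \<and> \<gamma> < 0)" using 3 y(2) by (auto simp: zero_le_mult_iff)
    then have \<theta>: "0 < \<theta>" "\<theta> < 1" by (auto simp: \<theta>_def field_simps)
    have g: "(\<beta> + \<gamma>) * \<theta> = \<gamma>" using s0 by (simp add: \<theta>_def)
    then have "(\<beta> + \<gamma>) * (1 - \<theta>) = \<beta>" by (simp add: right_diff_distrib)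
    define m where "m = (1 - \<theta>) *\<^sub>R v b + \<theta> *\<^sub>R v c"
    have "m - v a = (1 - \<theta>) *\<^sub>R (v b - v a) + \<theta> *\<^sub>R (v c - v a)"
      by (simp add: m_def algebra_simps)
    then have "(\<beta> + \<gamma>) *\<^sub>R (m - v a) = ((\<beta> + \<gamma>) * (1 - \<theta>)) *\<^sub>R (v b - v a) + ((\<beta> + \<gamma>) * \<theta>) *\<^sub>R (v c - v a)"
      by (simp only: scaleR_add_right scaleR_scaleR)
    then have ym: "y = (\<beta> + \<gamma>) *\<^sub>R (m - v a)"
      unfolding g \<open>(\<beta> + \<gamma>) * (1 - \<theta>) = \<beta>\<close> y(1) by (rule sym)
    have dets: "frame_det (v(c := m)) \<noteq> 0" "frame_det (v(b := m)) \<noteq> 0"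
      using frame_det_midpoint[OF abc(6), of v \<theta>] v \<theta> by (simp_all add: m_def)
    have "mixed d z v y = mixed d z (v(c := m)) y + mixed d z (v(b := m)) y"
      by (rule mixed_cut[OF v abc(6) \<theta> m_def])
    moreover have "mixed d z (v(c := m)) y = 0"
      using edge_zero[OF dets(1) abc(1,3,2,5,4) abc(6)[symmetric], of "\<beta> + \<gamma>"] abc by (simp add: ym)
    moreover have "mixed d z (v(b := m)) y = 0"
      using edge_zero[OF dets(2) abc, of "\<beta> + \<gamma>"] abc by (simp add: ym)
    ultimately show ?thesis by simp
  qed
qed

text \<open>As a combination of the three vertices \<open>y\<close> has coefficients
  \<open>\<alpha>\<close>, \<open>\<beta>\<close>, \<open>\<gamma>\<close> of sum 0. Two of them are
  not of opposite sign, and the third vertex serves as the apex.\<close>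

lemma mixed_tangent_zero:
  assumes v: "frame_det v \<noteq> 0" and T: "T = {a, b, c}" and abc: "a \<noteq> b" "a \<noteq> c" "b \<noteq> c"
    and y: "y \<in> tangent v T"
  shows "mixed d z v y = 0"
proof -
  have in_T: "a \<in> T" "b \<in> T" "c \<in> T" by (simp_all add: T)
  let ?S = "{\<beta> *\<^sub>R (v b - v a) + \<gamma> *\<^sub>R (v c - v a) | \<beta> \<gamma>. True}"
  have "tangent v T \<subseteq> ?S"
    unfolding tangent_def
  proof (intro span_minimal subsetI)
    show "subspace ?S"
    proof (rule subspaceI)
      show "0 \<in> ?S" by (intro CollectI exI[of _ 0]) simp
      show "x + y \<in> ?S" if xy: "x \<in> ?S" "y \<in> ?S" for x y
      proof -
        obtain r s r' s' where rs: "x = r *\<^sub>R (v b - v a) + s *\<^sub>R (v c - v a)" "y = r' *\<^sub>R (v b - v a) + s' *\<^sub>R (v c - v a)"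
          using xy by blast
        show ?thesis
          by (intro CollectI exI[of _ "r + r'"] exI[of _ "s + s'"]) (simp add: rs scaleR_add_left)
      qed
      show "k *\<^sub>R x \<in> ?S" if x: "x \<in> ?S" for k x
      proof -
        obtain r s where rs: "x = r *\<^sub>R (v b - v a) + s *\<^sub>R (v c - v a)" using x by blast
        show ?thesis
          by (intro CollectI exI[of _ "k * r"] exI[of _ "k * s"]) (simp add: rs scaleR_add_right)
      qed
    qed
  next
    fix x assume "x \<in> {v l - v l' | l l'. l \<in> T \<and> l' \<in> T}"
    then obtain l l' where l: "l \<in> T" "l' \<in> T" "x = v l - v l'" by blast
    define r where "r k = (if k = b then 1 else (0::real))" for k
    define s where "s k = (if k = c then 1 else (0::real))" for k
    have "v k = v a + r k *\<^sub>R (v b - v a) + s k *\<^sub>R (v c - v a)" if "k \<in> T" for k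
      using that abc by (auto simp: T r_def s_def)
    then have "x = (v a + r l *\<^sub>R (v b - v a) + s l *\<^sub>R (v c - v a))
        - (v a + r l' *\<^sub>R (v b - v a) + s l' *\<^sub>R (v c - v a))"
      using l by metis
    then have "x = (r l - r l') *\<^sub>R (v b - v a) + (s l - s l') *\<^sub>R (v c - v a)"
      by (simp add: scaleR_diff_left)
    then show "x \<in> ?S" by blast
  qed
  then obtain \<beta> \<gamma> where ya: "y = \<beta> *\<^sub>R (v b - v a) + \<gamma> *\<^sub>R (v c - v a)" using y by blast
  define \<alpha> where "\<alpha> = - \<beta> - \<gamma>"
  have yb: "y = \<alpha> *\<^sub>R (v a - v b) + \<gamma> *\<^sub>R (v c - v b)" and yc: "y = \<alpha> *\<^sub>R (v a - v c) + \<beta> *\<^sub>R (v b - v c)"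
    unfolding ya \<alpha>_def by (simp_all add: algebra_simps)
  consider "\<beta> * \<gamma> \<ge> 0" | "\<alpha> * \<gamma> \<ge> 0" | "\<alpha> * \<beta> \<ge> 0"
    by (smt (verit) zero_le_mult_iff)
  then show ?thesis
  proof cases
    case 1
    then show ?thesis using mixed_apex_zero[OF v in_T abc ya] by simp
  next
    case 2
    then show ?thesis
      using mixed_apex_zero[OF v in_T(2,1,3) abc(1)[symmetric] abc(3,2) yb] by simp
  next
    case 3
    then show ?thesis
      using mixed_apex_zero[OF v in_T(3,1,2) abc(2)[symmetric] abc(3)[symmetric] abc(1) yc] by simp
  qed
qed

end

text \<open>At \<open>d = p\<close> no slot is left to be moved, so \<open>higher\<close> is
  vacuous; below, it is the induction hypothesis for \<open>d + 1\<close>. Polarization passes from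
  one repeated vector to arbitrary tangent vectors.\<close>

lemma simplex_tensor_tangent_zero:
  assumes T: "T = {a, b, c}" and abc: "a \<noteq> b" "a \<noteq> c" "b \<noteq> c"
    and d: "1 \<le> d" "d \<le> p"
  shows "\<forall>v x. frame_det v \<noteq> 0 \<longrightarrow> (\<forall>l<d. x l \<in> tangent v T) \<longrightarrow> simplex_tensor v x = 0"
  using d(2) d(1)
proof (induction d rule: inc_induct)
  case base
  show ?case
  proof (intro allI impI)
    fix v :: "'n \<Rightarrow> real^'n" and x :: "nat \<Rightarrow> real^'n"
    assume v: "frame_det v \<noteq> 0" and x: "\<forall>l<p. x l \<in> tangent v T"
    show "simplex_tensor v x = 0"
    proof (rule Sym_tensors_polarization[OF simplex_tensor_Sym order_refl subspace_tangent[of v T], where z = x])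
      fix y assume "y \<in> tangent v T"
      then have "mixed p x v y = 0"
        by (intro mixed_tangent_zero[OF base order_refl _ v T abc]) auto
      then show "simplex_tensor v (\<lambda>l. if l < p then y else x l) = 0" by (simp add: mixed_def)
    qed (use x in auto)
  qed
next
  case (step d)
  show ?case
  proof (intro allI impI)
    fix v :: "'n \<Rightarrow> real^'n" and x :: "nat \<Rightarrow> real^'n"
    assume v: "frame_det v \<noteq> 0" and x: "\<forall>l<d. x l \<in> tangent v T"
    have dp: "d \<le> p" using step.hyps by simp
    have higher: "simplex_tensor u x = 0"
      if "frame_det u \<noteq> 0" "\<And>l. l \<le> d \<Longrightarrow> x l \<in> tangent u T" for u x
      using step.IH step.prems that by (auto simp: less_Suc_eq_le)
    show "simplex_tensor v x = 0"
    proof (rule Sym_tensors_polarization[OF simplex_tensor_Sym dp subspace_tangent[of v T], where z = x])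
      fix y assume "y \<in> tangent v T"
      then have "mixed d x v y = 0"
        by (rule mixed_tangent_zero[OF step.prems dp _ v T abc, rotated]) (rule higher)
      then show "simplex_tensor v (\<lambda>l. if l < d then y else x l) = 0" by (simp add: mixed_def)
    qed (use x in auto)
  qed
qed

lemma third_index:
  obtains c :: 'n where "a \<noteq> c" "b \<noteq> c"
proof -
  have "\<exists>c. c \<notin> {a, b}"
  proof (rule ccontr)
    assume "\<not> ?thesis"
    then have "UNIV = {a, b}" by auto
    then have "CARD('n) = card {a, b}" by simp
    also have "\<dots> \<le> 2" by (simp add: card_insert_if)
    finally show False using dim by simp
  qed
  then show thesis using that by fastforce
qed

text \<open>The end \<open>d = 1\<close> of the descent concerns a single slot, which is linear. A
  third index places each edge in a triangle, and the edges span the direction space of the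
  facet.\<close>

lemma simplex_tensor_slot_zero:
  assumes v: "frame_det v \<noteq> 0" and x: "x 0 \<in> tangent v UNIV"
  shows "simplex_tensor v x = 0"
proof -
  have p0: "0 < p" using order by simp
  have edge: "simplex_tensor v (x(0 := v a - v b)) = 0" for a b
  proof (cases "a = b")
    case True
    then show ?thesis by (intro Sym_tensors_zero_slot[OF simplex_tensor_Sym p0]) simp
  next
    case False
    obtain c where c: "a \<noteq> c" "b \<noteq> c" by (rule third_index)
    show ?thesis
      using simplex_tensor_tangent_zero[OF refl False c order_refl order] v diff_in_tangent[of a "{a, b, c}" b v]
      by simp
  qed
  have "simplex_tensor v (x(0 := x 0)) = 0"
    using Sym_tensors_linear_slot[OF simplex_tensor_Sym p0] _ x[unfolded tangent_def]
  proof (rule linear_eq_0_on_span)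
    fix y assume "y \<in> {v l - v l' | l l'. l \<in> UNIV \<and> l' \<in> UNIV}"
    then show "simplex_tensor v (x(0 := y)) = 0" using edge by auto
  qed
  then show ?thesis by simp
qed

text \<open>As \<open>w\<close> is 1 at all vertices, \<open>x l\<close> and
  \<open>(w \<bullet> x l) *\<^sub>R v k\<close> differ by a tangent vector of the facet, and the
  scalars come out as the tensor power of \<open>w\<close>.\<close>

lemma simplex_tensor_eq:
  assumes v: "frame_det v \<noteq> 0" and w: "\<And>k. w \<bullet> v k = 1"
  shows "simplex_tensor v x = tensor_power w p x * simplex_tensor v (\<lambda>_. v k)"
proof -
  have "simplex_tensor v x = simplex_tensor v (\<lambda>l. (w \<bullet> x l) *\<^sub>R v k)"
  proof (rule Sym_tensors_slots_mod[OF simplex_tensor_Sym subspace_tangent[of v UNIV], of 0])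
    fix l
    obtain c where c: "x l = (\<Sum>k\<in>UNIV. c k *\<^sub>R v k)" by (rule frame_coords[OF v])
    have "x l - (w \<bullet> x l) *\<^sub>R v k = (\<Sum>k'\<in>UNIV. c k' *\<^sub>R (v k' - v k))"
      unfolding c by (simp add: inner_sum_right w scaleR_diff_right sum_subtractf scaleR_sum_left)
    also have "\<dots> \<in> tangent v UNIV"
      by (intro subspace_sum subspace_scale subspace_tangent diff_in_tangent) auto
    finally show "x l - (w \<bullet> x l) *\<^sub>R v k \<in> tangent v UNIV" .
  qed (use simplex_tensor_slot_zero[OF v] in auto)
  also have "\<dots> = (\<Prod>l<p. w \<bullet> x l) * simplex_tensor v (\<lambda>_. v k)"
    by (rule Sym_tensors_scale_slots[OF simplex_tensor_Sym])
  finally show ?thesis by (simp add: tensor_power_def inner_commute)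
qed

section \<open>The remaining scalar as a function of the determinant\<close>

definition unit_frame :: "'n \<Rightarrow> real \<Rightarrow> 'n \<Rightarrow> real^'n" where
  "unit_frame k r = (\<lambda>i. axis i 1)(k := r *\<^sub>R axis k 1)"

lemma frame_det_unit_frame: "frame_det (unit_frame k r) = r"
proof -
  have "frame_det (\<lambda>i. axis i (1::real) :: real^'n) = det (mat 1 :: real^'n^'n)"
    unfolding frame_det_def by (intro arg_cong[of _ _ det]) (simp add: vec_eq_iff mat_def axis_def)
  moreover have "(\<lambda>i. axis i 1)(k := axis k 1) = (\<lambda>i. axis i (1::real) :: real^'n)" by auto
  ultimately show ?thesis by (simp add: unit_frame_def frame_det_scale del: fun_upd_apply)
qed

definition weight :: "'n \<Rightarrow> real \<Rightarrow> real" where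
  "weight k r = simplex_tensor (unit_frame k r) (\<lambda>_. unit_frame k r k)"

lemma simplex_tensor_vertex_indep:
  assumes v: "frame_det v \<noteq> 0"
  shows "simplex_tensor v (\<lambda>_. v k) = simplex_tensor v (\<lambda>_. v j)"
proof -
  obtain w where w: "\<And>k. w \<bullet> v k = 1" using frame_dual[OF v, of "\<lambda>_. 1"] by blast
  show ?thesis
    using simplex_tensor_eq[OF v w, of "\<lambda>_. v k" j] by (simp add: tensor_power_def inner_commute w)
qed

text \<open>A frame of positive determinant is compared with the unit frame of the same determinant.
  For a negative one, two vertices are exchanged first, which leaves the simplex as it is.\<close>

lemma simplex_tensor_vertex:
  assumes v: "frame_det v \<noteq> 0"
  shows "simplex_tensor v (\<lambda>_. v j) = weight k \<bar>frame_det v\<bar>"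
proof -
  have pos: "simplex_tensor u (\<lambda>_. u j) = weight k (frame_det u)" if u: "frame_det u > 0" for u
  proof -
    have "frame_det (unit_frame k (frame_det u)) \<noteq> 0" using u by (simp add: frame_det_unit_frame)
    from simplex_frame_change_vertex[OF this, of u UNIV k]
    have "simplex_tensor u (\<lambda>_. u k) = weight k (frame_det u)"
      by (simp add: frame_det_unit_frame simplex_tensor_def weight_def)
    then show ?thesis using simplex_tensor_vertex_indep[of u j k] u by simp
  qed
  show ?thesis
  proof (cases "frame_det v > 0")
    case True
    then show ?thesis using pos[of v] by simp
  next
    case False
    obtain i i' :: 'n where ii: "i \<noteq> k" "i' \<noteq> k" "i \<noteq> i'" by (rule two_indices_avoiding)
    define \<pi> where "\<pi> = Transposition.transpose i i'"
    have \<pi>: "\<pi> permutes UNIV" unfolding \<pi>_def by (rule permutes_swap_id) auto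
    have det: "frame_det (v \<circ> \<pi>) = - frame_det v"
      using frame_det_permute[OF \<pi>, of v] ii(3) by (simp add: \<pi>_def sign_swap_id)
    then have "simplex_tensor (v \<circ> \<pi>) (\<lambda>_. (v \<circ> \<pi>) j) = weight k (- frame_det v)"
      using pos[of "v \<circ> \<pi>"] False v by simp
    then have "simplex_tensor v (\<lambda>_. v (\<pi> j)) = weight k (- frame_det v)"
      by (simp add: simplex_tensor_permute[OF \<pi>])
    then show ?thesis using simplex_tensor_vertex_indep[OF v, of j "\<pi> j"] False by simp
  qed
qed

text \<open>The edge that is cut avoids index \<open>k\<close>, so \<open>v k\<close> stays a vertex
  of both pieces; \<open>\<theta>\<close> gives these the determinants \<open>s\<close> and
  \<open>r\<close>.\<close>

lemma Cauchy_weight: "Cauchy_function (weight k)"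
  unfolding Cauchy_function_def
proof (intro allI impI)
  fix r s :: real assume rs: "r > 0" "s > 0"
  obtain i j :: 'n where ij: "i \<noteq> k" "j \<noteq> k" "i \<noteq> j" by (rule two_indices_avoiding)
  define v where "v = unit_frame k (r + s)"
  have det: "frame_det v = r + s" by (simp add: v_def frame_det_unit_frame)
  then have v: "frame_det v \<noteq> 0" using rs by simp
  define \<theta> where "\<theta> = s / (r + s)"
  have \<theta>: "0 < \<theta>" "\<theta> < 1" using rs by (auto simp: \<theta>_def field_simps)
  define m where "m = (1 - \<theta>) *\<^sub>R v i + \<theta> *\<^sub>R v j"
  have ts: "\<theta> * (r + s) = s" using rs by (simp add: \<theta>_def)
  then have "(1 - \<theta>) * (r + s) = r" by (simp add: left_diff_distrib)
  with ts have dets: "frame_det (v(j := m)) = s" "frame_det (v(i := m)) = r"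
    unfolding m_def frame_det_midpoint[OF ij(3)] det by simp_all
  have "simplex_tensor v (\<lambda>_. v k) = simplex_tensor (v(j := m)) (\<lambda>_. v k) + simplex_tensor (v(i := m)) (\<lambda>_. v k)"
    by (rule simplex_tensor_cut[OF v ij(3) \<theta> m_def])
  moreover have "simplex_tensor v (\<lambda>_. v k) = weight k (r + s)"
    using simplex_tensor_vertex[OF v] det rs by simp
  moreover have "simplex_tensor (v(j := m)) (\<lambda>_. v k) = weight k s"
    using simplex_tensor_vertex[of "v(j := m)" k k] dets rs ij by simp
  moreover have "simplex_tensor (v(i := m)) (\<lambda>_. v k) = weight k r"
    using simplex_tensor_vertex[of "v(i := m)" k k] dets rs ij by simp
  ultimately show "weight k (r + s) = weight k r + weight k s" by simp
qed

theorem eq_M0: "\<exists>\<xi>. Cauchy_function \<xi> \<and> (\<forall>P\<in>polytopes_o. \<mu> P = M0 \<xi> p P)"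
proof -
  obtain k :: 'n where True by blast
  obtain \<kappa> where \<kappa>: "\<kappa> > 0"
    "\<And>v w. \<lbrakk>frame_det v \<noteq> 0; \<And>k. w \<bullet> v k = 1\<rbrakk>
      \<Longrightarrow> cvol (simplex0 (range v)) (w :: real^'n) = \<kappa> * \<bar>frame_det v\<bar>"
    using cvol_simplex by blast
  \<comment> \<open>\<open>weight\<close> takes a determinant and \<open>\<xi>\<close> a cone
    volume; on simplices they differ by the factor \<open>\<kappa>\<close>.\<close>
  define \<xi> where "\<xi> r = weight k (r / \<kappa>)" for r
  have C: "Cauchy_function \<xi>"
    using Cauchy_weight[of k] \<kappa>(1) by (simp add: Cauchy_function_def \<xi>_def add_divide_distrib)
  \<comment> \<open>The error of the formula is again a simple valuation, so checking it on
    simplices is enough.\<close>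
  define \<nu> where "\<nu> P x = \<mu> P x - M0 \<xi> p P x" for P x
  have val: "valuation_on polytopes_o \<nu>"
    using valuation M0_valuation[OF C, of p, where 'n = 'n]
    unfolding valuation_on_def \<nu>_def by (smt (verit))
  have low: "\<nu> P x = 0" if P: "P \<in> polytopes_o" "aff_dim P < int CARD('n)" for P x
    using vanishes_if_lowdim[OF P] facet_vectors_lowdim[OF polytopes_o_facts(2)[OF P(1)] P(2)]
    by (simp add: \<nu>_def M0_eq_sum_facet_vectors[OF P(1)])
  have "\<nu> P x = 0" if P: "P \<in> polytopes_o" for P x
  proof (cases "aff_dim P < int CARD('n)")
    case False
    interpret simple_valuation "\<lambda>P. \<nu> P x" "int CARD('n)"
      by (rule simple_valuation_eval[OF val low])
    show ?thesis
    proof (rule vanishes_if_vanishes_on_simplices)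
      fix V :: "(real^'n) set" assume V: "independent V" "int (card V) = int CARD('n)"
      obtain v :: "'n \<Rightarrow> real^'n" where v: "frame_det v \<noteq> 0" "V \<subseteq> range v"
        using frame_extending[OF V(1)] .
      have "card (range v) = CARD('n)" using frame_det_nonzero_imp(1)[OF v(1)] by (rule card_image)
      then have VV: "V = range v" using V(2) v(2) by (intro card_subset_eq) auto
      obtain w where w: "\<And>k. w \<bullet> v k = 1" using frame_dual[OF v(1), of "\<lambda>_. 1"] by blast
      have po: "simplex0 (range v) \<in> polytopes_o"
        by (rule finite_convex_hull_polytopes_o) simp
      have "M0 \<xi> p (simplex0 (range v)) x = tensor_power w p x * weight k \<bar>frame_det v\<bar>"
        unfolding M0_eq_sum_facet_vectors[OF po] facet_vectors_simplex[OF v(1) w]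
        using \<kappa>(1) by (simp add: \<kappa>(2)[OF v(1) w] \<xi>_def)
      moreover have "simplex_tensor v x = tensor_power w p x * weight k \<bar>frame_det v\<bar>"
        using simplex_tensor_eq[OF v(1) w, of x k] simplex_tensor_vertex[OF v(1), of k k] by simp
      ultimately show "\<nu> (simplex0 V) x = 0"
        by (simp add: \<nu>_def VV simplex_tensor_def)
    next
      show "aff_dim P = int CARD('n)" using False aff_dim_le_DIM[of P] by simp
    qed (use P polytopes_o_facts in auto)
  qed (rule low[OF P])
  then have "\<forall>P\<in>polytopes_o. \<mu> P = M0 \<xi> p P" by (auto simp: \<nu>_def fun_eq_iff)
  with C show ?thesis by blast
qed

end

theorem corollary3:
  fixes \<mu> :: "(real ^ 'n::finite) set \<Rightarrow> 'n tensor" and p :: nat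
  assumes "CARD('n) \<ge> 3" and "p \<ge> 1"
    and "\<And>P. P \<in> polytopes_o \<Longrightarrow> \<mu> P \<in> Sym_tensors p"
  shows "SL_contravariant \<mu> \<and> valuation_on polytopes_o \<mu> \<longleftrightarrow>
    (\<exists>\<xi>. Cauchy_function \<xi> \<and> (\<forall>P\<in>polytopes_o. \<mu> P = M0 \<xi> p P))"
proof
  assume "SL_contravariant \<mu> \<and> valuation_on polytopes_o \<mu>"
  then interpret contravariant_valuation \<mu> p
    using assms by unfold_locales auto
  show "\<exists>\<xi>. Cauchy_function \<xi> \<and> (\<forall>P\<in>polytopes_o. \<mu> P = M0 \<xi> p P)" by (rule eq_M0)
next
  assume "\<exists>\<xi>. Cauchy_function \<xi> \<and> (\<forall>P\<in>polytopes_o. \<mu> P = M0 \<xi> p P)"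
  then obtain \<xi> where \<xi>: "Cauchy_function \<xi>" "\<And>P. P \<in> polytopes_o \<Longrightarrow> \<mu> P = M0 \<xi> p P" by blast
  have "SL_contravariant \<mu>"
    unfolding SL_contravariant_def
  proof (intro allI ballI impI)
    fix \<phi> :: "real^'n^'n" and P :: "(real^'n) set"
    assume P: "P \<in> polytopes_o" and det: "det \<phi> = 1"
    \<comment> \<open>\<open>\<mu>\<close> agrees with the formula only on
      \<open>polytopes_o\<close>, so the image must be known to lie there.\<close>
    have "(\<lambda>x. \<phi> *v x) ` P \<in> polytopes_o"
      using P polytope_linear_image[OF matrix_vector_mul_linear[of \<phi>], of P]
      by (auto simp: polytopes_o_def intro: image_eqI[of _ _ 0])
    then show "\<mu> ((\<lambda>x. \<phi> *v x) ` P) = tensor_act (transpose (matrix_inv \<phi>)) (\<mu> P)"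
      using M0_SL_contravariant[of \<xi> p, where 'n = 'n] P det by (simp add: \<xi>(2) SL_contravariant_def)
  qed
  moreover have "valuation_on polytopes_o \<mu>"
    using M0_valuation[OF \<xi>(1), of p, where 'n = 'n] by (simp add: valuation_on_def \<xi>(2))
  ultimately show "SL_contravariant \<mu> \<and> valuation_on polytopes_o \<mu>" ..
qed

end
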